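(* For any $k\in\mathbb{N}$, there exist a natural number $n$ and a sequence of graphs $K_n\rightarrow G^{(1)}\rightarrow\cdots\rightarrow G^{(k)}$, each obtained from the previous one by a $\Delta Y$-move, such that $\mathrm{cr}(K_n)>\mathrm{cr}(G^{(1)})>\cdots>\mathrm{cr}(G^{(k)})$.
   Context: $K_n$ is the complete graph on $n$ vertices. A drawing of a graph is a continuous map from the graph (viewed as a topological 1-complex) to the plane $\mathbb{R}^2$ whose only multiple points are finitely many transversal double points (crossings), none at images of vertices. The crossing number $\mathrm{cr}(G)$ of a graph $G$ is the minimum number of crossings over all drawings of $G$. A $\Delta Y$-move on a $3$-cycle with vertices $v_1,v_2,v_3$ of a graph removes the three edges $v_1v_2$, $v_2v_3$, $v_3v_1$, adds a new vertex $v$, and adds the three edges $vv_1$, $vv_2$, $vv_3$. *)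

theory Defs
  imports "HOL-Analysis.Analysis"
begin

datatype 'a ugraph = UGraph (verts: "'a set") (edges: "'a set set")

definition simple_graph :: "'a ugraph \<Rightarrow> bool" where
  "simple_graph G \<longleftrightarrow> finite (verts G) \<and> (\<forall>e\<in>edges G. e \<subseteq> verts G \<and> card e = 2)"

definition complete_graph :: "nat \<Rightarrow> nat ugraph" where
  "complete_graph n = UGraph {1..n} {e. e \<subseteq> {1..n} \<and> card e = 2}"

definition delta_Y_move :: "'a ugraph \<Rightarrow> 'a ugraph \<Rightarrow> bool" where
  "delta_Y_move G H \<longleftrightarrow>
     (\<exists>v1 v2 v3 v.
        v1 \<noteq> v2 \<and> v2 \<noteq> v3 \<and> v3 \<noteq> v1 \<and>
        {v1, v2} \<in> edges G \<and> {v2, v3} \<in> edges G \<and> {v3, v1} \<in> edges G \<and>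
        v \<notin> verts G \<and>
        H = UGraph (insert v (verts G))
              ((edges G - {{v1, v2}, {v2, v3}, {v3, v1}}) \<union> {{v, v1}, {v, v2}, {v, v3}}))"

text \<open>As a set, the topological 1-complex of a graph is the disjoint union of its vertices and
  of one open unit interval for each edge.  A continuous map from this complex to the plane
  (here \<^typ>\<open>complex\<close>) is given by the images \<open>f v\<close> of the vertices together with, for each
  edge \<open>e\<close>, a path \<open>\<gamma> e\<close> on \<open>[0,1]\<close> joining the images of the two ends of \<open>e\<close>.\<close>

datatype 'a cpoint = Vertex_Point 'a | Edge_Point "'a set" real

definition complex_points :: "'a ugraph \<Rightarrow> 'a cpoint set" where
  "complex_points G =
     Vertex_Point ` verts G \<union> {Edge_Point e t | e t. e \<in> edges G \<and> 0 < t \<and> t < 1}"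

fun drawing_map :: "('a \<Rightarrow> complex) \<Rightarrow> ('a set \<Rightarrow> real \<Rightarrow> complex) \<Rightarrow> 'a cpoint \<Rightarrow> complex" where
  "drawing_map f \<gamma> (Vertex_Point v) = f v"
| "drawing_map f \<gamma> (Edge_Point e t) = \<gamma> e t"

definition fibre ::
  "'a ugraph \<Rightarrow> ('a \<Rightarrow> complex) \<Rightarrow> ('a set \<Rightarrow> real \<Rightarrow> complex) \<Rightarrow> complex \<Rightarrow> 'a cpoint set" where
  "fibre G f \<gamma> p = {x \<in> complex_points G. drawing_map f \<gamma> x = p}"

definition multiple_points ::
  "'a ugraph \<Rightarrow> ('a \<Rightarrow> complex) \<Rightarrow> ('a set \<Rightarrow> real \<Rightarrow> complex) \<Rightarrow> complex set" where
  "multiple_points G f \<gamma> = {p. \<exists>x\<in>fibre G f \<gamma> p. \<exists>y\<in>fibre G f \<gamma> p. x \<noteq> y}"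

text \<open>Drawings are only continuous, so transversality is topological: in a suitable local chart of
  the plane centred at the common point, the two branches are the two coordinate axes.\<close>

definition transversal_at ::
  "(real \<Rightarrow> complex) \<Rightarrow> real \<Rightarrow> (real \<Rightarrow> complex) \<Rightarrow> real \<Rightarrow> bool" where
  "transversal_at \<alpha> s \<beta> t \<longleftrightarrow>
     \<alpha> s = \<beta> t \<and>
     (\<exists>U h h' a b c d.
        open U \<and> homeomorphism U (ball 0 1) h h' \<and>
        0 \<le> a \<and> a < s \<and> s < b \<and> b \<le> 1 \<and>
        0 \<le> c \<and> c < t \<and> t < d \<and> d \<le> 1 \<and>
        inj_on \<alpha> {a<..<b} \<and> \<alpha> ` {a<..<b} \<subseteq> U \<and>
        inj_on \<beta> {c<..<d} \<and> \<beta> ` {c<..<d} \<subseteq> U \<and>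
        h (\<alpha> s) = 0 \<and>
        h ` \<alpha> ` {a<..<b} = {z \<in> ball 0 1. Im z = 0} \<and>
        h ` \<beta> ` {c<..<d} = {z \<in> ball 0 1. Re z = 0})"

definition is_drawing ::
  "'a ugraph \<Rightarrow> ('a \<Rightarrow> complex) \<Rightarrow> ('a set \<Rightarrow> real \<Rightarrow> complex) \<Rightarrow> bool" where
  "is_drawing G f \<gamma> \<longleftrightarrow>
     (\<forall>e\<in>edges G. path (\<gamma> e) \<and> {pathstart (\<gamma> e), pathfinish (\<gamma> e)} = f ` e) \<and>
     finite (multiple_points G f \<gamma>) \<and>
     (\<forall>p\<in>multiple_points G f \<gamma>. \<exists>e s e' t.
        fibre G f \<gamma> p = {Edge_Point e s, Edge_Point e' t} \<and>
        transversal_at (\<gamma> e) s (\<gamma> e') t)"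

definition crossing_number :: "'a ugraph \<Rightarrow> nat" where
  "crossing_number G =
     (LEAST c. \<exists>f \<gamma>. is_drawing G f \<gamma> \<and> card (multiple_points G f \<gamma>) = c)"

lemma simple_graph_complete_graph: "simple_graph (complete_graph n)"
  by (auto simp: simple_graph_def complete_graph_def)

lemma simple_graph_delta_Y_move:
  assumes "simple_graph G" "delta_Y_move G H"
  shows "simple_graph H"
proof -
  obtain v1 v2 v3 v where
    e: "{v1, v2} \<in> edges G" "{v2, v3} \<in> edges G" and v: "v \<notin> verts G"
    and H: "H = UGraph (insert v (verts G))
              ((edges G - {{v1, v2}, {v2, v3}, {v3, v1}}) \<union> {{v, v1}, {v, v2}, {v, v3}})"
    using assms(2) unfolding delta_Y_move_def by blast
  have "v1 \<in> verts G" "v2 \<in> verts G" "v3 \<in> verts G"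
    using e assms(1) unfolding simple_graph_def by blast+
  moreover from this have "v \<noteq> v1" "v \<noteq> v2" "v \<noteq> v3"
    using v by auto
  ultimately show ?thesis
    using assms(1) unfolding H simple_graph_def by auto
qed

end

theory Submission
  imports Defs "HOL-Complex_Analysis.Winding_Numbers"
begin

text \<open>
  Let \<open>G\<close> contain a large clique and consider a drawing of \<open>G\<close> with the minimal number of
  crossings; cutting out loops, we may take every edge to be an arc.

  If two adjacent edges \<open>ab\<close> and \<open>ac\<close> of the clique cross at \<open>p\<close>, put the new vertex of the
  \<open>\<Delta>Y\<close>-move on \<open>abc\<close> at \<open>p\<close> and use subarcs of \<open>ab\<close> and \<open>ac\<close> as its three edges: the crossing
  \<open>p\<close> disappears and no new one arises.

  Otherwise every crossing inside the clique involves four vertices.  Every \<open>K\<^sub>5\<close> has a crossing, so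
  counting 5-subsets yields of the order of \<open>m\<^sup>4\<close> crossings in a clique of size \<open>m\<close>, and some edge
  \<open>xy\<close> of the clique has more crossings than \<open>G\<close> has vertices.  For any further \<open>c\<close> in the clique,
  the \<open>\<Delta>Y\<close>-move on \<open>cxy\<close> deletes \<open>xy\<close>, and the new star can be drawn along \<open>cx\<close> and \<open>cy\<close>,
  joining them in a small disc around \<open>c\<close> at the cost of at most one crossing per edge at \<open>c\<close>.

  In both cases the crossing number drops, and the clique loses at most three vertices; so starting
  from a sufficiently large complete graph the step can be repeated \<open>k\<close> times.
\<close>

section \<open>Plane geometry\<close>

definition wedge :: "complex \<Rightarrow> complex \<Rightarrow> real" where
  "wedge u w = Re u * Im w - Im u * Re w"

lemma wedge_eq_inner: "wedge u w = (\<i> * u) \<bullet> w"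
  by (simp add: wedge_def inner_complex_def)

interpretation wedge: bounded_bilinear wedge
  unfolding wedge_eq_inner
  by (rule bounded_bilinear.comp1[OF bounded_bilinear_inner bounded_linear_mult_right])

lemma wedge_self [simp]: "wedge u u = 0"
  by (simp add: wedge_def)

lemma wedge_commute: "wedge u w = - wedge w u"
  by (simp add: wedge_def)

lemma wedge_eq_0_imp_zero:
  assumes "wedge u w \<noteq> 0" "wedge u z = 0" "wedge w z = 0"
  shows "z = 0"
proof -
  have "wedge u w *\<^sub>R z = wedge u z *\<^sub>R w - wedge w z *\<^sub>R u"
    by (simp add: wedge_def complex_eq_iff algebra_simps)
  then show ?thesis
    using assms by simp
qed

lemma in_closed_segmentE:
  fixes a b :: "'a::real_vector"
  assumes "x \<in> closed_segment a b"
  obtains u where "0 \<le> u" "u \<le> 1" "x = a + u *\<^sub>R (b - a)"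
  using assms by (auto simp: in_segment algebra_simps)

lemma wedge_closed_segment:
  assumes "x \<in> closed_segment a b" "y \<in> closed_segment a b"
  shows "wedge (b - a) (y - x) = 0"
proof -
  obtain s where s: "x = a + s *\<^sub>R (b - a)"
    using assms(1) by (rule in_closed_segmentE)
  obtain t where t: "y = a + t *\<^sub>R (b - a)"
    using assms(2) by (rule in_closed_segmentE)
  have "y - x = (t - s) *\<^sub>R (b - a)"
    unfolding s t by (simp add: algebra_simps)
  then show ?thesis
    by (simp add: wedge.scaleR_right)
qed

lemma transversal_segments_meet_once:
  assumes "wedge (b - a) (d - c) \<noteq> 0"
    and "p \<in> closed_segment a b" "p \<in> closed_segment c d" "q \<in> closed_segment a b"
      "q \<in> closed_segment c d"
  shows "p = q"
  using wedge_eq_0_imp_zero[OF assms(1), of "p - q"] wedge_closed_segment assms(2-5) by simp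

lemma crossing_segments_transversal:
  assumes "wedge (b - a) (c - a) \<noteq> 0" "p \<in> closed_segment a b" "p \<in> closed_segment c d"
  shows "wedge (b - a) (d - c) \<noteq> 0"
proof
  assume parallel: "wedge (b - a) (d - c) = 0"
  obtain t where "p = c + t *\<^sub>R (d - c)"
    using assms(3) by (rule in_closed_segmentE)
  then have "p - a = (c - a) + t *\<^sub>R (d - c)"
    by simp
  then have "wedge (b - a) (p - a) = wedge (b - a) (c - a)"
    using parallel
    by (simp only: wedge.add_right wedge.scaleR_right real_scaleR_def mult_zero_right add_0_right)
  then show False
    using assms(1) wedge_closed_segment[OF _ assms(2)] by simp
qed

lemma exists_off_finite_lines:
  assumes "open S" "S \<noteq> {}" "finite L" "\<And>a d. (a, d) \<in> L \<Longrightarrow> d \<noteq> 0"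
  obtains q where "q \<in> S" "\<And>a d. (a, d) \<in> L \<Longrightarrow> wedge d (q - a) \<noteq> 0"
proof -
  have "negligible {q. wedge d (q - a) = 0}" if "(a, d) \<in> L" for a d
    using negligible_hyperplane[of "\<i> * d" "(\<i> * d) \<bullet> a"] assms(4)[OF that]
    by (simp add: wedge_eq_inner inner_diff_right)
  then have "negligible (\<Union>(a, d)\<in>L. {q. wedge d (q - a) = 0})"
    using assms(3) by (intro negligible_Union) auto
  then have "\<not> S \<subseteq> (\<Union>(a, d)\<in>L. {q. wedge d (q - a) = 0})"
    using open_not_negligible[OF assms(1,2)] negligible_subset by blast
  then show thesis
    using that by blast
qed

lemma closed_segment_subset_ball:
  fixes P Q o' :: "'a::euclidean_space"
  assumes "P \<in> cball o' r" "Q \<in> cball o' r"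
  shows "closed_segment P Q \<subseteq> insert P (insert Q (ball o' r))"
  using dist_decreases_open_segment[of _ P Q o'] assms
  by (force simp: closed_segment_eq_open dist_commute)

lemma radial_segments_meet:
  fixes P Q c o' :: "'a::euclidean_space"
  assumes P: "P \<in> sphere o' r" and Q: "Q \<in> sphere o' r" and "P \<noteq> Q" and c: "c \<in> ball o' r"
    and x: "x \<in> closed_segment c P" "x \<in> closed_segment c Q"
  shows "x = c"
proof (rule ccontr)
  assume "x \<noteq> c"
  obtain s where s: "0 \<le> s" "x = c + s *\<^sub>R (P - c)"
    using x(1) by (rule in_closed_segmentE)
  obtain t where t: "0 \<le> t" "x = c + t *\<^sub>R (Q - c)"
    using x(2) by (rule in_closed_segmentE)
  have pos: "0 < s" "0 < t" and eq: "s *\<^sub>R (P - c) = t *\<^sub>R (Q - c)"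
    using s t \<open>x \<noteq> c\<close> by (auto simp: less_le)
  have shadowed: "Q \<in> closed_segment c P"
    if st: "0 < s" "s \<le> t" and eq: "s *\<^sub>R (P - c) = t *\<^sub>R (Q - c)" for s t P Q
  proof -
    have "Q - c = inverse t *\<^sub>R (t *\<^sub>R (Q - c))"
      using st by simp
    also have "\<dots> = (s / t) *\<^sub>R (P - c)"
      unfolding eq[symmetric] by (simp add: field_simps)
    finally have "Q - c = (s / t) *\<^sub>R (P - c)" .
    then have "Q = (1 - s / t) *\<^sub>R c + (s / t) *\<^sub>R P"
      by (simp add: algebra_simps)
    then show ?thesis
      using st unfolding in_segment by (intro exI[of _ "s / t"]) simp
  qed
  have "Q \<in> closed_segment c P \<or> P \<in> closed_segment c Q"
    using shadowed[OF pos(1) _ eq] shadowed[OF pos(2) _ eq[symmetric]] by linarith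
  moreover have "Q = P" if "P \<in> sphere o' r" "Q \<in> sphere o' r" "Q \<in> closed_segment c P" for P Q
    using closed_segment_subset_ball[of c o' r P] that c by auto
  ultimately show False
    using P Q \<open>P \<noteq> Q\<close> by metis
qed

section \<open>Nonplanarity of the complete graph on five vertices\<close>

lemma connected_arc_image_minus_pathstart:
  assumes "arc g"
  shows "connected (path_image g - {pathstart g})"
proof -
  have g: "inj_on g {0..1}" "continuous_on {0..1} g"
    using assms by (auto simp: arc_def path_def)
  have "path_image g - {pathstart g} = g ` ({0..1} - {0})"
    unfolding path_image_def pathstart_def by (subst inj_on_image_set_diff[OF g(1)]) auto
  also have "{0..1} - {0} = {0::real<..1}"
    by auto
  finally show ?thesis
    using g(2) by (auto intro!: connected_continuous_image intro: continuous_on_subset)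
qed

locale embedded_complete_graph =
  fixes S :: "'a set" and v :: "'a \<Rightarrow> complex" and g :: "'a \<Rightarrow> 'a \<Rightarrow> real \<Rightarrow> complex"
  assumes arc_edge: "\<lbrakk>i \<in> S; j \<in> S; i \<noteq> j\<rbrakk> \<Longrightarrow> arc (g i j)"
    and pathstart_edge: "\<lbrakk>i \<in> S; j \<in> S; i \<noteq> j\<rbrakk> \<Longrightarrow> pathstart (g i j) = v i"
    and pathfinish_edge: "\<lbrakk>i \<in> S; j \<in> S; i \<noteq> j\<rbrakk> \<Longrightarrow> pathfinish (g i j) = v j"
    and reverse_edge: "\<lbrakk>i \<in> S; j \<in> S; i \<noteq> j\<rbrakk> \<Longrightarrow> g j i = reversepath (g i j)"
    and inj_vertex: "inj_on v S"
    and edges_meet: "\<lbrakk>i \<in> S; j \<in> S; i \<noteq> j; k \<in> S; l \<in> S; k \<noteq> l; {i,j} \<noteq> {k,l}\<rbrakk>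
      \<Longrightarrow> path_image (g i j) \<inter> path_image (g k l) \<subseteq> v ` ({i,j} \<inter> {k,l})"
begin

definition triangle_image :: "'a \<Rightarrow> 'a \<Rightarrow> 'a \<Rightarrow> complex set" where
  "triangle_image i j k = path_image (g i j) \<union> path_image (g j k) \<union> path_image (g k i)"

definition triangle_path :: "'a \<Rightarrow> 'a \<Rightarrow> 'a \<Rightarrow> real \<Rightarrow> complex" where
  "triangle_path i j k = g i j +++ g j k +++ g k i"

lemma path_image_commute: "\<lbrakk>i \<in> S; j \<in> S; i \<noteq> j\<rbrakk> \<Longrightarrow> path_image (g j i) = path_image (g i j)"
  using reverse_edge[of i j] by simp

lemma ends_in_path_image:
  assumes "i \<in> S" "j \<in> S" "i \<noteq> j"
  shows "v i \<in> path_image (g i j)" "v j \<in> path_image (g i j)"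
  using assms pathstart_edge pathfinish_edge
  by (metis pathstart_in_path_image, metis pathfinish_in_path_image)

lemma adjacent_edges_meet:
  assumes "i \<in> S" "j \<in> S" "k \<in> S" "i \<noteq> j" "j \<noteq> k" "i \<noteq> k"
  shows "path_image (g i j) \<inter> path_image (g j k) = {v j}"
proof -
  have "path_image (g i j) \<inter> path_image (g j k) \<subseteq> v ` ({i,j} \<inter> {j,k})"
    by (rule edges_meet) (use assms in auto)
  also have "{i,j} \<inter> {j,k} = {j}"
    using assms by auto
  finally show ?thesis
    using assms ends_in_path_image by blast
qed

lemma disjoint_edges_meet:
  assumes "i \<in> S" "j \<in> S" "k \<in> S" "l \<in> S" "distinct [i,j,k,l]"
  shows "path_image (g i j) \<inter> path_image (g k l) = {}"
proof -
  have "path_image (g i j) \<inter> path_image (g k l) \<subseteq> v ` ({i,j} \<inter> {k,l})"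
    by (rule edges_meet) (use assms in auto)
  also have "{i,j} \<inter> {k,l} = {}"
    using assms by auto
  finally show ?thesis by simp
qed

lemma triangle_permute:
  assumes "i \<in> S" "j \<in> S" "k \<in> S" "distinct [i,j,k]"
  shows "triangle_image j k i = triangle_image i j k" "triangle_image j i k = triangle_image i j k"
  using assms by (auto simp: triangle_image_def path_image_commute)

lemma vertex_in_triangle:
  assumes "i \<in> S" "j \<in> S" "k \<in> S" "distinct [i,j,k]"
  shows "v i \<in> triangle_image i j k" "v j \<in> triangle_image i j k" "v k \<in> triangle_image i j k"
  using assms ends_in_path_image by (auto simp: triangle_image_def)

lemma vertex_notin_triangle:
  assumes "i \<in> S" "j \<in> S" "k \<in> S" "l \<in> S" "distinct [i,j,k,l]"
  shows "v l \<notin> triangle_image i j k"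
proof -
  have "v l \<notin> path_image (g a b)" if ab: "a \<in> S" "b \<in> S" "a \<noteq> b" "a \<noteq> l" "b \<noteq> l" for a b
  proof
    assume "v l \<in> path_image (g a b)"
    then have "v l \<in> path_image (g a b) \<inter> path_image (g b l)"
      using ends_in_path_image ab assms(4) by blast
    then show False
      using adjacent_edges_meet[of a b l] ab assms(4) inj_vertex by (auto simp: inj_on_eq_iff)
  qed
  then show ?thesis
    using assms by (auto simp: triangle_image_def)
qed

lemma triangle_meets_edge:
  assumes "i \<in> S" "j \<in> S" "k \<in> S" "l \<in> S" "distinct [i,j,k,l]"
  shows "triangle_image i j k \<inter> path_image (g i l) = {v i}"
proof
  have distinct: "j \<noteq> i" "k \<noteq> i" "i \<noteq> l" "j \<noteq> l" "k \<noteq> l" "distinct [j,k,i,l]"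
    using assms by auto
  show "triangle_image i j k \<inter> path_image (g i l) \<subseteq> {v i}"
    using adjacent_edges_meet[of j i l] adjacent_edges_meet[of k i l] disjoint_edges_meet[of j k i l]
      path_image_commute[of j i] assms(1-4) distinct
    unfolding triangle_image_def by blast
  show "{v i} \<subseteq> triangle_image i j k \<inter> path_image (g i l)"
    using assms ends_in_path_image vertex_in_triangle[of i j k] by auto
qed

lemma two_edge_path:
  assumes "i \<in> S" "j \<in> S" "k \<in> S" "distinct [i,j,k]"
  shows "arc (g i j +++ g j k)" "pathstart (g i j +++ g j k) = v i" "pathfinish (g i j +++ g j k) = v k"
    "path_image (g i j +++ g j k) = path_image (g i j) \<union> path_image (g j k)"
  using assms adjacent_edges_meet[of i j k]
  by (auto simp: pathstart_edge pathfinish_edge path_image_join intro!: arc_join arc_edge)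

lemma triangle_path:
  assumes "i \<in> S" "j \<in> S" "k \<in> S" "distinct [i,j,k]"
  shows "simple_path (triangle_path i j k)" "path_image (triangle_path i j k) = triangle_image i j k"
    "pathstart (triangle_path i j k) = v i" "pathfinish (triangle_path i j k) = v i"
proof -
  have "path_image (g i j) \<inter> path_image (g j k +++ g k i) \<subseteq> {v i, v j}"
    using assms adjacent_edges_meet[of i j k] adjacent_edges_meet[of k i j] two_edge_path[of j k i]
    by auto
  then show "simple_path (triangle_path i j k)"
    unfolding triangle_path_def using assms two_edge_path[of j k i]
    by (intro simple_path_join_loop) (auto simp: pathstart_edge pathfinish_edge arc_edge)
  show "path_image (triangle_path i j k) = triangle_image i j k"
    "pathstart (triangle_path i j k) = v i" "pathfinish (triangle_path i j k) = v i"
    using assms two_edge_path[of j k i]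
    by (auto simp: triangle_path_def pathstart_edge pathfinish_edge triangle_image_def path_image_join)
qed

lemma winding_number_triangle_path_nonzero_iff:
  assumes "i \<in> S" "j \<in> S" "k \<in> S" "distinct [i,j,k]" "p \<notin> triangle_image i j k"
  shows "winding_number (triangle_path i j k) p \<noteq> 0 \<longleftrightarrow> p \<in> inside (triangle_image i j k)"
proof -
  note loop = triangle_path[OF assms(1-4)]
  have "winding_number (triangle_path i j k) p \<noteq> 0" if "p \<in> inside (triangle_image i j k)"
    using simple_closed_path_norm_winding_number_inside[of "triangle_path i j k" p] loop that
    by (metis norm_zero zero_neq_one)
  moreover have "winding_number (triangle_path i j k) p = 0" if "p \<notin> inside (triangle_image i j k)"
  proof -
    have "p \<in> outside (path_image (triangle_path i j k))"
      using that assms(5) loop(2) by (simp add: outside_inside)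
    then show ?thesis
      using loop winding_number_zero_in_outside simple_path_imp_path by metis
  qed
  ultimately show ?thesis by blast
qed

lemma winding_number_triangle_path:
  assumes "i \<in> S" "j \<in> S" "k \<in> S" "distinct [i,j,k]" "p \<notin> triangle_image i j k"
  shows "winding_number (triangle_path i j k) p =
    winding_number (g i j) p + winding_number (g j k) p + winding_number (g k i) p"
proof -
  have distinct: "i \<noteq> j" "j \<noteq> k" "k \<noteq> i" "distinct [j,k,i]"
    using assms by auto
  have "path (g i j)" "path (g j k)" "path (g k i)" "path (g j k +++ g k i)"
    using assms distinct arc_edge two_edge_path(1)[of j k i] arc_imp_path by blast+
  moreover have "p \<notin> path_image (g i j)" "p \<notin> path_image (g j k)" "p \<notin> path_image (g k i)"
    "p \<notin> path_image (g j k +++ g k i)"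
    using assms distinct two_edge_path(4)[of j k i] by (auto simp: triangle_image_def)
  ultimately show ?thesis
    using assms distinct unfolding triangle_path_def
    by (simp add: winding_number_join pathstart_edge pathfinish_edge)
qed

lemma winding_number_triangle_path_cone:
  assumes S: "i \<in> S" "j \<in> S" "k \<in> S" "l \<in> S" "distinct [i,j,k,l]"
    and p: "p \<notin> triangle_image i j k" "p \<notin> triangle_image i j l" "p \<notin> triangle_image j k l"
  shows "winding_number (triangle_path i j k) p = winding_number (triangle_path i j l) p +
    winding_number (triangle_path j k l) p + winding_number (triangle_path k i l) p"
proof -
  have p': "p \<notin> triangle_image k i l"
    using p S by (auto simp: triangle_image_def path_image_commute)
  have "winding_number (g l a) p = - winding_number (g a l) p"
    if "a \<in> S" "a \<noteq> l" "p \<notin> path_image (g a l)" for a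
    using that S reverse_edge[of a l] arc_edge[of a l]
    by (simp add: winding_number_reversepath arc_imp_path)
  moreover have "distinct [i,j,k]" "distinct [i,j,l]" "distinct [j,k,l]" "distinct [k,i,l]"
    "i \<noteq> l" "j \<noteq> l" "k \<noteq> l"
    using S by auto
  moreover have "p \<notin> path_image (g i l)" "p \<notin> path_image (g j l)" "p \<notin> path_image (g k l)"
    using p p' by (auto simp: triangle_image_def)
  ultimately show ?thesis
    using S(1-4) p p' by (simp add: winding_number_triangle_path)
qed

lemma inside_triangle_exchange:
  assumes S: "i \<in> S" "j \<in> S" "k \<in> S" "l \<in> S" "distinct [i,j,k,l]"
    and l: "v l \<in> inside (triangle_image i j k)"
  shows "v k \<notin> inside (triangle_image i j l)"
proof -
  have theta: "path_image (g i j) \<union> path_image (g i k +++ g k j) = triangle_image i j k"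
    "path_image (g i j) \<union> path_image (g i l +++ g l j) = triangle_image i j l"
    using S two_edge_path[of i k j] two_edge_path[of i l j]
    by (auto simp: triangle_image_def path_image_commute)
  have meets: "path_image (g i j) \<inter> path_image (g i k +++ g k j) = {v i, v j}"
    "path_image (g i j) \<inter> path_image (g i l +++ g l j) = {v i, v j}"
    "path_image (g i k +++ g k j) \<inter> path_image (g i l +++ g l j) = {v i, v j}"
    using S two_edge_path[of i k j] two_edge_path[of i l j]
      adjacent_edges_meet[of j i k] adjacent_edges_meet[of i j k]
      adjacent_edges_meet[of j i l] adjacent_edges_meet[of i j l]
      adjacent_edges_meet[of k i l] adjacent_edges_meet[of k j l]
      disjoint_edges_meet[of i k l j] disjoint_edges_meet[of k j i l]
    by (auto simp: path_image_commute)
  have nonempty: "path_image (g i l +++ g l j) \<inter>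
      inside (path_image (g i j) \<union> path_image (g i k +++ g k j)) \<noteq> {}"
    using l theta S two_edge_path[of i l j] ends_in_path_image[of i l] by auto
  have "i \<noteq> j" "distinct [i,k,j]" "distinct [i,l,j]"
    using S by auto
  then have "simple_path (g i j)" "pathstart (g i j) = v i" "pathfinish (g i j) = v j"
    "simple_path (g i k +++ g k j)" "pathstart (g i k +++ g k j) = v i"
    "pathfinish (g i k +++ g k j) = v j"
    "simple_path (g i l +++ g l j)" "pathstart (g i l +++ g l j) = v i"
    "pathfinish (g i l +++ g l j) = v j"
    "v i \<noteq> v j"
    using S(1-4) two_edge_path[of i k j] two_edge_path[of i l j] inj_vertex
    by (simp_all add: inj_on_eq_iff arc_imp_simple_path arc_edge pathstart_edge pathfinish_edge)
  from split_inside_simple_closed_curve[OF this meets nonempty]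
  have "inside (triangle_image i j l) \<subseteq> inside (triangle_image i j k)"
    unfolding theta by blast
  moreover have "v k \<in> triangle_image i j k"
    using S by (auto intro: vertex_in_triangle)
  ultimately show ?thesis
    using inside_no_overlap by blast
qed

lemma inside_triangle_disjoint_edge:
  assumes S: "i \<in> S" "j \<in> S" "k \<in> S" "l \<in> S" "distinct [i,j,k,l]"
    and l: "v l \<notin> inside (triangle_image i j k)"
  shows "inside (triangle_image i j k) \<inter> path_image (g i l) = {}"
proof -
  let ?E = "path_image (g i l) - {v i}"
  have "connected ?E"
    using connected_arc_image_minus_pathstart[of "g i l"] arc_edge[of i l] pathstart_edge[of i l] S
    by simp
  moreover have "?E \<inter> triangle_image i j k = {}"
    using triangle_meets_edge[OF S] by blast
  moreover have "v l \<in> ?E \<inter> outside (triangle_image i j k)"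
    using S l vertex_notin_triangle[OF S] ends_in_path_image[of i l] inj_vertex
    by (auto simp: outside_inside inj_on_eq_iff)
  ultimately have "inside (triangle_image i j k) \<inter> ?E = {}"
    using inside_outside_intersect_connected[of ?E "triangle_image i j k"] by blast
  moreover have "v i \<notin> inside (triangle_image i j k)"
    using S vertex_in_triangle(1)[of i j k] inside_no_overlap[of "triangle_image i j k"] by fastforce
  ultimately show ?thesis
    by blast
qed

lemma inside_triangle_disjoint_triangle:
  assumes S: "i \<in> S" "j \<in> S" "k \<in> S" "l \<in> S" "distinct [i,j,k,l]"
    and l: "v l \<notin> inside (triangle_image i j k)"
  shows "inside (triangle_image i j k) \<inter> triangle_image i j l = {}"
proof -
  have "inside (triangle_image i j k) \<inter> path_image (g i l) = {}"
    by (rule inside_triangle_disjoint_edge[OF S l])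
  moreover have "inside (triangle_image i j k) \<inter> path_image (g j l) = {}"
    using inside_triangle_disjoint_edge[of j i k l] triangle_permute(2)[of i j k] S l by auto
  moreover have "path_image (g i j) \<subseteq> triangle_image i j k"
    by (auto simp: triangle_image_def)
  then have "inside (triangle_image i j k) \<inter> path_image (g i j) = {}"
    using inside_no_overlap[of "triangle_image i j k"] by blast
  ultimately show ?thesis
    using path_image_commute[of i l] S unfolding triangle_image_def[of i j l]
    by (auto simp: disjoint_iff)
qed

lemma vertex_inside_overlapping_triangle:
  assumes S: "i \<in> S" "j \<in> S" "k \<in> S" "l \<in> S" "distinct [i,j,k,l]"
    and l: "v l \<notin> inside (triangle_image i j k)"
    and p: "p \<in> inside (triangle_image i j k)" "p \<in> inside (triangle_image i j l)"
  shows "v k \<in> inside (triangle_image i j l)"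
proof -
  have distinct: "distinct [i,j,k]" "distinct [i,j,l]" "distinct [i,j,l,k]"
    using S by auto
  note Jordan_k = Jordan_inside_outside[OF triangle_path(1), OF S(1-3) distinct(1)]
  note Jordan_l = Jordan_inside_outside[OF triangle_path(1), OF S(1,2,4) distinct(2)]
  have "connected (inside (triangle_image i j k))"
    and frontier_k: "frontier (inside (triangle_image i j k)) = triangle_image i j k"
    using Jordan_k triangle_path[OF S(1-3) distinct(1)] by auto
  then have "inside (triangle_image i j k) \<subseteq> inside (triangle_image i j l)"
    using inside_outside_intersect_connected[of "inside (triangle_image i j k)" "triangle_image i j l"]
      inside_triangle_disjoint_triangle[OF S l] p inside_Un_outside[of "triangle_image i j l"] by blast
  then have "closure (inside (triangle_image i j k)) \<subseteq> closure (inside (triangle_image i j l))"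
    by (rule closure_mono)
  moreover have "v k \<in> closure (inside (triangle_image i j k))"
    using frontier_k vertex_in_triangle[OF S(1-3) distinct(1)] by (auto simp: frontier_def)
  moreover have "closure (inside (triangle_image i j l)) =
      inside (triangle_image i j l) \<union> triangle_image i j l"
    using Jordan_l triangle_path[OF S(1,2,4) distinct(2)] by (simp add: closure_Un_frontier)
  moreover have "v k \<notin> triangle_image i j l"
    using vertex_notin_triangle S(1-4) distinct(3) by blast
  ultimately show ?thesis by blast
qed

lemma some_vertex_inside:
  assumes S: "i \<in> S" "j \<in> S" "k \<in> S" "l \<in> S" "distinct [i,j,k,l]"
    and l: "v l \<notin> inside (triangle_image i j k)"
  shows "v k \<in> inside (triangle_image i j l) \<or> v i \<in> inside (triangle_image j k l) \<or>
      v j \<in> inside (triangle_image k i l)"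
proof -
  have distinct: "distinct [i,j,k]" "distinct [j,k,i,l]" "distinct [k,i,j,l]"
    using S by auto
  have rotate: "triangle_image j k i = triangle_image i j k"
    "triangle_image k i j = triangle_image i j k"
    using triangle_permute[of i j k] triangle_permute[of j k i] S by auto
  note loop = triangle_path[OF S(1-3) distinct(1)]
  obtain p where p: "p \<in> inside (triangle_image i j k)"
    using Jordan_inside_outside[OF loop(1)] loop by auto
  have "p \<notin> triangle_image i j k"
    using p inside_no_overlap by blast
  moreover have "p \<notin> triangle_image i j l" "p \<notin> triangle_image j k l" "p \<notin> triangle_image k i l"
    using p l rotate S(1-4) distinct
      inside_triangle_disjoint_triangle[OF S l] inside_triangle_disjoint_triangle[of j k i l]
      inside_triangle_disjoint_triangle[of k i j l] by (auto simp: disjoint_iff)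
  ultimately have "p \<in> inside (triangle_image i j l) \<or> p \<in> inside (triangle_image j k l) \<or>
      p \<in> inside (triangle_image k i l)"
    using winding_number_triangle_path_cone[OF S] p S
      winding_number_triangle_path_nonzero_iff[of i j k p]
      winding_number_triangle_path_nonzero_iff[of i j l p]
      winding_number_triangle_path_nonzero_iff[of j k l p]
      winding_number_triangle_path_nonzero_iff[of k i l p]
    by auto
  then show ?thesis
    using vertex_inside_overlapping_triangle[OF S l p] S(1-4) p l rotate distinct
      vertex_inside_overlapping_triangle[of j k i l p] vertex_inside_overlapping_triangle[of k i j l p]
    by auto
qed

lemma winding_number_triangle_path_other_vertices_eq:
  assumes S: "i \<in> S" "j \<in> S" "k \<in> S" "l \<in> S" "m \<in> S" "distinct [i,j,k,l,m]"
  shows "winding_number (triangle_path i j k) (v m) = winding_number (triangle_path i j k) (v l)"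
proof (rule winding_number_eq[where S = "path_image (g m l)"])
  show "path (triangle_path i j k)" "pathfinish (triangle_path i j k) = pathstart (triangle_path i j k)"
    "v m \<in> path_image (g m l)" "v l \<in> path_image (g m l)" "connected (path_image (g m l))"
    using S triangle_path[of i j k] ends_in_path_image[of m l] arc_edge[of m l]
    by (auto simp: simple_path_imp_path arc_imp_path)
  show "path_image (g m l) \<inter> path_image (triangle_path i j k) = {}"
    using S triangle_path[of i j k] disjoint_edges_meet[of m l] by (auto simp: triangle_image_def)
qed

lemma vertex_notin_inside_if_fifth_vertex:
  assumes S: "i \<in> S" "j \<in> S" "k \<in> S" "l \<in> S" "m \<in> S" "distinct [i,j,k,l,m]"
  shows "v l \<notin> inside (triangle_image i j k)"
proof
  assume l: "v l \<in> inside (triangle_image i j k)"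
  have zero: "winding_number (triangle_path a b l) (v m) = 0"
    if abc: "(a, b, c) \<in> {(i,j,k), (j,k,i), (k,i,j)}" for a b c
  proof -
    have S': "a \<in> S" "b \<in> S" "c \<in> S" "distinct [a,b,c,l]" "distinct [a,b,l,c,m]"
      and "triangle_image a b c = triangle_image i j k"
      using abc S triangle_permute[of i j k] triangle_permute[of j k i] by auto
    then have "v c \<notin> inside (triangle_image a b l)" "v c \<notin> triangle_image a b l"
      using inside_triangle_exchange[of a b c l] vertex_notin_triangle[of a b l c] l S(4) by auto
    then have "winding_number (triangle_path a b l) (v c) = 0"
      using winding_number_triangle_path_nonzero_iff[of a b l "v c"] S' S(4) by auto
    then show ?thesis
      using winding_number_triangle_path_other_vertices_eq[of a b l c m] S' S(4,5) by simp
  qed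
  have "winding_number (triangle_path i j k) (v m) = 0"
    using winding_number_triangle_path_cone[of i j k l "v m"] zero[of i j k] zero[of j k i]
      zero[of k i j]
      vertex_notin_triangle[of _ _ _ m] S by auto
  then have "winding_number (triangle_path i j k) (v l) = 0"
    using winding_number_triangle_path_other_vertices_eq[OF S] by simp
  moreover have "v l \<notin> triangle_image i j k"
    using vertex_notin_triangle[of i j k l] S by auto
  ultimately show False
    using winding_number_triangle_path_nonzero_iff[of i j k "v l"] l S by auto
qed

lemma card_vertices_le: "card S \<le> 4"
proof (rule ccontr)
  assume "\<not> card S \<le> 4"
  then obtain T where T: "T \<subseteq> S" "card T = 5"
    using obtain_subset_with_card_n[of 5 S] by auto
  then obtain xs where xs: "set xs = T" "distinct xs"
    using finite_distinct_list[of T] card.infinite[of T] by auto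
  then have "length xs = 5"
    using T(2) distinct_card by metis
  then obtain i j k l m where "xs = [i, j, k, l, m]"
    by (auto simp: length_Suc_conv numeral_eq_Suc)
  then have S: "i \<in> S" "j \<in> S" "k \<in> S" "l \<in> S" "m \<in> S" "distinct [i,j,k,l,m]"
    using xs T(1) by auto
  have "v d \<notin> inside (triangle_image a b c)"
    if "{a, b, c, d} \<subseteq> {i, j, k, l}" "distinct [a,b,c,d]" for a b c d
    by (rule vertex_notin_inside_if_fifth_vertex[where m = m]) (use S that in auto)
  then show False
    using some_vertex_inside[of i j k l] S by auto
qed

end

section \<open>Arcs between two points\<close>

definition arc_between :: "'a::topological_space set \<Rightarrow> 'a set \<Rightarrow> bool" where
  "arc_between A X \<longleftrightarrow> (\<exists>g. arc g \<and> path_image g = A \<and> {pathstart g, pathfinish g} = X)"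

lemma arc_betweenE:
  assumes "arc_between A {a, b}"
  obtains g where "arc g" "path_image g = A" "pathstart g = a" "pathfinish g = b"
proof -
  obtain g where g: "arc g" "path_image g = A" "{pathstart g, pathfinish g} = {a, b}"
    using assms by (auto simp: arc_between_def)
  then consider "pathstart g = a" "pathfinish g = b" | "pathstart g = b" "pathfinish g = a"
    by (auto simp: doubleton_eq_iff)
  then show thesis
  proof cases
    case 2
    then show thesis
      using that[of "reversepath g"] g by (simp add: arc_reversepath)
  qed (use that g in blast)
qed

lemma path_image_interiorE:
  assumes "p \<in> path_image g" "p \<noteq> pathstart g" "p \<noteq> pathfinish g"
  obtains s where "0 < s" "s < 1" "g s = p"
proof -
  obtain s where s: "0 \<le> s" "s \<le> 1" "g s = p"
    using assms(1) by (auto simp: path_image_def)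
  then have "s \<noteq> 0" "s \<noteq> 1"
    using assms by (auto simp: pathstart_def pathfinish_def)
  then show thesis
    using s that[of s] by simp
qed

lemma arc_between_interiorE:
  assumes "arc_between A X" "p \<in> A" "p \<notin> X"
  obtains g s where "arc g" "path_image g = A" "0 < s" "s < 1" "g s = p"
proof -
  obtain g where g: "arc g" "path_image g = A" "{pathstart g, pathfinish g} = X"
    using assms(1) by (auto simp: arc_between_def)
  then have "p \<in> path_image g" "p \<noteq> pathstart g" "p \<noteq> pathfinish g"
    using assms(2,3) by auto
  then show thesis
    using that g(1,2) path_image_interiorE by metis
qed

lemma arc_between_closed_segment:
  fixes a b :: "'a::real_normed_vector"
  shows "a \<noteq> b \<Longrightarrow> arc_between (closed_segment a b) {a, b}"
  unfolding arc_between_def by (intro exI[of _ "linepath a b"]) (auto simp: arc_linepath)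

lemma closed_arc_between: "arc_between A X \<Longrightarrow> closed A" for A :: "'a::t2_space set"
  by (auto simp: arc_between_def arc_imp_path compact_path_image compact_imp_closed)

lemma arc_between_join:
  assumes "arc_between A {a, p}" "arc_between B {p, b}" "A \<inter> B \<subseteq> {p}"
  shows "arc_between (A \<union> B) {a, b}"
proof -
  obtain g where g: "arc g" "path_image g = A" "pathstart g = a" "pathfinish g = p"
    using assms(1) by (rule arc_betweenE)
  obtain h where h: "arc h" "path_image h = B" "pathstart h = p" "pathfinish h = b"
    using assms(2) by (rule arc_betweenE)
  show ?thesis
    unfolding arc_between_def
    by (rule exI[of _ "g +++ h"]) (use g h assms(3) in \<open>auto simp: path_image_join intro!: arc_join\<close>)
qed

lemma arc_between_subarc:
  fixes g :: "real \<Rightarrow> 'a::real_normed_vector"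
  assumes "arc g" "0 \<le> u" "u < w" "w \<le> 1"
  shows "arc_between (g ` {u..w}) {g u, g w}"
  using assms unfolding arc_between_def
  by (intro exI[of _ "subpath u w g"]) (simp add: path_image_subpath arc_subpath_arc)

lemma arc_between_split:
  fixes A :: "'a::real_normed_vector set"
  assumes "arc_between A {a, b}" "p \<in> A" "p \<noteq> a" "p \<noteq> b"
  obtains B C where "arc_between B {p, a}" "arc_between C {p, b}" "B \<union> C = A" "B \<inter> C = {p}"
    "b \<notin> B" "a \<notin> C"
proof -
  obtain g where g: "arc g" "path_image g = A" "pathstart g = a" "pathfinish g = b"
    using assms(1) by (rule arc_betweenE)
  obtain s where s: "0 < s" "s < 1" "g s = p"
    using path_image_interiorE[of p g] g assms by auto
  have inj: "inj_on g {0..1}" and ends: "g 0 = a" "g 1 = b"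
    using g by (auto simp: arc_def pathstart_def pathfinish_def)
  show thesis
  proof (rule that[of "g ` {0..s}" "g ` {s..1}"])
    show "arc_between (g ` {0..s}) {p, a}" "arc_between (g ` {s..1}) {p, b}"
      using arc_between_subarc[OF g(1), of 0 s] arc_between_subarc[OF g(1), of s 1] s ends
      by (simp_all add: insert_commute)
    have "{0..1} = {0..s} \<union> {s..1}"
      using s by auto
    then show "g ` {0..s} \<union> g ` {s..1} = A"
      using g by (metis image_Un path_image_def)
    have "g ` {0..s} \<inter> g ` {s..1} = g ` ({0..s} \<inter> {s..1})"
      using s by (intro inj_on_image_Int[OF inj, symmetric]) auto
    also have "{0..s} \<inter> {s..1} = {s}"
      using s by auto
    finally show "g ` {0..s} \<inter> g ` {s..1} = {p}"
      using s by simp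
    have "g 1 \<notin> g ` {0..s}" "g 0 \<notin> g ` {s..1}"
      using s by (subst inj_on_image_mem_iff[OF inj]; auto)+
    then show "b \<notin> g ` {0..s}" "a \<notin> g ` {s..1}"
      using ends by auto
  qed
qed

lemma arc_between_first_hit:
  fixes A :: "'a::real_normed_vector set"
  assumes "arc_between A {a, b}" "closed S" "a \<notin> S" "b \<in> S"
  obtains B P where "arc_between B {a, P}" "B \<subseteq> A" "B \<inter> S = {P}" "P \<in> frontier S"
proof -
  obtain g where g: "arc g" "path_image g = A" "pathstart g = a" "pathfinish g = b"
    using assms(1) by (rule arc_betweenE)
  have "path g" "pathstart g \<in> closure (- S)" "pathfinish g \<notin> - S"
    using g assms closure_subset[of "- S"] by (auto simp: arc_imp_path)
  then obtain u where u: "0 \<le> u" "u \<le> 1" "g u \<in> frontier (- S)"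
    "path_image (subpath 0 u g) - {g u} \<subseteq> interior (- S)"
    using subpath_to_frontier by metis
  then have hit: "g u \<in> frontier S" "g ` {0..u} - {g u} \<subseteq> - S"
    using assms(2) by (auto simp: frontier_complement path_image_subpath interior_open open_Compl)
  then have "g u \<in> S"
    using frontier_subset_closed[OF assms(2)] by blast
  have "u \<noteq> 0"
    using \<open>g u \<in> S\<close> assms(3) g(3) by (auto simp: pathstart_def)
  show thesis
  proof (rule that)
    show "arc_between (g ` {0..u}) {a, g u}"
      using arc_between_subarc[OF g(1), of 0 u] g(3) u \<open>u \<noteq> 0\<close> by (simp add: pathstart_def)
    show "g ` {0..u} \<subseteq> A"
      using g u by (auto simp: path_image_def)
    show "g ` {0..u} \<inter> S = {g u}"
      using \<open>g u \<in> S\<close> hit(2) u by auto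
  qed (rule hit)
qed

section \<open>Germs of transversal crossings\<close>

definition centred_chart :: "complex set \<Rightarrow> (complex \<Rightarrow> complex) \<Rightarrow> complex \<Rightarrow> bool" where
  "centred_chart U h p \<longleftrightarrow> open U \<and> p \<in> U \<and> h p = 0 \<and> (\<exists>h'. homeomorphism U (ball 0 1) h h')"

lemma centred_chart_rescale:
  assumes "centred_chart U h p" "0 < \<epsilon>" "\<epsilon> \<le> 1"
  shows "centred_chart {x \<in> U. norm (h x) < \<epsilon>} (\<lambda>x. h x /\<^sub>R \<epsilon>) p"
proof -
  obtain h' where U: "open U" "p \<in> U" "h p = 0" and hom: "homeomorphism U (ball 0 1) h h'"
    using assms(1) by (auto simp: centred_chart_def)
  let ?V = "{x \<in> U. norm (h x) < \<epsilon>}"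
  have "continuous_on U h" and image: "h ` U = ball 0 1"
    using hom by (auto simp: homeomorphism_def)
  then have "open (U \<inter> h -` ball 0 \<epsilon>)"
    using U by (simp add: continuous_open_preimage)
  moreover have "U \<inter> h -` ball 0 \<epsilon> = ?V"
    by auto
  ultimately have "open ?V"
    by simp
  have "h ` ?V = ball 0 1 \<inter> ball 0 \<epsilon>"
    unfolding image[symmetric] by auto
  also have "\<dots> = ball 0 \<epsilon>"
    using assms(3) by auto
  finally have "homeomorphism ?V (ball 0 \<epsilon>) h h'"
    using assms(3) by (intro homeomorphism_of_subsets[OF hom]) auto
  moreover have "homeomorphism (ball 0 \<epsilon>) (ball 0 1) (\<lambda>z::complex. z /\<^sub>R \<epsilon>) (\<lambda>z. \<epsilon> *\<^sub>R z)"
    using assms(2) by (intro homeomorphismI) (auto intro!: continuous_intros simp: field_simps)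
  ultimately have "homeomorphism ?V (ball 0 1) ((\<lambda>z. z /\<^sub>R \<epsilon>) \<circ> h) (h' \<circ> (\<lambda>z. \<epsilon> *\<^sub>R z))"
    by (rule homeomorphism_compose)
  then show ?thesis
    unfolding centred_chart_def using \<open>open ?V\<close> U assms(2) by (auto simp: comp_def)
qed

lemma centred_chart_shrink:
  assumes "centred_chart U h p" "open N" "p \<in> N"
  obtains \<epsilon> where "0 < \<epsilon>" "\<epsilon> \<le> 1" "{x \<in> U. norm (h x) < \<epsilon>} \<subseteq> N"
proof -
  obtain h' where U: "p \<in> U" "h p = 0" and hom: "homeomorphism U (ball 0 1) h h'"
    using assms(1) by (auto simp: centred_chart_def)
  have h': "continuous_on (ball 0 1) h'" "h' 0 = p" and inverse: "\<And>x. x \<in> U \<Longrightarrow> h' (h x) = x"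
    using U hom by (auto simp: homeomorphism_def)
  then have "open (ball 0 1 \<inter> h' -` N)"
    using assms(2) by (intro continuous_open_preimage) auto
  moreover have "0 \<in> ball 0 1 \<inter> h' -` N"
    using h' assms(3) by auto
  ultimately obtain d where d: "0 < d" "ball 0 d \<subseteq> ball 0 1 \<inter> h' -` N"
    using open_contains_ball by metis
  show thesis
  proof (rule that[of "min 1 d"])
    show "{x \<in> U. norm (h x) < min 1 d} \<subseteq> N"
    proof
      fix x assume "x \<in> {x \<in> U. norm (h x) < min 1 d}"
      then have "h' (h x) \<in> N" "x \<in> U"
        using d(2) by auto
      then show "x \<in> N"
        using inverse by simp
    qed
  qed (use d in auto)
qed

lemma inj_image_covers_neighbourhood:
  fixes \<phi> :: "real \<Rightarrow> real"
  assumes "a < s" "s < b" "continuous_on {a..b} \<phi>" "inj_on \<phi> {a..b}" "\<phi> s = 0"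
  obtains \<epsilon> where "0 < \<epsilon>" "{-\<epsilon><..<\<epsilon>} \<subseteq> \<phi> ` {a..b}"
proof -
  have ab: "a \<in> {a..b}" "b \<in> {a..b}" "s \<in> {a..b}"
    using assms by auto
  have "\<phi> a < \<phi> s \<and> \<phi> s < \<phi> b \<or> \<phi> b < \<phi> s \<and> \<phi> s < \<phi> a"
    using continuous_inj_imp_mono[of a s b \<phi>] assms(1-4) by auto
  then obtain l r where lr: "l < 0" "0 < r" "l \<in> \<phi> ` {a..b}" "r \<in> \<phi> ` {a..b}"
    using assms(5) ab by (metis imageI)
  have "connected (\<phi> ` {a..b})"
    using assms(3) by (intro connected_continuous_image) auto
  then have "{l..r} \<subseteq> \<phi> ` {a..b}"
    using lr connected_contains_Icc by blast
  moreover have "{- min (-l) r<..<min (-l) r} \<subseteq> {l..r}"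
    by auto
  ultimately show thesis
    using lr that[of "min (-l) r"] by auto
qed

lemma arc_projection_covers_neighbourhood:
  fixes \<pi> :: "'a::topological_space \<Rightarrow> real"
  assumes A: "arc_between A X" "p \<in> A" "p \<notin> X" and W: "open W" "p \<in> W"
    and \<pi>: "continuous_on W \<pi>" "inj_on \<pi> (A \<inter> W)" "\<pi> p = 0"
  obtains \<epsilon> where "0 < \<epsilon>" "{-\<epsilon><..<\<epsilon>} \<subseteq> \<pi> ` (A \<inter> W)"
proof -
  obtain g s where g: "arc g" "path_image g = A" and s: "0 < s" "s < 1" "g s = p"
    using A by (rule arc_between_interiorE)
  have cont_g: "continuous_on {0..1} g" and inj_g: "inj_on g {0..1}"
    using g by (auto simp: arc_def path_def)
  have "open ({0<..<1} \<inter> g -` W)"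
    using W by (intro continuous_open_preimage continuous_on_subset[OF cont_g]) auto
  moreover have "s \<in> {0<..<1} \<inter> g -` W"
    using s W by simp
  ultimately obtain e where e: "0 < e" "cball s e \<subseteq> {0<..<1} \<inter> g -` W"
    using open_contains_cball by metis
  then have I: "{s-e..s+e} \<subseteq> {0<..<1}" "g ` {s-e..s+e} \<subseteq> W"
    by (auto simp: cball_eq_atLeastAtMost)
  have I01: "{s-e..s+e} \<subseteq> {0..1}"
    using I(1) by (rule order_trans) auto
  have image: "g ` {s-e..s+e} \<subseteq> A \<inter> W"
    using I(2) I01 g(2) unfolding path_image_def by blast
  have "continuous_on {s-e..s+e} (\<lambda>t. \<pi> (g t))"
    using continuous_on_compose2[OF \<pi>(1) continuous_on_subset[OF cont_g I01] I(2)] .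
  moreover have "inj_on (\<lambda>t. \<pi> (g t)) {s-e..s+e}"
    using comp_inj_on[OF inj_on_subset[OF inj_g I01] inj_on_subset[OF \<pi>(2) image]]
    by (simp add: comp_def)
  ultimately obtain \<epsilon> where "0 < \<epsilon>" "{-\<epsilon><..<\<epsilon>} \<subseteq> (\<lambda>t. \<pi> (g t)) ` {s-e..s+e}"
    by (rule inj_image_covers_neighbourhood[where s = s, rotated 2]) (use e(1) s(3) \<pi>(3) in auto)
  then show thesis
    using that image by blast
qed

text \<open>This is what makes the germ of a crossing insensitive to passing to subarcs.\<close>

lemma arc_fills_line_in_chart:
  assumes chart: "centred_chart U h p" and N: "open N" "p \<in> N"
    and A: "arc_between A X" "p \<in> A" "p \<notin> X"
    and line: "\<And>x. \<lbrakk>x \<in> A; x \<in> N; x \<in> U\<rbrakk> \<Longrightarrow> Im (u * h x) = 0" and "u \<noteq> 0"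
  obtains \<epsilon> where "0 < \<epsilon>" "\<epsilon> \<le> 1"
    "\<And>x. \<lbrakk>x \<in> U; norm (h x) < \<epsilon>\<rbrakk> \<Longrightarrow> x \<in> A \<longleftrightarrow> Im (u * h x) = 0"
proof -
  have U: "open U" "p \<in> U" "h p = 0" and h: "continuous_on U h" "inj_on h U"
    using chart by (auto simp: centred_chart_def homeomorphism_def intro: inj_on_inverseI)
  define \<pi> where "\<pi> x = Re (u * h x)" for x
  have same: "x = y" if "x \<in> U" "y \<in> U" "Im (u * h x) = 0" "Im (u * h y) = 0" "\<pi> x = \<pi> y" for x y
  proof -
    have "u * h x = u * h y"
      by (rule complex_eqI) (simp_all only: that \<pi>_def[symmetric])
    then show ?thesis
      using that \<open>u \<noteq> 0\<close> h(2) by (simp add: inj_on_eq_iff)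
  qed
  have "continuous_on (U \<inter> N) \<pi>"
    unfolding \<pi>_def by (intro continuous_intros continuous_on_subset[OF h(1)]) auto
  moreover have "inj_on \<pi> (A \<inter> (U \<inter> N))"
    using same line by (intro inj_onI) blast
  moreover have "open (U \<inter> N)" "p \<in> U \<inter> N" "\<pi> p = 0"
    using U N by (auto simp: \<pi>_def)
  ultimately obtain \<delta> where \<delta>: "0 < \<delta>" "{-\<delta><..<\<delta>} \<subseteq> \<pi> ` (A \<inter> (U \<inter> N))"
    using arc_projection_covers_neighbourhood[OF A] by blast
  obtain \<epsilon> where \<epsilon>: "0 < \<epsilon>" "\<epsilon> \<le> 1" "{x \<in> U. norm (h x) < \<epsilon>} \<subseteq> N"
    using centred_chart_shrink[OF chart N] .
  show thesis
  proof (rule that[of "min \<epsilon> (\<delta> / norm u)"])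
    fix x assume x: "x \<in> U" "norm (h x) < min \<epsilon> (\<delta> / norm u)"
    have "x \<in> A" if on_line: "Im (u * h x) = 0"
    proof -
      have "norm (u * h x) < \<delta>"
        using x(2) \<open>u \<noteq> 0\<close> by (simp add: norm_mult field_simps)
      then have "\<pi> x \<in> {-\<delta><..<\<delta>}"
        using abs_Re_le_cmod[of "u * h x"] unfolding greaterThanLessThan_iff \<pi>_def by linarith
      then obtain y where y: "y \<in> A" "y \<in> U" "y \<in> N" "\<pi> x = \<pi> y"
        using \<delta>(2) by blast
      then show ?thesis
        using same[OF x(1) y(2) on_line line] by blast
    qed
    then show "x \<in> A \<longleftrightarrow> Im (u * h x) = 0"
      using line \<epsilon>(3) x by auto
  qed (use \<epsilon> \<delta>(1) \<open>u \<noteq> 0\<close> in auto)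
qed

definition crossing_germ :: "complex set \<Rightarrow> complex set \<Rightarrow> complex \<Rightarrow> bool" where
  "crossing_germ A B p \<longleftrightarrow> (\<exists>U h. centred_chart U h p \<and>
     (\<forall>x\<in>U. x \<in> A \<longleftrightarrow> Im (h x) = 0) \<and> (\<forall>x\<in>U. x \<in> B \<longleftrightarrow> Re (h x) = 0))"

lemma crossing_germ_subarcs_in_chart:
  assumes chart: "centred_chart U h p" and N: "open N" "p \<in> N"
    and A: "arc_between A X" "p \<in> A" "p \<notin> X" "\<And>x. \<lbrakk>x \<in> A; x \<in> N; x \<in> U\<rbrakk> \<Longrightarrow> Im (h x) = 0"
    and B: "arc_between B Y" "p \<in> B" "p \<notin> Y" "\<And>x. \<lbrakk>x \<in> B; x \<in> N; x \<in> U\<rbrakk> \<Longrightarrow> Re (h x) = 0"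
  shows "crossing_germ A B p"
proof -
  obtain \<epsilon> where \<epsilon>: "0 < \<epsilon>" "\<epsilon> \<le> 1"
    "\<And>x. \<lbrakk>x \<in> U; norm (h x) < \<epsilon>\<rbrakk> \<Longrightarrow> x \<in> A \<longleftrightarrow> Im (1 * h x) = 0"
    by (rule arc_fills_line_in_chart[OF chart N A(1-3), where u = 1]) (use A(4) in simp_all)
  obtain \<delta> where \<delta>: "0 < \<delta>" "\<delta> \<le> 1"
    "\<And>x. \<lbrakk>x \<in> U; norm (h x) < \<delta>\<rbrakk> \<Longrightarrow> x \<in> B \<longleftrightarrow> Im (\<i> * h x) = 0"
    by (rule arc_fills_line_in_chart[OF chart N B(1-3), where u = \<i>]) (use B(4) in simp_all)
  define r where "r = min \<epsilon> \<delta>"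
  have r: "0 < r" "r \<le> 1" "r \<le> \<epsilon>" "r \<le> \<delta>"
    using \<epsilon> \<delta> by (auto simp: r_def)
  show ?thesis
    unfolding crossing_germ_def
    by (intro exI conjI) (rule centred_chart_rescale[OF chart r(1,2)], use r \<epsilon>(3) \<delta>(3) in auto)
qed

lemma crossing_germ_subarcs:
  assumes "crossing_germ A B p" "open N" "p \<in> N"
    and "arc_between A' X" "p \<in> A'" "p \<notin> X" "A' \<inter> N \<subseteq> A"
    and "arc_between B' Y" "p \<in> B'" "p \<notin> Y" "B' \<inter> N \<subseteq> B"
  shows "crossing_germ A' B' p"
proof -
  obtain U h where "centred_chart U h p"
    and "\<forall>x\<in>U. x \<in> A \<longleftrightarrow> Im (h x) = 0" "\<forall>x\<in>U. x \<in> B \<longleftrightarrow> Re (h x) = 0"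
    using assms(1) unfolding crossing_germ_def by blast
  then show ?thesis
    using assms(2-) by (intro crossing_germ_subarcs_in_chart[of U h p N A' X B' Y]) auto
qed

lemma crossing_germ_commute:
  assumes "crossing_germ A B p"
  shows "crossing_germ B A p"
proof -
  obtain U h h' where U: "open U" "p \<in> U" "h p = 0" "homeomorphism U (ball 0 1) h h'"
    and axes: "\<forall>x\<in>U. x \<in> A \<longleftrightarrow> Im (h x) = 0" "\<forall>x\<in>U. x \<in> B \<longleftrightarrow> Re (h x) = 0"
    using assms by (auto simp: crossing_germ_def centred_chart_def)
  have "homeomorphism (ball 0 1) (ball 0 1) (\<lambda>z. \<i> * z) (\<lambda>z. - \<i> * z)"
    by (intro homeomorphismI) (auto intro!: continuous_intros simp: norm_mult simp flip: mult.assoc)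
  then have "homeomorphism U (ball 0 1) ((\<lambda>z. \<i> * z) \<circ> h) (h' \<circ> (\<lambda>z. - \<i> * z))"
    by (rule homeomorphism_compose[OF U(4)])
  then have "centred_chart U (\<lambda>x. \<i> * h x) p"
    unfolding centred_chart_def using U by (auto simp: comp_def)
  then show ?thesis
    unfolding crossing_germ_def using axes by (intro exI[of _ U] exI[of _ "\<lambda>x. \<i> * h x"]) simp
qed

lemma crossing_germ_lines:
  assumes "wedge u w \<noteq> 0"
  shows "crossing_germ {x. wedge u (x - p) = 0} {x. wedge w (x - p) = 0} p"
proof -
  define h' where "h' z = p + Re z *\<^sub>R u + Im z *\<^sub>R w" for z
  define h where "h x = Complex (wedge (x - p) w / wedge u w) (wedge u (x - p) / wedge u w)" for x
  have inverse: "h (h' z) = z" for z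
    using assms by (simp add: h_def h'_def complex_eq_iff wedge.add_left wedge.add_right
        wedge.scaleR_left wedge.scaleR_right)
  have inverse': "h' (h x) = x" for x
  proof -
    have "wedge u w *\<^sub>R (h' (h x) - p) = wedge (x - p) w *\<^sub>R u + wedge u (x - p) *\<^sub>R w"
      using assms by (simp add: h_def h'_def scaleR_add_right)
    also have "\<dots> = wedge u w *\<^sub>R (x - p)"
      by (simp add: wedge_def complex_eq_iff algebra_simps)
    finally show ?thesis
      using assms by simp
  qed
  have cont: "continuous_on UNIV h" "continuous_on UNIV h'"
    unfolding h_def h'_def Complex_eq
    by (intro continuous_intros wedge.continuous_on; simp add: assms)+
  define U where "U = h -` ball 0 1"
  have "open U"
    using cont(1) by (simp add: U_def continuous_on_open_vimage)
  moreover have "homeomorphism U (ball 0 1) h h'"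
    by (rule homeomorphismI)
      (use inverse inverse' in \<open>auto simp: U_def intro: cont[THEN continuous_on_subset]\<close>)
  moreover have "h p = 0"
    by (simp add: h_def complex_eq_iff wedge.zero_left wedge.zero_right)
  ultimately have "centred_chart U h p"
    unfolding centred_chart_def by (auto simp: U_def)
  then show ?thesis
    unfolding crossing_germ_def using assms
    by (intro exI[of _ U] exI[of _ h]) (simp add: h_def wedge_commute[of _ w])
qed

lemma transversal_at_imp_crossing_germ:
  assumes trans: "transversal_at \<alpha> s \<beta> t" and p: "\<alpha> s = p"
    and \<alpha>: "path \<alpha>" "\<And>r. \<lbrakk>0 \<le> r; r \<le> 1; \<alpha> r = p\<rbrakk> \<Longrightarrow> r = s"
    and \<beta>: "path \<beta>" "\<And>r. \<lbrakk>0 \<le> r; r \<le> 1; \<beta> r = p\<rbrakk> \<Longrightarrow> r = t"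
    and A: "arc_between A X" "p \<in> A" "p \<notin> X" "A \<subseteq> path_image \<alpha>"
    and B: "arc_between B Y" "p \<in> B" "p \<notin> Y" "B \<subseteq> path_image \<beta>"
  shows "crossing_germ A B p"
proof -
  obtain U h h' a b c d where U: "open U" "homeomorphism U (ball 0 1) h h'" "h (\<alpha> s) = 0"
    and ab: "a < s" "s < b" "\<alpha> ` {a<..<b} \<subseteq> U" "h ` \<alpha> ` {a<..<b} = {z \<in> ball 0 1. Im z = 0}"
    and cd: "c < t" "t < d" "\<beta> ` {c<..<d} \<subseteq> U" "h ` \<beta> ` {c<..<d} = {z \<in> ball 0 1. Re z = 0}"
    using trans unfolding transversal_at_def by (elim conjE exE) (rule that; assumption)
  have "p \<in> U"
    using ab p by auto
  then have chart: "centred_chart U h p"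
    using U p by (auto simp: centred_chart_def)
  define N where "N = - (\<alpha> ` ({0..1} - {a<..<b}) \<union> \<beta> ` ({0..1} - {c<..<d}))"
  have closed: "closed (\<gamma> ` ({0..1} - {l<..<u}))" if "path \<gamma>" for \<gamma> :: "real \<Rightarrow> complex" and l u
    using that by (intro compact_imp_closed compact_continuous_image)
      (auto simp: path_def compact_diff intro: continuous_on_subset)
  have N: "open N" "p \<in> N"
    using closed[OF \<alpha>(1)] closed[OF \<beta>(1)] \<alpha>(2) \<beta>(2) ab(1,2) cd(1,2) unfolding N_def
    by (blast intro: open_Compl closed_Un, auto)
  have "A \<inter> N \<subseteq> \<alpha> ` {a<..<b}" "B \<inter> N \<subseteq> \<beta> ` {c<..<d}"
    using A(4) B(4) unfolding N_def path_image_def by blast+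
  then have "Im (h x) = 0" if "x \<in> A" "x \<in> N" for x
    using that ab(4) by blast
  moreover have "Re (h x) = 0" if "x \<in> B" "x \<in> N" for x
    using that \<open>B \<inter> N \<subseteq> \<beta> ` {c<..<d}\<close> cd(4) by blast
  ultimately show ?thesis
    using crossing_germ_subarcs_in_chart[OF chart N A(1-3) _ B(1-3)] by blast
qed

lemma open_connected_real_interval:
  fixes T :: "real set"
  assumes "open T" "connected T" "bounded T" "T \<noteq> {}"
  shows "T = {Inf T<..<Sup T}"
proof (intro equalityI subsetI)
  have bdd: "bdd_below T" "bdd_above T"
    using assms bounded_imp_bdd_below bounded_imp_bdd_above by auto
  fix x
  show "x \<in> {Inf T<..<Sup T}" if x: "x \<in> T"
  proof -
    obtain e where e: "0 < e" "cball x e \<subseteq> T"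
      using assms(1) x open_contains_cball by blast
    then have "x - e \<in> T" "x + e \<in> T"
      by (auto simp: cball_eq_atLeastAtMost)
    then show ?thesis
      using bdd e(1) cInf_lower[of "x - e" T] cSup_upper[of "x + e" T] by auto
  qed
  show "x \<in> T" if x: "x \<in> {Inf T<..<Sup T}"
  proof -
    obtain y z where "y \<in> T" "y < x" "z \<in> T" "x < z"
      using x bdd \<open>T \<noteq> {}\<close> by (auto simp: cInf_less_iff less_cSup_iff)
    then show ?thesis
      using connected_contains_Icc[OF assms(2), of y z] by auto
  qed
qed

lemma arc_with_convex_chart_image:
  fixes g :: "real \<Rightarrow> complex" and h :: "complex \<Rightarrow> complex"
  assumes g: "arc g" and hom: "homeomorphism U (ball 0 1) h h'"
    and L: "convex L" "\<forall>x\<in>U. x \<in> path_image g \<longleftrightarrow> h x \<in> L"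
  shows "h ` g ` ({0..1} \<inter> g -` U) = ball 0 1 \<inter> L" "connected ({0..1} \<inter> g -` U)"
proof -
  have h: "h ` U = ball 0 1" "\<And>x. x \<in> U \<Longrightarrow> h' (h x) = x"
    and cont_h': "continuous_on (ball 0 1) h'"
    using hom by (auto simp: homeomorphism_def)
  let ?T = "{0..1} \<inter> g -` U"
  have "g ` ?T = U \<inter> path_image g"
    by (auto simp: path_image_def)
  also have "\<dots> = {x \<in> U. h x \<in> L}"
    using L(2) by auto
  finally have gT: "g ` ?T = {x \<in> U. h x \<in> L}" .
  have "h ` {x \<in> U. h x \<in> L} = h ` U \<inter> L"
    by auto
  then show image: "h ` g ` ?T = ball 0 1 \<inter> L"
    unfolding gT h(1) .
  have "(\<lambda>x. h' (h x)) ` g ` ?T = (\<lambda>x. x) ` g ` ?T"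
    by (intro image_cong) (auto simp: h(2))
  then have "h' ` h ` g ` ?T = g ` ?T"
    by (simp add: image_image)
  moreover have "connected (ball 0 1 \<inter> L)"
    using L(1) by (simp add: convex_Int convex_connected)
  then have "connected (h' ` (ball 0 1 \<inter> L))"
    by (intro connected_continuous_image continuous_on_subset[OF cont_h']) auto
  ultimately have connected: "connected (g ` ?T)"
    unfolding image by simp
  obtain k where k: "continuous_on (path_image g) k" "\<And>t. t \<in> {0..1} \<Longrightarrow> k (g t) = t"
    using homeomorphism_arc[OF g] unfolding homeomorphism_def by metis
  have "connected (k ` g ` ?T)"
    by (intro connected_continuous_image[OF _ connected] continuous_on_subset[OF k(1)])
      (auto simp: path_image_def)
  moreover have "(\<lambda>t. k (g t)) ` ?T = (\<lambda>t. t) ` ?T"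
    by (intro image_cong) (simp_all add: k(2))
  ultimately show "connected ?T"
    by (simp add: image_image)
qed

lemma subarc_with_convex_chart_image:
  fixes g :: "real \<Rightarrow> complex" and h :: "complex \<Rightarrow> complex"
  assumes g: "arc g" "0 < s" "s < 1" "g s \<in> U" "g 0 \<notin> U" "g 1 \<notin> U"
    and U: "open U" "homeomorphism U (ball 0 1) h h'"
    and L: "convex L" "\<forall>x\<in>U. x \<in> path_image g \<longleftrightarrow> h x \<in> L"
  obtains a b where "0 \<le> a" "a < s" "s < b" "b \<le> 1" "inj_on g {a<..<b}" "g ` {a<..<b} \<subseteq> U"
    "h ` g ` {a<..<b} = ball 0 1 \<inter> L"
proof -
  have cont_g: "continuous_on {0..1} g" and inj_g: "inj_on g {0..1}"
    using g by (auto simp: arc_def path_def)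
  define T where "T = {0..1} \<inter> g -` U"
  have image: "h ` g ` T = ball 0 1 \<inter> L" and "connected T"
    using arc_with_convex_chart_image[OF g(1) U(2) L] by (simp_all add: T_def)
  have T: "T = {0<..<1} \<inter> g -` U"
    using g by (auto simp: T_def less_le)
  have "continuous_on {0<..<1} g"
    using cont_g by (rule continuous_on_subset) auto
  then have "open T"
    using U unfolding T by (intro continuous_open_preimage) auto
  moreover have "bounded T"
    by (rule bounded_subset[of "{0..1}"]) (auto simp: T_def)
  moreover have "s \<in> T"
    using g by (auto simp: T)
  ultimately obtain a b where ab: "T = {a<..<b}"
    using open_connected_real_interval \<open>connected T\<close> by blast
  show thesis
  proof (rule that[of a b])
    show "a < s" "s < b"
      using \<open>s \<in> T\<close> ab by auto
    have "{a<..<b} \<subseteq> {0..1}"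
      using ab T_def by auto
    then show "0 \<le> a" "b \<le> 1"
      using \<open>a < s\<close> \<open>s < b\<close> greaterThanLessThan_subseteq_atLeastAtMost_iff[of a b 0 1] by auto
    show "inj_on g {a<..<b}"
      using inj_g \<open>{a<..<b} \<subseteq> {0..1}\<close> by (rule inj_on_subset)
    show "g ` {a<..<b} \<subseteq> U" "h ` g ` {a<..<b} = ball 0 1 \<inter> L"
      using ab image by (auto simp: T)
  qed
qed

lemma crossing_germ_imp_transversal_at:
  assumes germ: "crossing_germ (path_image g) (path_image k) p"
    and g: "arc g" "0 < s" "s < 1" "g s = p" and k: "arc k" "0 < t" "t < 1" "k t = p"
  shows "transversal_at g s k t"
proof -
  obtain U\<^sub>0 h\<^sub>0 where chart: "centred_chart U\<^sub>0 h\<^sub>0 p"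
    and axes\<^sub>0: "\<forall>x\<in>U\<^sub>0. x \<in> path_image g \<longleftrightarrow> Im (h\<^sub>0 x) = 0" "\<forall>x\<in>U\<^sub>0. x \<in> path_image k \<longleftrightarrow> Re (h\<^sub>0 x) = 0"
    using germ unfolding crossing_germ_def by blast
  have "g s \<noteq> g 0" "g s \<noteq> g 1" "k t \<noteq> k 0" "k t \<noteq> k 1"
    using g k by (auto simp: arc_def inj_on_eq_iff)
  then have "open (- {g 0, g 1, k 0, k 1})" "p \<in> - {g 0, g 1, k 0, k 1}"
    using g(4) k(4) by (auto simp: open_Compl finite_imp_closed)
  then obtain \<epsilon> where \<epsilon>: "0 < \<epsilon>" "\<epsilon> \<le> 1" "{x \<in> U\<^sub>0. norm (h\<^sub>0 x) < \<epsilon>} \<subseteq> - {g 0, g 1, k 0, k 1}"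
    using centred_chart_shrink[OF chart] by metis
  define U where "U = {x \<in> U\<^sub>0. norm (h\<^sub>0 x) < \<epsilon>}"
  define h where "h x = h\<^sub>0 x /\<^sub>R \<epsilon>" for x
  obtain h' where U: "open U" "homeomorphism U (ball 0 1) h h'" "p \<in> U" "h p = 0"
    using centred_chart_rescale[OF chart \<epsilon>(1,2)] unfolding centred_chart_def U_def h_def by blast
  have ends: "g 0 \<notin> U" "g 1 \<notin> U" "k 0 \<notin> U" "k 1 \<notin> U"
    using \<epsilon>(3) by (auto simp: U_def)
  have axes: "\<forall>x\<in>U. x \<in> path_image g \<longleftrightarrow> h x \<in> {z. Im z = 0}"
    "\<forall>x\<in>U. x \<in> path_image k \<longleftrightarrow> h x \<in> {z. Re z = 0}"
    using axes\<^sub>0 \<epsilon>(1) by (auto simp: U_def h_def)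
  have axis_Int: "{z \<in> ball 0 1. P z} = ball 0 1 \<inter> {z. P z}" for P :: "complex \<Rightarrow> bool"
    by auto
  have convex: "convex {z. Im z = 0}" "convex {z. Re z = 0}"
    by (auto simp: convex_def)
  obtain a b where ab: "0 \<le> a" "a < s" "s < b" "b \<le> 1" "inj_on g {a<..<b}" "g ` {a<..<b} \<subseteq> U"
    "h ` g ` {a<..<b} = ball 0 1 \<inter> {z. Im z = 0}"
    by (rule subarc_with_convex_chart_image[OF g(1-3) _ ends(1,2) U(1,2) convex(1) axes(1)])
      (use g(4) U(3) in auto)
  obtain c d where cd: "0 \<le> c" "c < t" "t < d" "d \<le> 1" "inj_on k {c<..<d}" "k ` {c<..<d} \<subseteq> U"
    "h ` k ` {c<..<d} = ball 0 1 \<inter> {z. Re z = 0}"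
    by (rule subarc_with_convex_chart_image[OF k(1-3) _ ends(3,4) U(1,2) convex(2) axes(2)])
      (use k(4) U(3) in auto)
  have "h (g s) = 0" "g s = k t"
    using U(4) g(4) k(4) by auto
  then show ?thesis
    unfolding transversal_at_def axis_Int using U(1,2) ab cd by blast
qed

section \<open>Drawings by arcs\<close>

lemma edge_subset_verts: "\<lbrakk>simple_graph G; e \<in> edges G\<rbrakk> \<Longrightarrow> e \<subseteq> verts G"
  by (simp add: simple_graph_def)

lemma card_edge: "\<lbrakk>simple_graph G; e \<in> edges G\<rbrakk> \<Longrightarrow> card e = 2"
  by (simp add: simple_graph_def)

lemma edge_at_vertexE:
  assumes "simple_graph G" "e \<in> edges G" "a \<in> e"
  obtains b where "e = {a, b}" "b \<noteq> a"
proof -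
  obtain x y where "e = {x, y}" "x \<noteq> y"
    using card_edge[OF assms(1,2)] by (auto simp: card_2_iff)
  then show thesis
    using that[of x] that[of y] assms(3) by (auto simp: insert_commute)
qed

lemma finite_edges: "simple_graph G \<Longrightarrow> finite (edges G)"
  by (rule finite_subset[of _ "Pow (verts G)"]) (auto simp: simple_graph_def)

definition crossings :: "'a ugraph \<Rightarrow> ('a \<Rightarrow> complex) \<Rightarrow> ('a set \<Rightarrow> complex set) \<Rightarrow> complex set" where
  "crossings G f A =
     {p. p \<notin> f ` verts G \<and> (\<exists>e\<in>edges G. \<exists>e'\<in>edges G. e \<noteq> e' \<and> p \<in> A e \<and> p \<in> A e')}"

lemma crossingsI:
  "\<lbrakk>p \<notin> f ` verts G; e \<in> edges G; e' \<in> edges G; e \<noteq> e'; p \<in> A e; p \<in> A e'\<rbrakk> \<Longrightarrow> p \<in> crossings G f A"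
  unfolding crossings_def by blast

lemma crossingsE:
  assumes "p \<in> crossings G f A"
  obtains e e' where "p \<notin> f ` verts G" "e \<in> edges G" "e' \<in> edges G" "e \<noteq> e'" "p \<in> A e" "p \<in> A e'"
  using assms unfolding crossings_def by blast

definition transversal_crossing :: "'a set set \<Rightarrow> ('a set \<Rightarrow> complex set) \<Rightarrow> complex \<Rightarrow> bool" where
  "transversal_crossing E A p \<longleftrightarrow>
     (\<exists>e\<in>E. \<exists>e'\<in>E. e \<noteq> e' \<and> {d \<in> E. p \<in> A d} = {e, e'} \<and> crossing_germ (A e) (A e') p)"

locale arc_drawing =
  fixes G :: "'a ugraph" and f :: "'a \<Rightarrow> complex" and A :: "'a set \<Rightarrow> complex set"
  assumes simple_graph: "simple_graph G"
    and inj_vertices: "inj_on f (verts G)"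
    and arc_between_edge: "e \<in> edges G \<Longrightarrow> arc_between (A e) (f ` e)"
    and vertex_on_edge: "\<lbrakk>e \<in> edges G; v \<in> verts G; f v \<in> A e\<rbrakk> \<Longrightarrow> v \<in> e"
    and finite_crossings: "finite (crossings G f A)"
    and transversal_crossings: "p \<in> crossings G f A \<Longrightarrow> transversal_crossing (edges G) A p"
begin

lemma finite_verts: "finite (verts G)"
  using simple_graph by (simp add: simple_graph_def)

lemma edge_ends:
  assumes "{i, j} \<in> edges G"
  shows "i \<in> verts G" "j \<in> verts G" "i \<noteq> j"
  using edge_subset_verts[OF simple_graph assms] card_edge[OF simple_graph assms] by auto

lemma crossing_edges:
  assumes "p \<in> crossings G f A" "e \<in> edges G" "e' \<in> edges G" "e \<noteq> e'" "p \<in> A e" "p \<in> A e'"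
  shows "{d \<in> edges G. p \<in> A d} = {e, e'}" "crossing_germ (A e) (A e') p"
proof -
  obtain d d' where d: "{d \<in> edges G. p \<in> A d} = {d, d'}" "crossing_germ (A d) (A d') p"
    using transversal_crossings[OF assms(1)] unfolding transversal_crossing_def by blast
  moreover have "e \<in> {d \<in> edges G. p \<in> A d}" "e' \<in> {d \<in> edges G. p \<in> A d}"
    using assms by auto
  ultimately have "e = d \<and> e' = d' \<or> e = d' \<and> e' = d"
    using assms(4) by auto
  then show "{d \<in> edges G. p \<in> A d} = {e, e'}" "crossing_germ (A e) (A e') p"
    using d crossing_germ_commute[OF d(2)] by auto
qed

end

lemma fibre_iff:
  "Vertex_Point v \<in> fibre G f \<gamma> p \<longleftrightarrow> v \<in> verts G \<and> f v = p"
  "Edge_Point e t \<in> fibre G f \<gamma> p \<longleftrightarrow> e \<in> edges G \<and> 0 < t \<and> t < 1 \<and> \<gamma> e t = p"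
  by (auto simp: fibre_def complex_points_def)

locale drawing =
  fixes G :: "'a ugraph" and f :: "'a \<Rightarrow> complex" and \<gamma> :: "'a set \<Rightarrow> real \<Rightarrow> complex"
  assumes simple_graph: "simple_graph G" and is_drawing: "is_drawing G f \<gamma>"
begin

lemma path_edge: "e \<in> edges G \<Longrightarrow> path (\<gamma> e)"
  using is_drawing by (simp add: is_drawing_def)

lemma ends_edge: "e \<in> edges G \<Longrightarrow> {pathstart (\<gamma> e), pathfinish (\<gamma> e)} = f ` e"
  using is_drawing by (simp add: is_drawing_def)

lemma multiple_fibreE:
  assumes "x \<in> fibre G f \<gamma> p" "y \<in> fibre G f \<gamma> p" "x \<noteq> y"
  obtains e s e' t where "{x, y} = {Edge_Point e s, Edge_Point e' t}"
    "fibre G f \<gamma> p = {Edge_Point e s, Edge_Point e' t}" "transversal_at (\<gamma> e) s (\<gamma> e') t"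
proof -
  have "p \<in> multiple_points G f \<gamma>"
    using assms by (auto simp: multiple_points_def)
  then obtain e s e' t where est: "fibre G f \<gamma> p = {Edge_Point e s, Edge_Point e' t}"
    "transversal_at (\<gamma> e) s (\<gamma> e') t"
    using is_drawing unfolding is_drawing_def by blast
  then have "{x, y} = {Edge_Point e s, Edge_Point e' t}"
    using assms by auto
  then show thesis
    using est by (rule that)
qed

lemma vertex_fibre:
  assumes "v \<in> verts G"
  shows "fibre G f \<gamma> (f v) = {Vertex_Point v}"
proof -
  have v: "Vertex_Point v \<in> fibre G f \<gamma> (f v)"
    using assms by (simp add: fibre_iff)
  have "x = Vertex_Point v" if x: "x \<in> fibre G f \<gamma> (f v)" for x
  proof (rule ccontr)
    assume "x \<noteq> Vertex_Point v"
    then obtain e s e' t where "{x, Vertex_Point v} = {Edge_Point e s, Edge_Point e' t}"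
      by (rule multiple_fibreE[OF x v])
    then show False
      by (auto simp: doubleton_eq_iff)
  qed
  then show ?thesis
    using v by blast
qed

lemma inj_vertices: "inj_on f (verts G)"
proof (rule inj_onI)
  fix u v assume uv: "u \<in> verts G" "v \<in> verts G" "f u = f v"
  then have "Vertex_Point u \<in> fibre G f \<gamma> (f v)"
    by (simp add: fibre_iff)
  then show "u = v"
    using vertex_fibre[OF uv(2)] by simp
qed

lemma edge_point_exists:
  assumes "e \<in> edges G" "p \<in> path_image (\<gamma> e)" "p \<notin> f ` e"
  obtains t where "Edge_Point e t \<in> fibre G f \<gamma> p"
proof -
  have "p \<noteq> pathstart (\<gamma> e)" "p \<noteq> pathfinish (\<gamma> e)"
    using ends_edge[OF assms(1)] assms(3) by blast+
  then show thesis
    using path_image_interiorE[OF assms(2)] that assms(1) unfolding fibre_iff by metis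
qed

lemma vertex_on_edge:
  assumes "e \<in> edges G" "v \<in> verts G" "f v \<in> path_image (\<gamma> e)"
  shows "v \<in> e"
proof (rule ccontr)
  assume "v \<notin> e"
  then have "f v \<notin> f ` e"
    using inj_vertices assms(2) edge_subset_verts[OF simple_graph assms(1)]
    by (meson inj_on_image_mem_iff)
  then obtain t where "Edge_Point e t \<in> fibre G f \<gamma> (f v)"
    using edge_point_exists assms(1,3) by blast
  then show False
    using vertex_fibre[OF assms(2)] by simp
qed

lemma two_edges_throughE:
  assumes p: "p \<notin> f ` verts G"
    and d: "d \<in> edges G" "d' \<in> edges G" "d \<noteq> d'" "p \<in> path_image (\<gamma> d)" "p \<in> path_image (\<gamma> d')"
  obtains e s e' t where "{e, e'} = {d, d'}"
    "fibre G f \<gamma> p = {Edge_Point e s, Edge_Point e' t}" "transversal_at (\<gamma> e) s (\<gamma> e') t"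
proof -
  have "p \<notin> f ` d" "p \<notin> f ` d'"
    using p d edge_subset_verts[OF simple_graph] by blast+
  then obtain r r' where r: "Edge_Point d r \<in> fibre G f \<gamma> p" "Edge_Point d' r' \<in> fibre G f \<gamma> p"
    using edge_point_exists[OF d(1,4)] edge_point_exists[OF d(2,5)] by metis
  have "Edge_Point d r \<noteq> Edge_Point d' r'"
    using d(3) by simp
  then obtain e s e' t where est: "{Edge_Point d r, Edge_Point d' r'} =
      {Edge_Point e s, Edge_Point e' t}"
    "fibre G f \<gamma> p = {Edge_Point e s, Edge_Point e' t}" "transversal_at (\<gamma> e) s (\<gamma> e') t"
    by (rule multiple_fibreE[OF r])
  have "{e, e'} = {d, d'}"
    using est(1) by (auto simp: doubleton_eq_iff)
  then show thesis
    using est(2,3) by (rule that)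
qed

lemma crossing_germ_subarcs_of_edges:
  assumes p: "p \<notin> f ` verts G" and e: "e \<in> edges G" "e' \<in> edges G" "e \<noteq> e'"
    and fibre: "fibre G f \<gamma> p = {Edge_Point e s, Edge_Point e' t}"
    and trans: "transversal_at (\<gamma> e) s (\<gamma> e') t"
    and B: "arc_between B (f ` e)" "p \<in> B" "B \<subseteq> path_image (\<gamma> e)"
    and C: "arc_between C (f ` e')" "p \<in> C" "C \<subseteq> path_image (\<gamma> e')"
  shows "crossing_germ B C p"
proof -
  have off_ends: "p \<notin> f ` d" if "d \<in> edges G" for d
    using p edge_subset_verts[OF simple_graph that] by blast
  have in_fibre: "Edge_Point d r \<in> fibre G f \<gamma> p" if "d \<in> edges G" "0 \<le> r" "r \<le> 1" "\<gamma> d r = p" for d r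
  proof -
    have "p \<noteq> pathstart (\<gamma> d)" "p \<noteq> pathfinish (\<gamma> d)"
      using ends_edge[OF that(1)] off_ends[OF that(1)] by blast+
    then have "r \<noteq> 0" "r \<noteq> 1"
      using that(4) by (auto simp: pathstart_def pathfinish_def)
    then show ?thesis
      using that by (simp add: fibre_iff)
  qed
  have "Edge_Point e s \<in> fibre G f \<gamma> p"
    unfolding fibre by simp
  then have "\<gamma> e s = p"
    by (simp add: fibre_iff)
  moreover have "r = s" if "0 \<le> r" "r \<le> 1" "\<gamma> e r = p" for r
    using in_fibre[OF e(1) that] e(3) unfolding fibre by simp
  moreover have "r = t" if "0 \<le> r" "r \<le> 1" "\<gamma> e' r = p" for r
    using in_fibre[OF e(2) that] e(3) unfolding fibre by simp
  ultimately show ?thesis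
    using transversal_at_imp_crossing_germ[OF trans _ path_edge[OF e(1)] _ path_edge[OF e(2)] _
        B(1,2) off_ends[OF e(1)] B(3) C(1,2) off_ends[OF e(2)] C(3)] by blast
qed

context
  fixes A :: "'a set \<Rightarrow> complex set"
  assumes subarc: "\<And>e. e \<in> edges G \<Longrightarrow> arc_between (A e) (f ` e)"
    "\<And>e. e \<in> edges G \<Longrightarrow> A e \<subseteq> path_image (\<gamma> e)"
begin

lemma subarcs_crossing:
  assumes crossing: "p \<in> crossings G f A"
  shows "p \<in> multiple_points G f \<gamma>" "transversal_crossing (edges G) A p"
proof -
  obtain d d' where p: "p \<notin> f ` verts G"
    and d: "d \<in> edges G" "d' \<in> edges G" "d \<noteq> d'" "p \<in> A d" "p \<in> A d'"
    using crossing by (rule crossingsE)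
  then have pd: "p \<in> path_image (\<gamma> d)" "p \<in> path_image (\<gamma> d')"
    using subarc(2) by blast+
  obtain e s e' t where ee': "{e, e'} = {d, d'}"
    and fibre: "fibre G f \<gamma> p = {Edge_Point e s, Edge_Point e' t}"
    and trans: "transversal_at (\<gamma> e) s (\<gamma> e') t"
    by (rule two_edges_throughE[OF p d(1-3) pd])
  have e: "e \<in> edges G" "e' \<in> edges G" "e \<noteq> e'" "p \<in> A e" "p \<in> A e'"
    using ee' d by (auto simp: doubleton_eq_iff)
  have "c \<in> {e, e'}" if c: "c \<in> edges G" "p \<in> A c" for c
  proof -
    have "p \<in> path_image (\<gamma> c)" "p \<notin> f ` c"
      using subarc(2) c p edge_subset_verts[OF simple_graph] by blast+
    then obtain r where "Edge_Point c r \<in> fibre G f \<gamma> p"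
      by (rule edge_point_exists[OF c(1)])
    then show ?thesis
      unfolding fibre by auto
  qed
  then have "{c \<in> edges G. p \<in> A c} = {e, e'}"
    using e by blast
  moreover have "crossing_germ (A e) (A e') p"
    by (rule crossing_germ_subarcs_of_edges[OF p e(1-3) fibre trans]) (simp_all add: subarc e)
  ultimately show "transversal_crossing (edges G) A p"
    using e(1-3) unfolding transversal_crossing_def by blast
  show "p \<in> multiple_points G f \<gamma>"
    using e(3) by (auto simp: multiple_points_def fibre)
qed

lemma subarcs_crossings_subset: "crossings G f A \<subseteq> multiple_points G f \<gamma>"
  using subarcs_crossing(1) by (rule subsetI)

lemma arc_drawing_subarcs: "arc_drawing G f A"
proof
  show "finite (crossings G f A)"
    using is_drawing subarcs_crossings_subset finite_subset by (auto simp: is_drawing_def)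
qed (use simple_graph inj_vertices subarc vertex_on_edge subarcs_crossing(2) in blast)+

end

lemma arc_drawing_exists:
  obtains A where "arc_drawing G f A" "crossings G f A \<subseteq> multiple_points G f \<gamma>"
proof -
  have "\<exists>B. arc_between B (f ` e) \<and> B \<subseteq> path_image (\<gamma> e)" if e: "e \<in> edges G" for e
  proof -
    have "card (f ` e) = 2"
      using card_edge[OF simple_graph e] edge_subset_verts[OF simple_graph e] inj_vertices
      by (metis card_image inj_on_subset)
    then have "pathstart (\<gamma> e) \<noteq> pathfinish (\<gamma> e)"
      unfolding ends_edge[OF e, symmetric] by auto
    then obtain q where "arc q" "path_image q \<subseteq> path_image (\<gamma> e)"
      "pathstart q = pathstart (\<gamma> e)" "pathfinish q = pathfinish (\<gamma> e)"
      using path_contains_arc path_edge[OF e] by metis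
    then show ?thesis
      using ends_edge[OF e] unfolding arc_between_def by metis
  qed
  then obtain A where A: "\<And>e. e \<in> edges G \<Longrightarrow> arc_between (A e) (f ` e)"
    "\<And>e. e \<in> edges G \<Longrightarrow> A e \<subseteq> path_image (\<gamma> e)"
    by metis
  show thesis
    by (rule that[OF arc_drawing_subarcs[OF A] subarcs_crossings_subset[OF A]])
qed

end

locale parametrized_arc_drawing = arc_drawing G f A
  for G :: "'a ugraph" and f and A +
  fixes \<gamma> :: "'a set \<Rightarrow> real \<Rightarrow> complex"
  assumes arc_edge: "e \<in> edges G \<Longrightarrow> arc (\<gamma> e)"
    and path_image_edge: "e \<in> edges G \<Longrightarrow> path_image (\<gamma> e) = A e"
    and ends_edge: "e \<in> edges G \<Longrightarrow> {pathstart (\<gamma> e), pathfinish (\<gamma> e)} = f ` e"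
begin

lemma edge_point_unique:
  assumes "Edge_Point e s \<in> fibre G f \<gamma> p" "Edge_Point e t \<in> fibre G f \<gamma> p"
  shows "s = t"
proof -
  have "inj_on (\<gamma> e) {0..1}"
    using assms arc_edge by (auto simp: fibre_iff arc_def)
  then show ?thesis
    using assms by (auto simp: fibre_iff inj_on_def)
qed

lemma edge_point_in_fibre:
  assumes "Edge_Point e t \<in> fibre G f \<gamma> p"
  shows "p \<in> A e" "p \<notin> f ` verts G"
proof -
  have e: "e \<in> edges G" "0 < t" "t < 1" "\<gamma> e t = p"
    using assms by (auto simp: fibre_iff)
  then show "p \<in> A e"
    using path_image_edge[OF e(1)] by (auto simp: path_image_def)
  have "inj_on (\<gamma> e) {0..1}"
    using arc_edge[OF e(1)] by (simp add: arc_def)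
  then have "\<gamma> e t \<noteq> \<gamma> e 0" "\<gamma> e t \<noteq> \<gamma> e 1"
    using e(2,3) by (auto simp: inj_on_eq_iff)
  then have "p \<notin> f ` e"
    unfolding ends_edge[OF e(1), symmetric] e(4) by (simp add: pathstart_def pathfinish_def)
  then show "p \<notin> f ` verts G"
    using vertex_on_edge[OF e(1)] \<open>p \<in> A e\<close> by blast
qed

lemma edge_point_exists:
  assumes "e \<in> edges G" "p \<in> A e" "p \<notin> f ` verts G"
  obtains t where "Edge_Point e t \<in> fibre G f \<gamma> p"
proof -
  have "p \<noteq> pathstart (\<gamma> e)" "p \<noteq> pathfinish (\<gamma> e)"
    using assms ends_edge[OF assms(1)] edge_subset_verts[OF simple_graph assms(1)] by blast+
  then show thesis
    using path_image_interiorE path_image_edge[OF assms(1)] assms that unfolding fibre_iff by metis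
qed

lemma multiple_points_eq_crossings: "multiple_points G f \<gamma> = crossings G f A"
proof (intro equalityI subsetI)
  fix p assume "p \<in> multiple_points G f \<gamma>"
  then obtain x y where xy: "x \<in> fibre G f \<gamma> p" "y \<in> fibre G f \<gamma> p" "x \<noteq> y"
    by (auto simp: multiple_points_def)
  have "p \<notin> f ` verts G"
  proof
    assume "p \<in> f ` verts G"
    then have "\<exists>v\<in>verts G. z = Vertex_Point v \<and> f v = p" if "z \<in> fibre G f \<gamma> p" for z
      using that edge_point_in_fibre(2) by (cases z) (auto simp: fibre_iff)
    then show False
      using xy inj_vertices by (metis inj_onD)
  qed
  then have "\<exists>e t. z = Edge_Point e t" if "z \<in> fibre G f \<gamma> p" for z
    using that by (cases z) (auto simp: fibre_iff)
  then obtain e s e' t where est: "x = Edge_Point e s" "y = Edge_Point e' t"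
    using xy by meson
  then have "e \<noteq> e'"
    using xy edge_point_unique by blast
  then show "p \<in> crossings G f A"
    using \<open>p \<notin> f ` verts G\<close> xy[unfolded est] edge_point_in_fibre(1)
    by (intro crossingsI[of p f G e e' A]) (blast dest: fibre_iff(2)[THEN iffD1])+
next
  fix p assume "p \<in> crossings G f A"
  then obtain e e' where e: "p \<notin> f ` verts G" "e \<in> edges G" "e' \<in> edges G" "e \<noteq> e'" "p \<in> A e" "p \<in> A e'"
    by (rule crossingsE)
  then obtain s t where "Edge_Point e s \<in> fibre G f \<gamma> p" "Edge_Point e' t \<in> fibre G f \<gamma> p"
    using edge_point_exists by metis
  then show "p \<in> multiple_points G f \<gamma>"
    using e(4) unfolding multiple_points_def by blast
qed

lemma crossing_fibre:
  assumes "p \<in> crossings G f A"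
  obtains e s e' t where "fibre G f \<gamma> p = {Edge_Point e s, Edge_Point e' t}"
    "transversal_at (\<gamma> e) s (\<gamma> e') t"
proof -
  obtain e e' where e: "e \<in> edges G" "e' \<in> edges G" "crossing_germ (A e) (A e') p"
    and through: "{d \<in> edges G. p \<in> A d} = {e, e'}"
    using transversal_crossings[OF assms] unfolding transversal_crossing_def by blast
  have p: "p \<notin> f ` verts G"
    using assms by (rule crossingsE)
  have "p \<in> A e" "p \<in> A e'"
    using through by blast+
  then obtain s t where st: "Edge_Point e s \<in> fibre G f \<gamma> p" "Edge_Point e' t \<in> fibre G f \<gamma> p"
    using edge_point_exists[OF e(1) _ p] edge_point_exists[OF e(2) _ p] by metis
  have "x \<in> {Edge_Point e s, Edge_Point e' t}" if x: "x \<in> fibre G f \<gamma> p" for x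
  proof (cases x)
    case (Vertex_Point v)
    then show ?thesis
      using x p by (auto simp: fibre_iff)
  next
    case (Edge_Point d r)
    then have "d \<in> {d \<in> edges G. p \<in> A d}"
      using x edge_point_in_fibre(1) by (auto simp: fibre_iff)
    then have "d = e \<or> d = e'"
      unfolding through by blast
    then show ?thesis
      using x st edge_point_unique unfolding Edge_Point by blast
  qed
  then have "fibre G f \<gamma> p = {Edge_Point e s, Edge_Point e' t}"
    using st by (intro equalityI subsetI) auto
  moreover have "transversal_at (\<gamma> e) s (\<gamma> e') t"
    using st e arc_edge path_image_edge
    by (intro crossing_germ_imp_transversal_at[where p = p]) (auto simp: fibre_iff)
  ultimately show thesis
    by (rule that)
qed

lemma is_drawing: "is_drawing G f \<gamma>"
  unfolding is_drawing_def multiple_points_eq_crossings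
proof (intro conjI ballI)
  show "\<exists>e s e' t. fibre G f \<gamma> p = {Edge_Point e s, Edge_Point e' t} \<and> transversal_at (\<gamma> e) s (\<gamma> e') t"
    if "p \<in> crossings G f A" for p
    using crossing_fibre[OF that] by metis
qed (simp_all add: arc_edge ends_edge finite_crossings arc_imp_path)

end

context arc_drawing
begin

lemma is_drawing_exists:
  obtains \<gamma> where "is_drawing G f \<gamma>" "multiple_points G f \<gamma> = crossings G f A"
proof -
  have "\<exists>g. arc g \<and> path_image g = A e \<and> {pathstart g, pathfinish g} = f ` e" if "e \<in> edges G" for e
    using arc_between_edge[OF that] by (simp add: arc_between_def)
  then obtain \<gamma> where "\<And>e. e \<in> edges G \<Longrightarrow>
      arc (\<gamma> e) \<and> path_image (\<gamma> e) = A e \<and> {pathstart (\<gamma> e), pathfinish (\<gamma> e)} = f ` e"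
    by metis
  then interpret parametrized_arc_drawing G f A \<gamma>
    by unfold_locales blast+
  show thesis
    using that is_drawing multiple_points_eq_crossings .
qed

lemma crossing_number_le: "crossing_number G \<le> card (crossings G f A)"
proof -
  obtain \<gamma> where "is_drawing G f \<gamma>" "multiple_points G f \<gamma> = crossings G f A"
    by (rule is_drawing_exists)
  then show ?thesis
    unfolding crossing_number_def by (intro Least_le) metis
qed

lemma crossing_number_attained:
  obtains f' A' where "arc_drawing G f' A'" "card (crossings G f' A') = crossing_number G"
proof -
  have "\<exists>f \<gamma>. is_drawing G f \<gamma> \<and> card (multiple_points G f \<gamma>) = crossing_number G"
    unfolding crossing_number_def by (rule LeastI_ex) (use is_drawing_exists in metis)
  then obtain f' \<gamma> where D: "is_drawing G f' \<gamma>" "card (multiple_points G f' \<gamma>) = crossing_number G"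
    by blast
  interpret drawing G f' \<gamma>
    by unfold_locales (rule simple_graph D(1))+
  obtain A' where A': "arc_drawing G f' A'" "crossings G f' A' \<subseteq> multiple_points G f' \<gamma>"
    by (rule arc_drawing_exists)
  have "card (crossings G f' A') \<le> crossing_number G"
    using A'(2) D card_mono[of "multiple_points G f' \<gamma>" "crossings G f' A'"]
    by (auto simp: is_drawing_def)
  then show thesis
    using that A'(1) arc_drawing.crossing_number_le[OF A'(1)] by force
qed

end

section \<open>Delta-Y moves and crossings of adjacent edges\<close>

definition triangle_edges :: "'a \<Rightarrow> 'a \<Rightarrow> 'a \<Rightarrow> 'a set set" where
  "triangle_edges a b c = {{a, b}, {b, c}, {c, a}}"

definition delta_Y_graph :: "'a ugraph \<Rightarrow> 'a \<Rightarrow> 'a \<Rightarrow> 'a \<Rightarrow> 'a \<Rightarrow> 'a ugraph" where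
  "delta_Y_graph G a b c v = UGraph (insert v (verts G))
     ((edges G - triangle_edges a b c) \<union> {{v, a}, {v, b}, {v, c}})"

lemma delta_Y_move_delta_Y_graph:
  assumes "distinct [a, b, c]" "triangle_edges a b c \<subseteq> edges G" "v \<notin> verts G"
  shows "delta_Y_move G (delta_Y_graph G a b c v)"
  unfolding delta_Y_move_def delta_Y_graph_def
  by (rule exI[of _ a], rule exI[of _ b], rule exI[of _ c], rule exI[of _ v])
    (use assms in \<open>auto simp: triangle_edges_def\<close>)

lemma (in arc_drawing) crossing_transfer:
  assumes H: "simple_graph H" "\<And>d. d \<in> edges H \<Longrightarrow> arc_between (A' d) (f' ` d)"
    and q: "q \<in> crossings H f' A'" "q \<notin> f ` verts G" and N: "open N" "q \<in> N"
    and src: "\<And>d. \<lbrakk>d \<in> edges H; q \<in> A' d\<rbrakk> \<Longrightarrow> src d \<in> edges G"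
      "\<And>d. \<lbrakk>d \<in> edges H; q \<in> A' d\<rbrakk> \<Longrightarrow> A' d \<inter> N \<subseteq> A (src d)"
    and inj: "inj_on src {d \<in> edges H. q \<in> A' d}"
  shows "q \<in> crossings G f A" "{d \<in> edges G. q \<in> A d} = src ` {d \<in> edges H. q \<in> A' d}"
    "transversal_crossing (edges H) A' q"
proof -
  obtain e e' where q': "q \<notin> f' ` verts H"
    and e: "e \<in> edges H" "e' \<in> edges H" "e \<noteq> e'" "q \<in> A' e" "q \<in> A' e'"
    using q(1) by (rule crossingsE)
  have off_ends: "q \<notin> f' ` d" if "d \<in> edges H" for d
    using q' edge_subset_verts[OF H(1) that] by blast
  have src_ne: "src e \<noteq> src e'"
    using inj e by (auto simp: inj_on_def)
  have src_e: "src e \<in> edges G" "src e' \<in> edges G" "q \<in> A (src e)" "q \<in> A (src e')"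
    using src e N(2) by blast+
  show crossing: "q \<in> crossings G f A"
    using q(2) src_e src_ne by (intro crossingsI[of q f G "src e" "src e'"])
  note source = crossing_edges[OF crossing src_e(1,2) src_ne src_e(3,4)]
  have through: "{d \<in> edges H. q \<in> A' d} = {e, e'}"
  proof (intro equalityI subsetI)
    fix d assume d: "d \<in> {d \<in> edges H. q \<in> A' d}"
    then have "src d \<in> {d \<in> edges G. q \<in> A d}"
      using src N(2) by blast
    then have "src d = src e \<or> src d = src e'"
      unfolding source(1) by simp
    then show "d \<in> {e, e'}"
      using inj d e by (auto simp: inj_on_def)
  qed (use e in auto)
  then show "{d \<in> edges G. q \<in> A d} = src ` {d \<in> edges H. q \<in> A' d}"
    unfolding source(1) by simp
  have "crossing_germ (A' e) (A' e') q"
    by (rule crossing_germ_subarcs[OF source(2) N H(2)[OF e(1)] e(4) off_ends[OF e(1)] src(2)[OF e(1,4)]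
          H(2)[OF e(2)] e(5) off_ends[OF e(2)] src(2)[OF e(2,5)]])
  then show "transversal_crossing (edges H) A' q"
    unfolding transversal_crossing_def using e(1-3) through by blast
qed

locale delta_Y_redrawing = arc_drawing G f A
  for G :: "'a ugraph" and f and A +
  fixes a b c v :: 'a and p :: complex and S :: "'a \<Rightarrow> complex set"
  assumes distinct_corners: "distinct [a, b, c]"
    and triangle: "triangle_edges a b c \<subseteq> edges G"
    and fresh: "v \<notin> verts G"
    and centre_not_vertex: "p \<notin> f ` verts G"
    and centre_on_edge: "\<lbrakk>e \<in> edges G; p \<in> A e\<rbrakk> \<Longrightarrow> e \<in> triangle_edges a b c"
    and star_arc: "w \<in> {a, b, c} \<Longrightarrow> arc_between (S w) {p, f w}"
    and vertex_on_star: "\<lbrakk>w \<in> {a, b, c}; u \<in> verts G; f u \<in> S w\<rbrakk> \<Longrightarrow> u = w"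
begin

definition G\<^sub>Y :: "'a ugraph" where
  "G\<^sub>Y = delta_Y_graph G a b c v"

definition f\<^sub>Y :: "'a \<Rightarrow> complex" where
  "f\<^sub>Y = f(v := p)"

definition A\<^sub>Y :: "'a set \<Rightarrow> complex set" where
  "A\<^sub>Y e = (if v \<in> e then S (the_elem (e - {v})) else A e)"

lemma corners: "w \<in> {a, b, c} \<Longrightarrow> w \<in> verts G" "w \<in> {a, b, c} \<Longrightarrow> w \<noteq> v"
  using triangle edge_subset_verts[OF simple_graph] fresh by (auto simp: triangle_edges_def)

lemma delta_Y_move: "delta_Y_move G G\<^sub>Y"
  unfolding G\<^sub>Y_def using distinct_corners triangle fresh by (rule delta_Y_move_delta_Y_graph)

lemma verts_Y: "verts G\<^sub>Y = insert v (verts G)"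
  by (simp add: G\<^sub>Y_def delta_Y_graph_def)

lemma edges_Y_cases [consumes 1, case_names star old]:
  assumes "e \<in> edges G\<^sub>Y"
  obtains w where "w \<in> {a, b, c}" "e = {v, w}"
  | "e \<in> edges G" "v \<notin> e" "e \<notin> triangle_edges a b c"
  using assms edge_subset_verts[OF simple_graph, of e] fresh
  by (auto simp: G\<^sub>Y_def delta_Y_graph_def)

lemma star_edge: "w \<in> {a, b, c} \<Longrightarrow> {v, w} \<in> edges G\<^sub>Y"
  by (auto simp: G\<^sub>Y_def delta_Y_graph_def)

lemma A\<^sub>Y_star: "w \<in> {a, b, c} \<Longrightarrow> A\<^sub>Y {v, w} = S w"
  using corners(2) by (auto simp: A\<^sub>Y_def insert_Diff_if)

lemma A\<^sub>Y_old: "v \<notin> e \<Longrightarrow> A\<^sub>Y e = A e"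
  by (simp add: A\<^sub>Y_def)

lemma f\<^sub>Y_old: "u \<in> verts G \<Longrightarrow> f\<^sub>Y u = f u"
  using fresh by (auto simp: f\<^sub>Y_def)

lemma image_f\<^sub>Y_verts: "f\<^sub>Y ` verts G\<^sub>Y = insert p (f ` verts G)"
proof -
  have "f\<^sub>Y ` verts G = f ` verts G"
    by (intro image_cong) (simp_all add: f\<^sub>Y_old)
  moreover have "f\<^sub>Y v = p"
    by (simp add: f\<^sub>Y_def)
  ultimately show ?thesis
    by (simp add: verts_Y)
qed

lemma arc_between_Y:
  assumes "e \<in> edges G\<^sub>Y"
  shows "arc_between (A\<^sub>Y e) (f\<^sub>Y ` e)"
  using assms
proof (cases e rule: edges_Y_cases)
  case (star w)
  then have "f\<^sub>Y ` e = {p, f w}"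
    using corners f\<^sub>Y_old by (auto simp: f\<^sub>Y_def)
  then show ?thesis
    using star A\<^sub>Y_star star_arc by simp
next
  case old
  then have "f\<^sub>Y ` e = f ` e"
    using f\<^sub>Y_old edge_subset_verts[OF simple_graph] by (intro image_cong) auto
  then show ?thesis
    using old A\<^sub>Y_old arc_between_edge by simp
qed

lemma vertex_on_edge_Y:
  assumes e: "e \<in> edges G\<^sub>Y" and u: "u \<in> verts G\<^sub>Y" "f\<^sub>Y u \<in> A\<^sub>Y e"
  shows "u \<in> e"
  using e
proof (cases e rule: edges_Y_cases)
  case (star w)
  then show ?thesis
    using u vertex_on_star[of w u] A\<^sub>Y_star f\<^sub>Y_old by (auto simp: verts_Y)
next
  case old
  then have "u \<noteq> v"
    using u(2) centre_on_edge A\<^sub>Y_old by (auto simp: f\<^sub>Y_def)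
  then show ?thesis
    using old u vertex_on_edge A\<^sub>Y_old f\<^sub>Y_old by (auto simp: verts_Y)
qed

lemma arc_drawing_Y:
  assumes "finite (crossings G\<^sub>Y f\<^sub>Y A\<^sub>Y)"
    and "\<And>q. q \<in> crossings G\<^sub>Y f\<^sub>Y A\<^sub>Y \<Longrightarrow> transversal_crossing (edges G\<^sub>Y) A\<^sub>Y q"
  shows "arc_drawing G\<^sub>Y f\<^sub>Y A\<^sub>Y"
proof
  show "simple_graph G\<^sub>Y"
    using simple_graph delta_Y_move by (rule simple_graph_delta_Y_move)
  show "inj_on f\<^sub>Y (verts G\<^sub>Y)"
    using inj_vertices centre_not_vertex fresh by (auto simp: verts_Y f\<^sub>Y_def inj_on_def)
qed (fact arc_between_Y vertex_on_edge_Y assms)+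

definition source :: "('a \<Rightarrow> 'a set) \<Rightarrow> 'a set \<Rightarrow> 'a set" where
  "source \<tau> e = (if v \<in> e then \<tau> (the_elem (e - {v})) else e)"

lemma edges_Y_through_cases [consumes 2, case_names star old]:
  assumes "e \<in> edges G\<^sub>Y" "q \<in> A\<^sub>Y e"
  obtains w where "w \<in> {w \<in> {a, b, c}. q \<in> S w}" "e = {v, w}" "A\<^sub>Y e = S w" "source \<tau> e = \<tau> w"
  | "v \<notin> e" "e \<in> edges G - triangle_edges a b c" "A\<^sub>Y e = A e" "source \<tau> e = e"
  using assms(1)
proof (cases e rule: edges_Y_cases)
  case (star w)
  then have "A\<^sub>Y e = S w" "source \<tau> e = \<tau> w"
    using A\<^sub>Y_star corners(2) by (simp_all add: source_def insert_Diff_if)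
  then show thesis
    using that(1)[of w] star assms(2) by simp
next
  case old
  then show thesis
    using that(2) A\<^sub>Y_old by (simp add: source_def)
qed

text \<open>Near \<open>q\<close>, the new edge \<open>vw\<close> runs along the edge \<open>\<tau> w\<close> of the triangle.\<close>

context
  fixes q :: complex and N :: "complex set" and \<tau> :: "'a \<Rightarrow> 'a set"
  assumes \<tau>_triangle: "\<And>w. \<lbrakk>w \<in> {a, b, c}; q \<in> S w\<rbrakk> \<Longrightarrow> \<tau> w \<in> triangle_edges a b c"
    and star_along: "\<And>w. \<lbrakk>w \<in> {a, b, c}; q \<in> S w\<rbrakk> \<Longrightarrow> S w \<inter> N \<subseteq> A (\<tau> w)"
    and inj_\<tau>: "inj_on \<tau> {w \<in> {a, b, c}. q \<in> S w}"
begin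

lemma source_edge:
  assumes "e \<in> edges G\<^sub>Y" "q \<in> A\<^sub>Y e"
  shows "source \<tau> e \<in> edges G" "A\<^sub>Y e \<inter> N \<subseteq> A (source \<tau> e)"
    "v \<in> e \<longleftrightarrow> source \<tau> e \<in> triangle_edges a b c"
proof -
  have "source \<tau> e \<in> edges G \<and> A\<^sub>Y e \<inter> N \<subseteq> A (source \<tau> e) \<and> (v \<in> e \<longleftrightarrow> source \<tau> e \<in> triangle_edges a b c)"
    using assms
  proof (cases e rule: edges_Y_through_cases[where \<tau> = \<tau>])
    case (star w)
    then have "w \<in> {a, b, c}" "q \<in> S w" "v \<in> e"
      by simp_all
    then show ?thesis
      using star(3,4) \<tau>_triangle[of w] star_along[of w] triangle by (simp add: subsetD)
  next
    case old
    then show ?thesis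
      by simp
  qed
  then show "source \<tau> e \<in> edges G" "A\<^sub>Y e \<inter> N \<subseteq> A (source \<tau> e)"
    "v \<in> e \<longleftrightarrow> source \<tau> e \<in> triangle_edges a b c"
    by blast+
qed

lemma inj_on_source: "inj_on (source \<tau>) {e \<in> edges G\<^sub>Y. q \<in> A\<^sub>Y e}"
proof (rule inj_onI)
  fix d e assume "d \<in> {e \<in> edges G\<^sub>Y. q \<in> A\<^sub>Y e}" "e \<in> {e \<in> edges G\<^sub>Y. q \<in> A\<^sub>Y e}"
  then have d: "d \<in> edges G\<^sub>Y" "q \<in> A\<^sub>Y d" and e: "e \<in> edges G\<^sub>Y" "q \<in> A\<^sub>Y e"
    by auto
  assume eq: "source \<tau> d = source \<tau> e"
  then have same_kind: "v \<in> d \<longleftrightarrow> v \<in> e"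
    using source_edge(3)[OF d] source_edge(3)[OF e] by metis
  from d show "d = e"
  proof (cases d rule: edges_Y_through_cases[where \<tau> = \<tau>])
    case d_star: (star w)
    from e show ?thesis
    proof (cases e rule: edges_Y_through_cases[where \<tau> = \<tau>])
      case (star w')
      then have "w = w'"
        using inj_onD[OF inj_\<tau> _ d_star(1) star(1)] d_star(4) eq by simp
      then show ?thesis
        using d_star(2) star(2) by simp
    qed (use same_kind d_star(2) in simp)
  next
    case d_old: old
    from e show ?thesis
      by (cases e rule: edges_Y_through_cases[where \<tau> = \<tau>]) (use same_kind d_old(1,4) eq in simp_all)
  qed
qed

lemma crossing_transfer_Y:
  assumes q: "q \<in> crossings G\<^sub>Y f\<^sub>Y A\<^sub>Y" and N: "open N" "q \<in> N"
  shows "q \<in> crossings G f A" "transversal_crossing (edges G\<^sub>Y) A\<^sub>Y q"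
    "\<And>e. \<lbrakk>e \<in> triangle_edges a b c; q \<in> A e\<rbrakk> \<Longrightarrow> \<exists>w\<in>{a, b, c}. q \<in> S w \<and> \<tau> w = e"
proof -
  have "q \<notin> f ` verts G"
    using q image_f\<^sub>Y_verts by (auto elim: crossingsE)
  moreover have "simple_graph G\<^sub>Y"
    using simple_graph delta_Y_move by (rule simple_graph_delta_Y_move)
  ultimately have transfer: "q \<in> crossings G f A"
    "{d \<in> edges G. q \<in> A d} = source \<tau> ` {d \<in> edges G\<^sub>Y. q \<in> A\<^sub>Y d}"
    "transversal_crossing (edges G\<^sub>Y) A\<^sub>Y q"
    using crossing_transfer[OF _ arc_between_Y q _ N _ _ inj_on_source] source_edge(1,2) by simp_all
  show "q \<in> crossings G f A" "transversal_crossing (edges G\<^sub>Y) A\<^sub>Y q"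
    by (fact transfer)+
  fix e assume e: "e \<in> triangle_edges a b c" "q \<in> A e"
  then have "e \<in> {d \<in> edges G. q \<in> A d}"
    using triangle by auto
  then obtain d where d: "d \<in> edges G\<^sub>Y" "q \<in> A\<^sub>Y d" "e = source \<tau> d"
    unfolding transfer(2) by blast
  from d(1,2) show "\<exists>w\<in>{a, b, c}. q \<in> S w \<and> \<tau> w = e"
  proof (cases d rule: edges_Y_through_cases[where \<tau> = \<tau>])
    case (star w)
    then show ?thesis
      using d(3) by (intro bexI[of _ w]) simp_all
  qed (use d(3) e(1) in simp)
qed

end

end

locale crossing_star = arc_drawing G f A
  for G :: "'a ugraph" and f and A +
  fixes a b c v :: 'a and p :: complex and S :: "'a \<Rightarrow> complex set"
  assumes distinct_abc: "distinct [a, b, c]"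
    and triangle_abc: "triangle_edges a b c \<subseteq> edges G"
    and fresh_vertex: "v \<notin> verts G"
    and crossing: "p \<in> crossings G f A" "p \<in> A {a, b}" "p \<in> A {c, a}"
    and arc_to_corner: "w \<in> {a, b, c} \<Longrightarrow> arc_between (S w) {p, f w}"
    and star_ab: "S a \<union> S b = A {a, b}" "S a \<inter> S b = {p}"
    and star_c: "S c \<subseteq> A {c, a}"
    and other_ends: "f b \<notin> S a" "f a \<notin> S b" "f a \<notin> S c"
begin

definition host_edge :: "'a \<Rightarrow> 'a set" where
  "host_edge w = (if w = c then {c, a} else {a, b})"

lemma host_edge_simps: "host_edge a = {a, b}" "host_edge b = {a, b}" "host_edge c = {c, a}"
  using distinct_abc by (auto simp: host_edge_def)

lemma host_edge_in_triangle: "host_edge w \<in> triangle_edges a b c"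
  by (simp add: host_edge_def triangle_edges_def)

lemma edges_abc: "{a, b} \<in> edges G" "{c, a} \<in> edges G" "{a, b} \<noteq> {c, a}"
  using triangle_abc distinct_abc by (auto simp: triangle_edges_def doubleton_eq_iff)

lemma star_subset_host_edge: "w \<in> {a, b, c} \<Longrightarrow> S w \<subseteq> A (host_edge w)"
  using star_ab(1) star_c host_edge_simps by auto

sublocale delta_Y_redrawing G f A a b c v p S
proof
  show "p \<notin> f ` verts G"
    using crossing(1) by (rule crossingsE)
  show "e \<in> triangle_edges a b c" if "e \<in> edges G" "p \<in> A e" for e
  proof -
    have "e \<in> {d \<in> edges G. p \<in> A d}"
      using that by simp
    then show ?thesis
      unfolding crossing_edges(1)[OF crossing(1) edges_abc crossing(2,3)]
      by (auto simp: triangle_edges_def)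
  qed
  show "u = w" if w: "w \<in> {a, b, c}" and u: "u \<in> verts G" "f u \<in> S w" for u w
  proof -
    have "host_edge w \<in> edges G" "f u \<in> A (host_edge w)"
      using host_edge_in_triangle triangle_abc star_subset_host_edge[OF w] u(2) by blast+
    then have "u \<in> host_edge w"
      using vertex_on_edge u(1) by blast
    then show ?thesis
      using w u host_edge_simps other_ends by auto
  qed
qed (fact distinct_abc triangle_abc fresh_vertex arc_to_corner)+

lemma star_crossing_transfer:
  assumes q: "q \<in> crossings G\<^sub>Y f\<^sub>Y A\<^sub>Y"
  shows "q \<in> crossings G f A - {p}" "transversal_crossing (edges G\<^sub>Y) A\<^sub>Y q"
proof -
  have "q \<noteq> p"
    using q image_f\<^sub>Y_verts by (auto elim: crossingsE)
  then have inj: "inj_on host_edge {w \<in> {a, b, c}. q \<in> S w}"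
    using star_ab(2) host_edge_simps edges_abc(3) by (auto simp: inj_on_def)
  have along: "S w \<inter> UNIV \<subseteq> A (host_edge w)" if "w \<in> {a, b, c}" for w
    using star_subset_host_edge[OF that] by simp
  show "q \<in> crossings G f A - {p}" "transversal_crossing (edges G\<^sub>Y) A\<^sub>Y q"
    using crossing_transfer_Y(1,2)[OF host_edge_in_triangle along inj q open_UNIV UNIV_I] \<open>q \<noteq> p\<close>
    by simp_all
qed

lemma delta_Y_crossing_star:
  "arc_drawing G\<^sub>Y f\<^sub>Y A\<^sub>Y" "crossings G\<^sub>Y f\<^sub>Y A\<^sub>Y \<subseteq> crossings G f A - {p}"
proof -
  show sub: "crossings G\<^sub>Y f\<^sub>Y A\<^sub>Y \<subseteq> crossings G f A - {p}"
    using star_crossing_transfer(1) by (rule subsetI)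
  then have "finite (crossings G\<^sub>Y f\<^sub>Y A\<^sub>Y)"
    using finite_crossings by (meson finite_Diff finite_subset)
  then show "arc_drawing G\<^sub>Y f\<^sub>Y A\<^sub>Y"
    using star_crossing_transfer(2) by (rule arc_drawing_Y)
qed

end

lemma (in arc_drawing) delta_Y_at_crossing:
  assumes distinct: "distinct [a, b, c]" and triangle: "triangle_edges a b c \<subseteq> edges G"
    and v: "v \<notin> verts G" and p: "p \<in> crossings G f A" "p \<in> A {a, b}" "p \<in> A {c, a}"
  obtains f' A' where "arc_drawing (delta_Y_graph G a b c v) f' A'"
    "crossings (delta_Y_graph G a b c v) f' A' \<subseteq> crossings G f A - {p}"
proof -
  have edges: "{a, b} \<in> edges G" "{c, a} \<in> edges G"
    using triangle by (auto simp: triangle_edges_def)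
  have "p \<notin> f ` verts G"
    using p(1) by (rule crossingsE)
  then have p_ne: "p \<noteq> f a" "p \<noteq> f b" "p \<noteq> f c"
    using edges edge_subset_verts[OF simple_graph] by blast+
  have arcs: "arc_between (A {a, b}) {f a, f b}" "arc_between (A {c, a}) {f c, f a}"
    using arc_between_edge[OF edges(1)] arc_between_edge[OF edges(2)] by simp_all
  obtain B C where BC: "arc_between B {p, f a}" "arc_between C {p, f b}" "B \<union> C = A {a, b}"
    "B \<inter> C = {p}" "f b \<notin> B" "f a \<notin> C"
    by (rule arc_between_split[OF arcs(1) p(2) p_ne(1,2)])
  obtain E E' where E: "arc_between E {p, f c}" "arc_between E' {p, f a}" "E \<union> E' = A {c, a}"
    "E \<inter> E' = {p}" "f a \<notin> E" "f c \<notin> E'"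
    by (rule arc_between_split[OF arcs(2) p(3) p_ne(3,1)])
  define S where "S w = (if w = a then B else if w = b then C else E)" for w
  have S: "S a = B" "S b = C" "S c = E"
    using distinct by (auto simp: S_def)
  interpret crossing_star G f A a b c v p S
    by unfold_locales (use distinct triangle v p BC E S in auto)
  show thesis
    using that[of f\<^sub>Y A\<^sub>Y] delta_Y_crossing_star by (simp only: G\<^sub>Y_def)
qed

section \<open>Redrawing the edges at a vertex radially\<close>

locale radial_disc = arc_drawing G f A
  for G :: "'a ugraph" and f and A +
  fixes c :: 'a and o' :: complex and r :: real and P :: "'a \<Rightarrow> complex"
  assumes centre: "c \<in> verts G" "f c \<in> ball o' r"
    and other_vertices: "\<lbrakk>w \<in> verts G; w \<noteq> c\<rbrakk> \<Longrightarrow> f w \<notin> cball o' r"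
    and no_crossings: "crossings G f A \<inter> cball o' r = {}"
    and far_edge: "\<lbrakk>e \<in> edges G; c \<notin> e\<rbrakk> \<Longrightarrow> A e \<inter> cball o' r = {}"
    and radial_edge: "{c, z} \<in> edges G \<Longrightarrow> A {c, z} \<inter> cball o' r = closed_segment (f c) (P z)"
    and entry_point: "{c, z} \<in> edges G \<Longrightarrow> P z \<in> sphere o' r"
begin

lemma edge_in_discE:
  assumes "e \<in> edges G" "q \<in> A e" "q \<in> cball o' r"
  obtains z where "e = {c, z}" "q \<in> closed_segment (f c) (P z)"
proof -
  have "c \<in> e"
    using far_edge assms by blast
  then obtain z where z: "e = {c, z}"
    by (rule edge_at_vertexE[OF simple_graph assms(1)])
  moreover have "q \<in> closed_segment (f c) (P z)"
    using radial_edge[of z] assms z by blast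
  ultimately show thesis
    by (rule that)
qed

lemma edge_in_disc_unique:
  assumes "e \<in> edges G" "e' \<in> edges G" "q \<in> A e" "q \<in> A e'" "q \<in> cball o' r" "q \<noteq> f c"
  shows "e = e'"
proof (rule ccontr)
  assume "e \<noteq> e'"
  moreover have "q \<notin> f ` verts G"
    using other_vertices assms(5,6) by auto
  ultimately have "q \<in> crossings G f A"
    using assms(1-4) by (intro crossingsI[of q f G e e'])
  then show False
    using no_crossings assms(5) by blast
qed

lemma entry_point_on_edge: "{c, z} \<in> edges G \<Longrightarrow> P z \<in> A {c, z}"
  using radial_edge[of z] by blast

lemma outer_arcE:
  assumes z: "{c, z} \<in> edges G"
  obtains B where "arc_between B {f z, P z}" "B \<subseteq> A {c, z}" "B \<inter> cball o' r = {P z}"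
proof -
  have "arc_between (A {c, z}) {f z, f c}"
    using arc_between_edge[OF z] by (simp add: insert_commute)
  moreover have "f z \<notin> cball o' r" "f c \<in> cball o' r"
    using other_vertices edge_ends[OF z] centre(2) by auto
  ultimately obtain B Q where B: "arc_between B {f z, Q}" "B \<subseteq> A {c, z}" "B \<inter> cball o' r = {Q}"
    and "Q \<in> frontier (cball o' r)"
    using arc_between_first_hit[OF _ closed_cball] by metis
  then have Q: "Q \<in> sphere o' r" "Q \<in> closed_segment (f c) (P z)"
    using radial_edge[OF z] by auto
  then have "Q = P z"
    using closed_segment_subset_ball[of "f c" o' r "P z"] centre(2) entry_point[OF z] by auto
  then show thesis
    using that B by blast
qed

end

text \<open>Edge \<open>cz\<close> is kept up to the point \<open>P z\<close> where it first enters a small disc around \<open>c\<close>, and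
  continued by a segment from there to the new position of \<open>c\<close>.\<close>

locale vertex_disc = arc_drawing G f A
  for G :: "'a ugraph" and f and A +
  fixes c :: 'a and r :: real and B :: "'a \<Rightarrow> complex set" and P :: "'a \<Rightarrow> complex"
  assumes vertex: "c \<in> verts G"
    and radius: "0 < r"
    and other_vertices: "\<lbrakk>w \<in> verts G; w \<noteq> c\<rbrakk> \<Longrightarrow> f w \<notin> cball (f c) r"
    and no_crossings: "crossings G f A \<inter> cball (f c) r = {}"
    and far_edge: "\<lbrakk>e \<in> edges G; c \<notin> e\<rbrakk> \<Longrightarrow> A e \<inter> cball (f c) r = {}"
    and outer_arc: "{c, z} \<in> edges G \<Longrightarrow> arc_between (B z) {f z, P z}"
    and outer_arc_subset: "{c, z} \<in> edges G \<Longrightarrow> B z \<subseteq> A {c, z}"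
    and outer_arc_in_disc: "{c, z} \<in> edges G \<Longrightarrow> B z \<inter> cball (f c) r = {P z}"
    and entry_point: "{c, z} \<in> edges G \<Longrightarrow> P z \<in> sphere (f c) r"
begin

lemma edge_cases [consumes 1, case_names near far]:
  assumes "e \<in> edges G"
  obtains z where "{c, z} \<in> edges G" "e = {c, z}" | "c \<notin> e"
  using assms edge_at_vertexE[OF simple_graph assms, of c] by metis

lemma inj_entry_point: "inj_on P {z. {c, z} \<in> edges G}"
proof (rule inj_onI, rule ccontr)
  fix z z' assume z: "z \<in> {z. {c, z} \<in> edges G}" "z' \<in> {z. {c, z} \<in> edges G}" "P z = P z'" "z \<noteq> z'"
  then have "P z \<in> A {c, z}" "P z \<in> A {c, z'}" "P z \<in> cball (f c) r"
    using outer_arc_subset[of z] outer_arc_in_disc[of z] outer_arc_subset[of z'] outer_arc_in_disc[of z']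
    by auto
  moreover have "P z \<noteq> f c"
    using entry_point[of z] z radius by auto
  then have "P z \<notin> f ` verts G"
    using other_vertices \<open>P z \<in> cball (f c) r\<close> by (metis imageE)
  moreover have "{c, z} \<noteq> {c, z'}"
    using z(4) by (auto simp: doubleton_eq_iff)
  ultimately have "P z \<in> crossings G f A"
    using z by (intro crossingsI[of "P z" f G "{c, z}" "{c, z'}"]) simp_all
  then show False
    using no_crossings \<open>P z \<in> cball (f c) r\<close> by blast
qed

definition radial_arcs :: "complex \<Rightarrow> 'a set \<Rightarrow> complex set" where
  "radial_arcs c' e =
     (if c \<in> e then B (the_elem (e - {c})) \<union> closed_segment c' (P (the_elem (e - {c}))) else A e)"

lemma radial_arcs_near: "{c, z} \<in> edges G \<Longrightarrow> radial_arcs c' {c, z} = B z \<union> closed_segment c' (P z)"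
  using edge_ends(3) by (auto simp: radial_arcs_def insert_Diff_if)

lemma radial_arcs_far: "c \<notin> e \<Longrightarrow> radial_arcs c' e = A e"
  by (simp add: radial_arcs_def)

context
  fixes c' :: complex
  assumes c': "c' \<in> ball (f c) r"
begin

lemma segment_in_disc: "{c, z} \<in> edges G \<Longrightarrow> closed_segment c' (P z) \<subseteq> cball (f c) r"
  using c' entry_point by (intro closed_segment_subset) auto

lemma radial_arcs_in_disc:
  assumes z: "{c, z} \<in> edges G"
  shows "radial_arcs c' {c, z} \<inter> cball (f c) r = closed_segment c' (P z)"
  using outer_arc_in_disc[OF z] segment_in_disc[OF z]
  by (simp add: radial_arcs_near[OF z] Int_Un_distrib2 Int_absorb2 insert_absorb)

lemma radial_arcs_outside_disc:
  assumes "e \<in> edges G"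
  shows "radial_arcs c' e \<inter> - cball (f c) r \<subseteq> A e"
  using assms
proof (cases e rule: edge_cases)
  case (near z)
  then show ?thesis
    using outer_arc_subset segment_in_disc radial_arcs_near by blast
qed (simp_all add: radial_arcs_far)

lemma arc_between_radial_arcs:
  assumes "e \<in> edges G"
  shows "arc_between (radial_arcs c' e) (f(c := c') ` e)"
  using assms
proof (cases e rule: edge_cases)
  case (near z)
  have "c' \<noteq> P z"
    using c' entry_point near(1) by auto
  then have "arc_between (closed_segment c' (P z)) {P z, c'}"
    using arc_between_closed_segment[of c' "P z"] by (simp add: insert_commute)
  moreover have "B z \<inter> closed_segment c' (P z) \<subseteq> {P z}"
    using outer_arc_in_disc segment_in_disc near(1) by blast
  ultimately have "arc_between (B z \<union> closed_segment c' (P z)) {f z, c'}"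
    using arc_between_join outer_arc near(1) by blast
  moreover have "f(c := c') ` e = {f z, c'}"
    using near edge_ends(3) by auto
  ultimately show ?thesis
    using near radial_arcs_near by simp
next
  case far
  then have "f(c := c') ` e = f ` e"
    by (intro image_cong) auto
  then show ?thesis
    using assms far radial_arcs_far arc_between_edge by simp
qed

lemma vertex_on_radial_arc:
  assumes e: "e \<in> edges G" and w: "w \<in> verts G" "(f(c := c')) w \<in> radial_arcs c' e"
  shows "w \<in> e"
proof (cases "w = c")
  case True
  then have "c' \<in> radial_arcs c' e" "c' \<in> cball (f c) r"
    using w(2) c' by auto
  then show ?thesis
    using far_edge[OF e] radial_arcs_far[of e c'] True by (cases "c \<in> e") auto
next
  case False
  then have "f w \<in> A e"
    using radial_arcs_outside_disc[OF e] other_vertices w by auto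
  then show ?thesis
    using vertex_on_edge e w(1) by blast
qed

lemma radial_crossing_transfer:
  assumes q: "q \<in> crossings G (f(c := c')) (radial_arcs c')"
  shows "q \<in> crossings G f A" "transversal_crossing (edges G) (radial_arcs c') q" "q \<notin> cball (f c) r"
proof -
  obtain e e' where q_vertex: "q \<notin> f(c := c') ` verts G"
    and e: "e \<in> edges G" "e' \<in> edges G" "e \<noteq> e'" "q \<in> radial_arcs c' e" "q \<in> radial_arcs c' e'"
    using q by (rule crossingsE)
  have "q \<noteq> c'"
    using q_vertex vertex by auto
  have on_segment: "\<exists>z. {c, z} \<in> edges G \<and> d = {c, z} \<and> q \<in> closed_segment c' (P z)"
    if "d \<in> edges G" "q \<in> radial_arcs c' d" "q \<in> cball (f c) r" for d
    using that(1)
  proof (cases d rule: edge_cases)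
    case (near z)
    then show ?thesis
      using radial_arcs_in_disc that by blast
  qed (use far_edge that radial_arcs_far in blast)
  show out: "q \<notin> cball (f c) r"
  proof
    assume "q \<in> cball (f c) r"
    then obtain z z' where z: "{c, z} \<in> edges G" "e = {c, z}" "q \<in> closed_segment c' (P z)"
      and z': "{c, z'} \<in> edges G" "e' = {c, z'}" "q \<in> closed_segment c' (P z')"
      using on_segment e by meson
    then have "P z \<noteq> P z'"
      using inj_entry_point e(3) by (auto dest: inj_onD)
    then show False
      using radial_segments_meet[OF entry_point[OF z(1)] entry_point[OF z'(1)] _ c' z(3) z'(3)] \<open>q \<noteq> c'\<close>
      by blast
  qed
  then have "q \<noteq> f c"
    using radius by auto
  then have "q \<notin> f ` verts G"
    using q_vertex by (auto simp: image_iff)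
  then show "q \<in> crossings G f A" "transversal_crossing (edges G) (radial_arcs c') q"
    using crossing_transfer[OF simple_graph arc_between_radial_arcs q, of "- cball (f c) r" "\<lambda>e. e"]
      out radial_arcs_outside_disc by auto
qed

lemma radial_disc: "radial_disc G (f(c := c')) (radial_arcs c') c (f c) r P"
proof
  show "inj_on (f(c := c')) (verts G)"
    using inj_vertices other_vertices c' by (force simp: inj_on_def)
  show "finite (crossings G (f(c := c')) (radial_arcs c'))"
    using radial_crossing_transfer(1) finite_crossings by (auto intro: finite_subset)
  show "crossings G (f(c := c')) (radial_arcs c') \<inter> cball (f c) r = {}"
    using radial_crossing_transfer(3) by blast
  show "radial_arcs c' e \<inter> cball (f c) r = {}" if "e \<in> edges G" "c \<notin> e" for e
    using far_edge that radial_arcs_far by simp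
  show "radial_arcs c' {c, z} \<inter> cball (f c) r = closed_segment ((f(c := c')) c) (P z)"
    if "{c, z} \<in> edges G" for z
    using radial_arcs_in_disc that by simp
qed (use simple_graph arc_between_radial_arcs vertex_on_radial_arc radial_crossing_transfer(2)
      vertex c' other_vertices entry_point in auto)

end

end

context arc_drawing
begin

lemma vertex_neighbourhood:
  assumes c: "c \<in> verts G"
  obtains r where "0 < r" "\<And>w. \<lbrakk>w \<in> verts G; w \<noteq> c\<rbrakk> \<Longrightarrow> f w \<notin> cball (f c) r"
    "crossings G f A \<inter> cball (f c) r = {}" "\<And>e. \<lbrakk>e \<in> edges G; c \<notin> e\<rbrakk> \<Longrightarrow> A e \<inter> cball (f c) r = {}"
proof -
  define F where "F = f ` (verts G - {c}) \<union> crossings G f A \<union> (\<Union>e\<in>{e \<in> edges G. c \<notin> e}. A e)"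
  have "closed F"
    unfolding F_def using finite_verts finite_crossings finite_edges[OF simple_graph]
    by (intro closed_Un closed_UN) (auto intro: finite_imp_closed closed_arc_between arc_between_edge)
  moreover have "f c \<notin> F"
    using c inj_vertices vertex_on_edge by (auto simp: F_def crossings_def inj_on_def)
  ultimately obtain r where "0 < r" "cball (f c) r \<subseteq> - F"
    using open_contains_cball[of "- F"] by auto
  then show thesis
    by (intro that[of r]) (auto simp: F_def)
qed

lemma vertex_disc_exists:
  assumes c: "c \<in> verts G"
  obtains r B P where "vertex_disc G f A c r B P"
proof -
  obtain r where r: "0 < r" and others: "\<And>w. \<lbrakk>w \<in> verts G; w \<noteq> c\<rbrakk> \<Longrightarrow> f w \<notin> cball (f c) r"
    and disc: "crossings G f A \<inter> cball (f c) r = {}"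
      "\<And>e. \<lbrakk>e \<in> edges G; c \<notin> e\<rbrakk> \<Longrightarrow> A e \<inter> cball (f c) r = {}"
    using vertex_neighbourhood[OF c] by metis
  have "\<exists>B P. arc_between B {f z, P} \<and> B \<subseteq> A {c, z} \<and> B \<inter> cball (f c) r = {P} \<and> P \<in> sphere (f c) r"
    if z: "{c, z} \<in> edges G" for z
  proof -
    have "f z \<notin> cball (f c) r" "f c \<in> cball (f c) r"
      using others edge_ends[OF z] r by auto
    moreover have "arc_between (A {c, z}) {f z, f c}"
      using arc_between_edge[OF z] by (simp add: insert_commute)
    ultimately obtain B P where "arc_between B {f z, P}" "B \<subseteq> A {c, z}" "B \<inter> cball (f c) r = {P}"
      "P \<in> frontier (cball (f c) r)"
      using arc_between_first_hit[OF _ closed_cball] by metis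
    then show ?thesis
      by auto
  qed
  then obtain B P where BP: "\<And>z. {c, z} \<in> edges G \<Longrightarrow> arc_between (B z) {f z, P z} \<and> B z \<subseteq> A {c, z} \<and>
      B z \<inter> cball (f c) r = {P z} \<and> P z \<in> sphere (f c) r"
    by metis
  have "vertex_disc G f A c r B P"
    by unfold_locales (use c r others disc BP in auto)
  then show thesis
    by (rule that)
qed

end

section \<open>Delta-Y moves that remove an edge with many crossings\<close>

text \<open>The new vertex is put at \<open>P x\<close>, so that only the chord from \<open>P x\<close> to \<open>P y\<close>, which belongs to the
  edge \<open>vy\<close>, can create new crossings: at most one with each radial segment at \<open>c\<close>.\<close>

locale radial_triangle = radial_disc G f A c o' r P
  for G :: "'a ugraph" and f and A and c and o' and r and P +
  fixes x y v :: 'a and Bx By :: "complex set"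
  assumes distinct_cxy: "distinct [c, x, y]"
    and triangle_cxy: "triangle_edges c x y \<subseteq> edges G"
    and fresh_vertex: "v \<notin> verts G"
    and outer_x: "arc_between Bx {f x, P x}" "Bx \<subseteq> A {c, x}" "Bx \<inter> cball o' r = {P x}"
    and outer_y: "arc_between By {f y, P y}" "By \<subseteq> A {c, y}" "By \<inter> cball o' r = {P y}"
    and off_chord: "wedge (P y - P x) (f c - P x) \<noteq> 0"
begin

definition chord :: "complex set" where
  "chord = closed_segment (P x) (P y)"

definition star :: "'a \<Rightarrow> complex set" where
  "star w = (if w = x then Bx else if w = y then By \<union> chord else closed_segment (f c) (P x))"

lemma star_simps: "star x = Bx" "star y = By \<union> chord" "star c = closed_segment (f c) (P x)"
  using distinct_cxy by (auto simp: star_def)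

lemma edges_cxy: "{c, x} \<in> edges G" "{c, y} \<in> edges G"
  using triangle_cxy by (auto simp: triangle_edges_def insert_commute)

lemma entry_points: "P x \<in> sphere o' r" "P y \<in> sphere o' r" "P x \<noteq> P y"
  using entry_point edges_cxy off_chord by (auto simp: wedge.zero_left)

lemma chord_in_disc: "chord \<subseteq> cball o' r"
  unfolding chord_def using entry_points by (intro closed_segment_subset) auto

lemma spoke_in_disc: "closed_segment (f c) (P x) \<subseteq> cball o' r"
  using entry_points centre(2) by (intro closed_segment_subset) auto

lemma spoke_subset: "closed_segment (f c) (P x) \<subseteq> A {c, x}"
  using radial_edge[OF edges_cxy(1)] by blast

lemma centre_notin_chord: "f c \<notin> chord"
  using wedge_closed_segment[of "P x" "P x" "P y" "f c"] off_chord by (auto simp: chord_def)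

lemma chord_meets_spoke: "q \<in> chord \<Longrightarrow> q \<in> closed_segment (f c) (P x) \<Longrightarrow> q = P x"
  using transversal_segments_meet_once[OF off_chord, of "P x" q]
  by (simp add: chord_def closed_segment_commute)

sublocale delta_Y_redrawing G f A c x y v "P x" star
proof
  have P_x: "P x \<in> A {c, x}" "P x \<in> cball o' r" "P x \<noteq> f c"
    using entry_point_on_edge[OF edges_cxy(1)] entry_points centre(2) by auto
  then show "P x \<notin> f ` verts G"
    using other_vertices by (metis imageE)
  show "e \<in> triangle_edges c x y" if "e \<in> edges G" "P x \<in> A e" for e
    using edge_in_disc_unique[OF that(1) edges_cxy(1) that(2) P_x] by (simp add: triangle_edges_def)
  have "arc_between (By \<union> chord) {f y, P x}"
    using outer_y chord_in_disc entry_points(3) arc_between_closed_segment[of "P y" "P x"]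
    by (intro arc_between_join) (auto simp: chord_def closed_segment_commute)
  moreover have "arc_between (closed_segment (f c) (P x)) {f c, P x}"
    using P_x(3) by (intro arc_between_closed_segment) simp
  ultimately show "arc_between (star w) {P x, f w}" if "w \<in> {c, x, y}" for w
    using that outer_x(1) by (auto simp: star_simps insert_commute)
  show "u = w" if w: "w \<in> {c, x, y}" and u: "u \<in> verts G" "f u \<in> star w" for w u
  proof (cases "f u \<in> cball o' r")
    case True
    then have "u = c"
      using other_vertices u(1) by blast
    moreover have "f c \<in> cball o' r" "f c \<noteq> P x" "f c \<noteq> P y"
      using centre(2) entry_points by auto
    then have "f c \<notin> Bx" "f c \<notin> By"
      using outer_x(3) outer_y(3) by blast+
    ultimately show ?thesis
      using w u(2) centre_notin_chord by (auto simp: star_simps)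
  next
    case False
    then have "f u \<notin> chord" "f u \<notin> closed_segment (f c) (P x)"
      using chord_in_disc spoke_in_disc by blast+
    then have "w = x \<and> f u \<in> Bx \<or> w = y \<and> f u \<in> By"
      using w u(2) by (auto simp: star_simps)
    then have "w \<noteq> c" "f u \<in> A {c, w}" "{c, w} \<in> edges G"
      using outer_x(2) outer_y(2) edges_cxy distinct_cxy by auto
    then have "u \<in> {c, w}"
      using vertex_on_edge u(1) by blast
    then show ?thesis
      using False centre(2) by auto
  qed
qed (fact distinct_cxy triangle_cxy fresh_vertex)+

lemma star_edge_in_disc:
  assumes "w \<in> {c, x, y}" "q \<in> star w" "q \<in> cball o' r" "q \<noteq> P x" "q \<in> chord"
  shows "w = y"
  using assms outer_x(3) chord_meets_spoke by (auto simp: star_simps)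

lemma edges_through_chord_crossing:
  assumes q: "q \<in> crossings G\<^sub>Y f\<^sub>Y A\<^sub>Y" "q \<in> chord"
  obtains z where "{c, z} \<in> edges G" "{c, z} \<in> edges G\<^sub>Y" "z \<noteq> v" "q \<in> closed_segment (f c) (P z)"
    "{d \<in> edges G\<^sub>Y. q \<in> A\<^sub>Y d} = {{v, y}, {c, z}}"
proof -
  have in_disc: "q \<in> cball o' r"
    using q(2) chord_in_disc by blast
  have ne: "q \<noteq> P x" "q \<noteq> f c"
    using q image_f\<^sub>Y_verts centre_notin_chord by (auto elim: crossingsE)
  have cases: "d = {v, y} \<or> (d \<in> edges G \<and> q \<in> A d \<and> v \<notin> d)" if "d \<in> edges G\<^sub>Y" "q \<in> A\<^sub>Y d" for d
    using that(1)
  proof (cases d rule: edges_Y_cases)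
    case (star w)
    then show ?thesis
      using star_edge_in_disc[of w q] that(2) A\<^sub>Y_star in_disc ne(1) q(2) by auto
  next
    case old
    then show ?thesis
      using that(2) A\<^sub>Y_old by simp
  qed
  obtain e e' where e: "e \<in> edges G\<^sub>Y" "e' \<in> edges G\<^sub>Y" "e \<noteq> e'" "q \<in> A\<^sub>Y e" "q \<in> A\<^sub>Y e'"
    using q(1) by (rule crossingsE)
  then obtain d where d: "d \<in> edges G\<^sub>Y" "d \<in> edges G" "q \<in> A d" "q \<in> A\<^sub>Y d" "v \<notin> d"
    using cases[OF e(1,4)] cases[OF e(2,5)] by metis
  obtain z where z: "d = {c, z}" "q \<in> closed_segment (f c) (P z)"
    by (rule edge_in_discE[OF d(2,3) in_disc])
  have "d' \<in> {{v, y}, {c, z}}" if "d' \<in> edges G\<^sub>Y" "q \<in> A\<^sub>Y d'" for d'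
    using cases[OF that] edge_in_disc_unique[OF _ d(2) _ d(3) in_disc ne(2)] z(1) by auto
  then have "{d \<in> edges G\<^sub>Y. q \<in> A\<^sub>Y d} \<subseteq> {{v, y}, {c, z}}"
    by blast
  moreover have "{v, y} \<in> edges G\<^sub>Y" "q \<in> A\<^sub>Y {v, y}"
    using star_edge[of y] A\<^sub>Y_star[of y] q(2) by (simp_all add: star_simps)
  ultimately have through: "{d \<in> edges G\<^sub>Y. q \<in> A\<^sub>Y d} = {{v, y}, {c, z}}"
    using d(1,4) z(1) by blast
  show thesis
    by (rule that[OF _ _ _ z(2) through]) (use d z(1) in auto)
qed

lemma chord_transversal_to_spokes:
  assumes "q \<in> chord" "q \<in> closed_segment (f c) (P z)"
  shows "wedge (P y - P x) (P z - f c) \<noteq> 0"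
  using crossing_segments_transversal[OF off_chord] assms by (simp add: chord_def)

lemma A\<^sub>Y_spoke: "z \<noteq> v \<Longrightarrow> A\<^sub>Y {c, z} = A {c, z}"
  using centre(1) fresh_vertex by (intro A\<^sub>Y_old) auto

lemma A\<^sub>Y_vy_in_disc: "A\<^sub>Y {v, y} \<inter> cball o' r = chord"
proof -
  have "P y \<in> chord"
    by (simp add: chord_def)
  then show ?thesis
    using A\<^sub>Y_star[of y] outer_y(3) chord_in_disc
    by (simp add: star_simps Int_Un_distrib2 Int_absorb2 insert_absorb)
qed

lemma chord_crossing_in_ball:
  assumes q: "q \<in> crossings G\<^sub>Y f\<^sub>Y A\<^sub>Y" "q \<in> chord"
  shows "q \<in> ball o' r"
proof -
  obtain z where z: "{c, z} \<in> edges G" "{c, z} \<in> edges G\<^sub>Y" "z \<noteq> v" "q \<in> closed_segment (f c) (P z)"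
    and through: "{d \<in> edges G\<^sub>Y. q \<in> A\<^sub>Y d} = {{v, y}, {c, z}}"
    by (rule edges_through_chord_crossing[OF q])
  have "q \<noteq> P y"
  proof
    assume "q = P y"
    moreover have "q \<in> A {c, z}"
      using through A\<^sub>Y_spoke[OF z(3)] by blast
    ultimately have "q \<in> A {c, y}" "q \<in> A {c, z}" "q \<in> cball o' r" "q \<noteq> f c"
      using entry_point_on_edge[OF edges_cxy(2)] q(2) chord_in_disc centre_notin_chord by auto
    then have "{c, y} = {c, z}"
      by (rule edge_in_disc_unique[OF edges_cxy(2) z(1)])
    then have removed: "{c, z} \<in> triangle_edges c x y"
      by (auto simp: triangle_edges_def insert_commute)
    have "c \<noteq> v"
      using centre(1) fresh_vertex by blast
    from z(2) show False
      by (cases rule: edges_Y_cases) (use removed \<open>c \<noteq> v\<close> z(3) in \<open>simp_all add: doubleton_eq_iff\<close>)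
  qed
  moreover have "q \<noteq> P x"
    using q(1) image_f\<^sub>Y_verts by (auto elim: crossingsE)
  ultimately show ?thesis
    using closed_segment_subset_ball[of "P x" o' r "P y"] entry_points q(2) by (auto simp: chord_def)
qed

lemma transversal_chord_crossing:
  assumes q: "q \<in> crossings G\<^sub>Y f\<^sub>Y A\<^sub>Y" "q \<in> chord"
  shows "transversal_crossing (edges G\<^sub>Y) A\<^sub>Y q"
proof -
  obtain z where z: "{c, z} \<in> edges G" "{c, z} \<in> edges G\<^sub>Y" "z \<noteq> v" "q \<in> closed_segment (f c) (P z)"
    and through: "{d \<in> edges G\<^sub>Y. q \<in> A\<^sub>Y d} = {{v, y}, {c, z}}"
    by (rule edges_through_chord_crossing[OF q])
  have e: "{v, y} \<in> edges G\<^sub>Y" "q \<in> A\<^sub>Y {v, y}" "q \<in> A\<^sub>Y {c, z}"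
    using through by blast+
  have off_ends: "q \<notin> f\<^sub>Y ` d" if "d \<in> edges G\<^sub>Y" for d
    using q(1) edge_subset_verts[OF simple_graph_delta_Y_move[OF simple_graph delta_Y_move] that]
    by (auto elim: crossingsE)
  have "crossing_germ (A\<^sub>Y {v, y}) (A\<^sub>Y {c, z}) q"
  proof (rule crossing_germ_subarcs[OF crossing_germ_lines open_ball chord_crossing_in_ball[OF q]])
    show "wedge (P y - P x) (P z - f c) \<noteq> 0"
      using chord_transversal_to_spokes[OF q(2) z(4)] .
    show "A\<^sub>Y {v, y} \<inter> ball o' r \<subseteq> {p. wedge (P y - P x) (p - q) = 0}"
    proof
      fix p assume "p \<in> A\<^sub>Y {v, y} \<inter> ball o' r"
      then have "p \<in> A\<^sub>Y {v, y} \<inter> cball o' r"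
        by simp
      then have "p \<in> chord"
        unfolding A\<^sub>Y_vy_in_disc .
      then show "p \<in> {p. wedge (P y - P x) (p - q) = 0}"
        using wedge_closed_segment[of q "P x" "P y" p] q(2) by (simp add: chord_def)
    qed
    show "A\<^sub>Y {c, z} \<inter> ball o' r \<subseteq> {p. wedge (P z - f c) (p - q) = 0}"
    proof
      fix p assume "p \<in> A\<^sub>Y {c, z} \<inter> ball o' r"
      then have "p \<in> closed_segment (f c) (P z)"
        using radial_edge[OF z(1)] A\<^sub>Y_spoke[OF z(3)] by auto
      then show "p \<in> {p. wedge (P z - f c) (p - q) = 0}"
        using wedge_closed_segment[OF z(4)] by simp
    qed
  qed (fact arc_between_Y[OF e(1)] arc_between_Y[OF z(2)] e(2,3) off_ends[OF e(1)] off_ends[OF z(2)])+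
  moreover have "{v, y} \<noteq> {c, z}"
    using z(3) centre(1) fresh_vertex by (auto simp: doubleton_eq_iff)
  ultimately show ?thesis
    unfolding transversal_crossing_def using through
    by (intro bexI[OF _ e(1)] bexI[OF _ z(2)] conjI)
qed

lemma crossing_off_chord:
  assumes q: "q \<in> crossings G\<^sub>Y f\<^sub>Y A\<^sub>Y" "q \<notin> chord"
  shows "q \<in> crossings G f A - A {x, y}" "transversal_crossing (edges G\<^sub>Y) A\<^sub>Y q"
proof -
  define \<tau> where "\<tau> w = (if w = y then {c, y} else {c, x})" for w
  have \<tau>: "\<tau> x = {c, x}" "\<tau> y = {c, y}" "\<tau> c = {c, x}"
    using distinct_cxy by (auto simp: \<tau>_def)
  have \<tau>_triangle: "\<tau> w \<in> triangle_edges c x y" for w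
    by (auto simp: \<tau>_def triangle_edges_def insert_commute)
  have star_sub: "star w \<inter> - chord \<subseteq> A (\<tau> w)" if "w \<in> {c, x, y}" for w
    using that outer_x(2) outer_y(2) spoke_subset by (auto simp: star_simps \<tau>)
  have "q \<noteq> P x"
    using q(1) image_f\<^sub>Y_verts by (auto elim: crossingsE)
  then have "\<not> (q \<in> star x \<and> q \<in> star c)"
    using outer_x(3) spoke_in_disc by (auto simp: star_simps)
  moreover have "{c, x} \<noteq> {c, y}"
    using distinct_cxy by (auto simp: doubleton_eq_iff)
  ultimately have inj: "inj_on \<tau> {w \<in> {c, x, y}. q \<in> star w}"
    by (auto simp: inj_on_def \<tau>)
  have "open (- chord)" "q \<in> - chord"
    using q(2) by (auto simp: chord_def open_Compl)
  note transfer = crossing_transfer_Y[OF \<tau>_triangle star_sub inj q(1) this]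
  have "q \<notin> A {x, y}"
  proof
    assume "q \<in> A {x, y}"
    then obtain w where "\<tau> w = {x, y}"
      using transfer(3)[of "{x, y}"] by (auto simp: triangle_edges_def)
    then show False
      using distinct_cxy by (auto simp: \<tau>_def doubleton_eq_iff split: if_splits)
  qed
  then show "q \<in> crossings G f A - A {x, y}" "transversal_crossing (edges G\<^sub>Y) A\<^sub>Y q"
    using transfer(1,2) by auto
qed

lemma card_chord_crossings:
  "finite (crossings G\<^sub>Y f\<^sub>Y A\<^sub>Y \<inter> chord)" "card (crossings G\<^sub>Y f\<^sub>Y A\<^sub>Y \<inter> chord) \<le> card (verts G)"
proof -
  have "\<exists>z. {c, z} \<in> edges G \<and> q \<in> closed_segment (f c) (P z)"
    if "q \<in> crossings G\<^sub>Y f\<^sub>Y A\<^sub>Y \<inter> chord" for q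
    using edges_through_chord_crossing[of q] that by blast
  then obtain \<zeta> where \<zeta>: "\<And>q. q \<in> crossings G\<^sub>Y f\<^sub>Y A\<^sub>Y \<inter> chord \<Longrightarrow> {c, \<zeta> q} \<in> edges G"
    "\<And>q. q \<in> crossings G\<^sub>Y f\<^sub>Y A\<^sub>Y \<inter> chord \<Longrightarrow> q \<in> closed_segment (f c) (P (\<zeta> q))"
    by metis
  have inj: "inj_on \<zeta> (crossings G\<^sub>Y f\<^sub>Y A\<^sub>Y \<inter> chord)"
  proof (rule inj_onI)
    fix q q' assume q: "q \<in> crossings G\<^sub>Y f\<^sub>Y A\<^sub>Y \<inter> chord" "q' \<in> crossings G\<^sub>Y f\<^sub>Y A\<^sub>Y \<inter> chord"
      "\<zeta> q = \<zeta> q'"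
    then show "q = q'"
      using transversal_segments_meet_once[OF chord_transversal_to_spokes[OF _ \<zeta>(2)[OF q(1)]], of q q']
        \<zeta>(2)[OF q(1)] \<zeta>(2)[OF q(2)] by (simp add: chord_def)
  qed
  have "\<zeta> ` (crossings G\<^sub>Y f\<^sub>Y A\<^sub>Y \<inter> chord) \<subseteq> verts G"
    using \<zeta>(1) edge_ends(2) by blast
  then show "finite (crossings G\<^sub>Y f\<^sub>Y A\<^sub>Y \<inter> chord)"
    "card (crossings G\<^sub>Y f\<^sub>Y A\<^sub>Y \<inter> chord) \<le> card (verts G)"
    using inj finite_verts by (meson inj_on_finite, meson card_inj_on_le)
qed

lemma delta_Y_radial_triangle:
  "arc_drawing G\<^sub>Y f\<^sub>Y A\<^sub>Y"
  "card (crossings G\<^sub>Y f\<^sub>Y A\<^sub>Y) \<le> card (crossings G f A - A {x, y}) + card (verts G)"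
proof -
  let ?X = "crossings G\<^sub>Y f\<^sub>Y A\<^sub>Y"
  have off: "?X - chord \<subseteq> crossings G f A - A {x, y}"
    using crossing_off_chord(1) by blast
  then have fin: "finite (?X - chord)"
    using finite_crossings by (meson finite_Diff finite_subset)
  have split: "?X = (?X - chord) \<union> (?X \<inter> chord)"
    by blast
  have "finite ?X"
    using fin card_chord_crossings(1) by (subst split) simp
  then show "arc_drawing G\<^sub>Y f\<^sub>Y A\<^sub>Y"
    using crossing_off_chord(2) transversal_chord_crossing by (intro arc_drawing_Y) blast+
  have "card ?X \<le> card (?X - chord) + card (?X \<inter> chord)"
    by (subst split) (rule card_Un_le)
  also have "\<dots> \<le> card (crossings G f A - A {x, y}) + card (verts G)"
    using card_chord_crossings(2) card_mono[OF _ off] finite_crossings by (intro add_mono) auto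
  finally show "card ?X \<le> card (crossings G f A - A {x, y}) + card (verts G)" .
qed

end

lemma (in arc_drawing) delta_Y_near_vertex:
  assumes cxy: "distinct [c, x, y]" "triangle_edges c x y \<subseteq> edges G" and v: "v \<notin> verts G"
  obtains f' A' where "arc_drawing (delta_Y_graph G c x y v) f' A'"
    "card (crossings (delta_Y_graph G c x y v) f' A') \<le>
      card (crossings G f A - A {x, y}) + card (verts G)"
proof -
  have edges: "{c, x} \<in> edges G" "{c, y} \<in> edges G"
    using cxy(2) by (auto simp: triangle_edges_def insert_commute)
  then have "c \<in> verts G"
    using edge_subset_verts[OF simple_graph] by blast
  then obtain r B P where "vertex_disc G f A c r B P"
    by (rule vertex_disc_exists)
  then interpret disc: vertex_disc G f A c r B P .
  have "P x \<noteq> P y"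
    using disc.inj_entry_point edges cxy(1) by (auto simp: inj_on_eq_iff)
  then obtain c' where c': "c' \<in> ball (f c) r" "wedge (P y - P x) (c' - P x) \<noteq> 0"
    using exists_off_finite_lines[of "ball (f c) r" "{(P x, P y - P x)}"] disc.radius by auto
  define f\<^sub>1 where "f\<^sub>1 = f(c := c')"
  define A\<^sub>1 where "A\<^sub>1 = disc.radial_arcs c'"
  interpret radial: radial_disc G f\<^sub>1 A\<^sub>1 c "f c" r P
    unfolding f\<^sub>1_def A\<^sub>1_def using c'(1) by (rule disc.radial_disc)
  obtain Bx where Bx: "arc_between Bx {f\<^sub>1 x, P x}" "Bx \<subseteq> A\<^sub>1 {c, x}" "Bx \<inter> cball (f c) r = {P x}"
    by (rule radial.outer_arcE[OF edges(1)])
  obtain By where By: "arc_between By {f\<^sub>1 y, P y}" "By \<subseteq> A\<^sub>1 {c, y}" "By \<inter> cball (f c) r = {P y}"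
    by (rule radial.outer_arcE[OF edges(2)])
  interpret radial_triangle G f\<^sub>1 A\<^sub>1 c "f c" r P x y v Bx By
    by unfold_locales (use cxy v Bx By c'(2) in \<open>simp_all add: f\<^sub>1_def\<close>)
  have "A\<^sub>1 {x, y} = A {x, y}"
    unfolding A\<^sub>1_def using cxy(1) by (intro disc.radial_arcs_far) auto
  moreover have "crossings G f\<^sub>1 A\<^sub>1 \<subseteq> crossings G f A"
    using disc.radial_crossing_transfer(1)[OF c'(1)] unfolding f\<^sub>1_def A\<^sub>1_def by blast
  ultimately have "card (crossings G f\<^sub>1 A\<^sub>1 - A\<^sub>1 {x, y}) \<le> card (crossings G f A - A {x, y})"
    using finite_crossings by (intro card_mono) auto
  then show thesis
    using that[of f\<^sub>Y A\<^sub>Y] delta_Y_radial_triangle unfolding G\<^sub>Y_def by linarith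
qed

section \<open>Straight-line drawings of complete graphs\<close>

definition complete_on :: "'a set \<Rightarrow> 'a ugraph" where
  "complete_on V = UGraph V {e. e \<subseteq> V \<and> card e = 2}"

lemma verts_complete_on [simp]: "verts (complete_on V) = V"
  by (simp add: complete_on_def)

lemma edges_complete_on_iff: "e \<in> edges (complete_on V) \<longleftrightarrow> (\<exists>i\<in>V. \<exists>j\<in>V. i \<noteq> j \<and> e = {i, j})"
  by (auto simp: complete_on_def card_2_iff)

lemma edge_complete_onE:
  assumes "e \<in> edges (complete_on V)"
  obtains i j where "i \<in> V" "j \<in> V" "i \<noteq> j" "e = {i, j}"
  using assms unfolding edges_complete_on_iff by blast

lemma simple_graph_complete_on: "finite V \<Longrightarrow> simple_graph (complete_on V)"
  by (auto simp: simple_graph_def complete_on_def)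

definition edge_segment :: "('a \<Rightarrow> complex) \<Rightarrow> 'a set \<Rightarrow> complex set" where
  "edge_segment f e = convex hull (f ` e)"

lemma edge_segment_pair [simp]: "edge_segment f {i, j} = closed_segment (f i) (f j)"
  by (simp add: edge_segment_def segment_convex_hull)

locale general_position =
  fixes V :: "'a set" and f :: "'a \<Rightarrow> complex"
  assumes finite: "finite V"
    and inj: "inj_on f V"
    and not_collinear: "\<lbrakk>i \<in> V; j \<in> V; k \<in> V; distinct [i, j, k]\<rbrakk> \<Longrightarrow> wedge (f j - f i) (f k - f i) \<noteq> 0"
    and not_concurrent: "\<lbrakk>{e\<^sub>1, e\<^sub>2, e\<^sub>3} \<subseteq> edges (complete_on V); distinct [e\<^sub>1, e\<^sub>2, e\<^sub>3];
      p \<in> edge_segment f e\<^sub>1; p \<in> edge_segment f e\<^sub>2; p \<in> edge_segment f e\<^sub>3\<rbrakk> \<Longrightarrow> p \<in> f ` V"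
begin

lemma crossing_edgesE:
  assumes e: "e \<in> edges (complete_on V)" "e' \<in> edges (complete_on V)" "e \<noteq> e'"
    and p: "p \<in> edge_segment f e" "p \<in> edge_segment f e'" "p \<notin> f ` V"
  obtains i j k l where "i \<in> V" "j \<in> V" "k \<in> V" "l \<in> V" "e = {i, j}" "e' = {k, l}"
    "wedge (f j - f i) (f l - f k) \<noteq> 0"
proof -
  have disjoint: "w \<notin> e'" if w: "w \<in> e" for w
  proof
    assume w': "w \<in> e'"
    have simple: "simple_graph (complete_on V)"
      using finite by (rule simple_graph_complete_on)
    obtain a where a: "e = {w, a}" "a \<noteq> w"
      using w by (rule edge_at_vertexE[OF simple e(1)])
    obtain b where b: "e' = {w, b}" "b \<noteq> w"
      using w' by (rule edge_at_vertexE[OF simple e(2)])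
    have V: "w \<in> V" "a \<in> V" "b \<in> V" "distinct [w, a, b]"
      using e a b by (auto simp: complete_on_def)
    then have "p = f w"
      using transversal_segments_meet_once[OF not_collinear[OF V], of p "f w"] p a b by simp
    then show False
      using p(3) V(1) by blast
  qed
  obtain i j where ij: "i \<in> V" "j \<in> V" "i \<noteq> j" "e = {i, j}"
    using e(1) by (rule edge_complete_onE)
  obtain k l where kl: "k \<in> V" "l \<in> V" "k \<noteq> l" "e' = {k, l}"
    using e(2) by (rule edge_complete_onE)
  have "distinct [i, j, k]"
    using disjoint ij kl by auto
  then have "wedge (f j - f i) (f l - f k) \<noteq> 0"
    using crossing_segments_transversal[OF not_collinear] ij kl p by simp
  then show thesis
    using that ij kl by blast
qed

lemma vertex_on_edge_segment:
  assumes e: "e \<in> edges (complete_on V)" and v: "v \<in> V" "f v \<in> edge_segment f e"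
  shows "v \<in> e"
proof (rule ccontr)
  assume "v \<notin> e"
  obtain i j where ij: "i \<in> V" "j \<in> V" "i \<noteq> j" "e = {i, j}"
    using e by (rule edge_complete_onE)
  then have "wedge (f j - f i) (f v - f i) = 0"
    using wedge_closed_segment[of "f i" "f i" "f j" "f v"] v(2) by simp
  then show False
    using not_collinear[of i j v] ij v(1) \<open>v \<notin> e\<close> by auto
qed

lemma finite_straight_line_crossings: "finite (crossings (complete_on V) f (edge_segment f))"
proof -
  define X where "X = (\<lambda>(e, e'). (edge_segment f e \<inter> edge_segment f e') - f ` V)"
  define I where "I = {(e, e'). e \<in> edges (complete_on V) \<and> e' \<in> edges (complete_on V) \<and> e \<noteq> e'}"
  have "finite (edges (complete_on V))"
    using finite by (intro finite_edges simple_graph_complete_on)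
  then have "finite I"
    by (intro finite_subset[of I "edges (complete_on V) \<times> edges (complete_on V)"]) (auto simp: I_def)
  moreover have "finite (X d)" if "d \<in> I" for d
  proof -
    obtain e e' where e: "d = (e, e')" "e \<in> edges (complete_on V)" "e' \<in> edges (complete_on V)" "e \<noteq> e'"
      using \<open>d \<in> I\<close> by (auto simp: I_def)
    have "p = q" if "p \<in> X d" "q \<in> X d" for p q
    proof -
      have pq: "p \<in> edge_segment f e" "p \<in> edge_segment f e'" "p \<notin> f ` V"
        "q \<in> edge_segment f e" "q \<in> edge_segment f e'"
        using that by (auto simp: X_def e(1))
      obtain i j k l where "e = {i, j}" "e' = {k, l}" "wedge (f j - f i) (f l - f k) \<noteq> 0"
        by (rule crossing_edgesE[OF e(2-4) pq(1-3)])
      then show ?thesis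
        using transversal_segments_meet_once[of "f j" "f i" "f l" "f k" p q] pq by simp
    qed
    then have "X d = {} \<or> (\<exists>p. X d = {p})"
      by blast
    then show ?thesis
      by auto
  qed
  moreover have "crossings (complete_on V) f (edge_segment f) \<subseteq> (\<Union>d\<in>I. X d)"
    by (auto simp: crossings_def X_def I_def)
  ultimately show ?thesis
    using finite_subset by blast
qed

lemma transversal_straight_line_crossing:
  assumes "p \<in> crossings (complete_on V) f (edge_segment f)"
  shows "transversal_crossing (edges (complete_on V)) (edge_segment f) p"
proof -
  obtain e e' where "p \<notin> f ` verts (complete_on V)"
    and e: "e \<in> edges (complete_on V)" "e' \<in> edges (complete_on V)" "e \<noteq> e'"
    and "p \<in> edge_segment f e" "p \<in> edge_segment f e'"
    using assms by (rule crossingsE)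
  then have p: "p \<in> edge_segment f e" "p \<in> edge_segment f e'" "p \<notin> f ` V"
    by simp_all
  obtain i j k l where ijkl: "i \<in> V" "j \<in> V" "k \<in> V" "l \<in> V" "e = {i, j}" "e' = {k, l}"
    "wedge (f j - f i) (f l - f k) \<noteq> 0"
    by (rule crossing_edgesE[OF e p])
  have "f i \<noteq> f j" "f k \<noteq> f l"
    using ijkl(7) by (auto simp: wedge.zero_left wedge.zero_right)
  then have arcs: "arc_between (edge_segment f e) {f i, f j}"
    "arc_between (edge_segment f e') {f k, f l}"
    using arc_between_closed_segment ijkl(5,6) by simp_all
  have ends: "p \<notin> {f i, f j}" "p \<notin> {f k, f l}"
    using p(3) ijkl(1-4) by auto
  have "crossing_germ (edge_segment f e) (edge_segment f e') p"
    by (rule crossing_germ_subarcs[OF crossing_germ_lines[OF ijkl(7)] open_UNIV UNIV_I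
          arcs(1) p(1) ends(1) _ arcs(2) p(2) ends(2)])
      (use p(1,2) ijkl(5,6) wedge_closed_segment in auto)
  moreover have "d \<in> {e, e'}" if "d \<in> edges (complete_on V)" "p \<in> edge_segment f d" for d
    using not_concurrent[of e e' d p] e p that by auto
  then have "{d \<in> edges (complete_on V). p \<in> edge_segment f d} = {e, e'}"
    using e p by blast
  ultimately show ?thesis
    unfolding transversal_crossing_def using e by blast
qed

lemma arc_drawing_straight_lines: "arc_drawing (complete_on V) f (edge_segment f)"
proof
  show "arc_between (edge_segment f e) (f ` e)" if e: "e \<in> edges (complete_on V)" for e
  proof -
    obtain i j where ij: "i \<in> V" "j \<in> V" "i \<noteq> j" "e = {i, j}"
      using e by (rule edge_complete_onE)
    then have "f i \<noteq> f j"
      using inj by (simp add: inj_on_eq_iff)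
    then show ?thesis
      using arc_between_closed_segment ij(4) by simp
  qed
qed (use finite inj simple_graph_complete_on vertex_on_edge_segment finite_straight_line_crossings
    transversal_straight_line_crossing in auto)

end

locale general_position_extension = general_position V f
  for V :: "'a set" and f +
  fixes w :: 'a and q :: complex
  assumes new: "w \<notin> V"
    and off_points: "q \<notin> f ` V"
    and off_lines: "\<lbrakk>i \<in> V; j \<in> V; i \<noteq> j\<rbrakk> \<Longrightarrow> wedge (f j - f i) (q - f i) \<noteq> 0"
    and off_crossings: "\<lbrakk>i \<in> V; p \<in> crossings (complete_on V) f (edge_segment f)\<rbrakk> \<Longrightarrow>
        wedge (p - f i) (q - f i) \<noteq> 0"
begin

definition f' :: "'a \<Rightarrow> complex" where
  "f' = f(w := q)"

lemma f'_simps [simp]: "f' w = q" "i \<in> V \<Longrightarrow> f' i = f i"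
  using new by (auto simp: f'_def)

lemma image_f': "f' ` insert w V = insert q (f ` V)"
proof -
  have "f' ` V = f ` V"
    by (intro image_cong) simp_all
  then show ?thesis
    by simp
qed

lemma not_collinear_extension:
  assumes ijk: "i \<in> insert w V" "j \<in> insert w V" "k \<in> insert w V" "distinct [i, j, k]"
  shows "wedge (f' j - f' i) (f' k - f' i) \<noteq> 0"
proof -
  have rotate: "wedge (c - b) (a - b) = wedge (b - a) (c - a)" for a b c
    by (simp add: wedge_def algebra_simps)
  consider "i = w" "j \<in> V" "k \<in> V" | "j = w" "i \<in> V" "k \<in> V" | "k = w" "i \<in> V" "j \<in> V"
    | "i \<in> V" "j \<in> V" "k \<in> V"
    using ijk by auto
  then show ?thesis
  proof cases
    case 1
    then show ?thesis
      using off_lines[of j k] ijk(4) rotate[where a = q and b = "f j" and c = "f k"] by simp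
  next
    case 2
    then show ?thesis
      using off_lines[of k i] ijk(4) rotate[where a = "f k" and b = "f i" and c = q] by auto
  next
    case 3
    then show ?thesis
      using off_lines[of i j] ijk(4) by simp
  next
    case 4
    then show ?thesis
      using not_collinear[of i j k] ijk(4) by simp
  qed
qed

lemma edge_extension_cases [consumes 1, case_names new old]:
  assumes "e \<in> edges (complete_on (insert w V))"
  obtains i where "i \<in> V" "e = {w, i}" "edge_segment f' e = closed_segment q (f i)"
  | "e \<in> edges (complete_on V)" "edge_segment f' e = edge_segment f e"
proof -
  obtain i j where ij: "i \<in> insert w V" "j \<in> insert w V" "i \<noteq> j" "e = {i, j}"
    using assms by (rule edge_complete_onE)
  then consider "i = w" "j \<in> V" | "j = w" "i \<in> V" | "i \<in> V" "j \<in> V"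
    by auto
  then show thesis
  proof cases
    case 1
    then show thesis
      using that(1)[of j] ij(4) by auto
  next
    case 2
    then show thesis
      using that(1)[of i] ij(4) by (auto simp: insert_commute)
  next
    case 3
    then show thesis
      using that(2) ij(3,4) by (auto simp: edges_complete_on_iff)
  qed
qed

lemma new_edges_meet:
  assumes "i \<in> V" "j \<in> V" "i \<noteq> j" "p \<in> closed_segment q (f i)" "p \<in> closed_segment q (f j)"
  shows "p = q"
proof -
  have "wedge (f i - q) (f j - q) \<noteq> 0"
    using not_collinear_extension[of w i j] assms(1-3) new by fastforce
  then show ?thesis
    using transversal_segments_meet_once[of "f i" q "f j" q p q] assms(4,5) by simp
qed

lemma new_edge_off_crossings:
  assumes i: "i \<in> V" "p \<in> closed_segment q (f i)"
    and e: "e \<in> edges (complete_on V)" "e' \<in> edges (complete_on V)" "e \<noteq> e'"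
    and p: "p \<in> edge_segment f e" "p \<in> edge_segment f e'"
  shows "p \<in> f ` V"
proof (rule ccontr)
  assume "p \<notin> f ` V"
  then have crossing: "p \<in> crossings (complete_on V) f (edge_segment f)"
    using e p by (intro crossingsI[of p f "complete_on V" e e']) simp_all
  have "wedge (f i - q) (p - q) = 0"
    using wedge_closed_segment[of q q "f i" p] i(2) by simp
  then have "wedge (p - f i) (q - f i) = 0"
    by (simp add: wedge_def algebra_simps)
  then show False
    using off_crossings[OF i(1) crossing] by simp
qed

lemma not_concurrent_extension:
  assumes e: "{e\<^sub>1, e\<^sub>2, e\<^sub>3} \<subseteq> edges (complete_on (insert w V))" "distinct [e\<^sub>1, e\<^sub>2, e\<^sub>3]"
    and p: "p \<in> edge_segment f' e\<^sub>1" "p \<in> edge_segment f' e\<^sub>2" "p \<in> edge_segment f' e\<^sub>3"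
  shows "p \<in> f' ` insert w V"
proof (rule ccontr)
  assume "p \<notin> f' ` insert w V"
  then have p': "p \<noteq> q" "p \<notin> f ` V"
    unfolding image_f' by auto
  define new_edge where "new_edge e \<longleftrightarrow> (\<exists>i\<in>V. e = {w, i} \<and> p \<in> closed_segment q (f i))" for e
  define old_edge where "old_edge e \<longleftrightarrow> e \<in> edges (complete_on V) \<and> p \<in> edge_segment f e" for e
  have kind: "new_edge e \<or> old_edge e"
    if "e \<in> edges (complete_on (insert w V))" "p \<in> edge_segment f' e" for e
    using that(1) by (cases e rule: edge_extension_cases)
      (use that(2) in \<open>auto simp: new_edge_def old_edge_def\<close>)
  have kinds: "new_edge e\<^sub>1 \<or> old_edge e\<^sub>1" "new_edge e\<^sub>2 \<or> old_edge e\<^sub>2" "new_edge e\<^sub>3 \<or> old_edge e\<^sub>3"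
    using kind e p by simp_all
  have one_new: "e = e'" if "new_edge e" "new_edge e'" for e e'
    using that new_edges_meet p'(1) unfolding new_edge_def by metis
  have one_old: "e = e'" if "new_edge d" "old_edge e" "old_edge e'" for d e e'
    using that new_edge_off_crossings p'(2) unfolding new_edge_def old_edge_def by metis
  have "\<not> (old_edge e\<^sub>1 \<and> old_edge e\<^sub>2 \<and> old_edge e\<^sub>3)"
    using not_concurrent[of e\<^sub>1 e\<^sub>2 e\<^sub>3 p] e(2) p'(2) by (auto simp: old_edge_def)
  then show False
    using kinds one_new one_old e(2) unfolding distinct_length_2_or_more by metis
qed

lemma general_position_extension: "general_position (insert w V) f'"
proof
  show "inj_on f' (insert w V)"
    using inj off_points new by (auto simp: inj_on_def)
qed (use finite not_collinear_extension not_concurrent_extension in simp_all)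

end

lemma (in general_position) exists_extension:
  assumes "w \<notin> V"
  obtains f' where "general_position (insert w V) f'"
proof -
  let ?X = "crossings (complete_on V) f (edge_segment f)"
  define L where "L = (\<Union>i\<in>V. (\<lambda>z. (f i, z - f i)) ` insert (f i + 1) (f ` (V - {i}) \<union> ?X))"
  have "finite L"
    unfolding L_def using finite finite_straight_line_crossings by simp
  moreover have "d \<noteq> 0" if "(a, d) \<in> L" for a d
    using that inj unfolding L_def by (auto simp: inj_on_eq_iff elim: crossingsE)
  ultimately obtain q where "\<And>a d. (a, d) \<in> L \<Longrightarrow> wedge d (q - a) \<noteq> 0"
    using exists_off_finite_lines[of UNIV L] by auto
  then have q: "wedge (z - f i) (q - f i) \<noteq> 0"
    if "i \<in> V" "z \<in> insert (f i + 1) (f ` (V - {i}) \<union> ?X)" for i z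
    using that unfolding L_def by blast
  interpret general_position_extension V f w q
  proof
    show "q \<notin> f ` V"
    proof
      assume "q \<in> f ` V"
      then obtain i where "i \<in> V" "q = f i"
        by blast
      then show False
        using q[OF _ insertI1, of i] by (simp add: wedge.zero_right)
    qed
  qed (use assms q in auto)
  show thesis
    using that general_position_extension .
qed

lemma exists_general_position:
  assumes "finite V"
  obtains f :: "'a \<Rightarrow> complex" where "general_position V f"
proof -
  have "\<exists>f :: 'a \<Rightarrow> complex. general_position V f"
    using assms
  proof (induction V)
    case empty
    show ?case
      by (intro exI, unfold_locales) (auto simp: edges_complete_on_iff)
  next
    case (insert w V)
    then show ?case
      using general_position.exists_extension by metis
  qed
  then show thesis
    using that by blast
qed

lemma arc_drawing_complete_on:
  assumes "finite V"
  obtains f A where "arc_drawing (complete_on V) f A"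
  using exists_general_position[OF assms] general_position.arc_drawing_straight_lines by metis

section \<open>Counting crossings in a clique\<close>

definition clique :: "'a ugraph \<Rightarrow> 'a set \<Rightarrow> bool" where
  "clique G C \<longleftrightarrow> C \<subseteq> verts G \<and> (\<forall>a\<in>C. \<forall>b\<in>C. a \<noteq> b \<longrightarrow> {a, b} \<in> edges G)"

lemma clique_edge: "\<lbrakk>clique G C; a \<in> C; b \<in> C; a \<noteq> b\<rbrakk> \<Longrightarrow> {a, b} \<in> edges G"
  by (simp add: clique_def)

lemma clique_subset: "\<lbrakk>clique G C; S \<subseteq> C\<rbrakk> \<Longrightarrow> clique G S"
  by (auto simp: clique_def)

lemma clique_triangle: "\<lbrakk>clique G C; {a, b, c} \<subseteq> C; distinct [a, b, c]\<rbrakk> \<Longrightarrow> triangle_edges a b c \<subseteq> edges G"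
  by (auto simp: triangle_edges_def intro: clique_edge)

lemma clique_delta_Y_graph: "clique G C \<Longrightarrow> clique (delta_Y_graph G a b c v) (C - {a, b, c})"
  by (auto simp: clique_def delta_Y_graph_def triangle_edges_def doubleton_eq_iff)

context arc_drawing
begin

lemma finite_clique: "clique G C \<Longrightarrow> finite C"
  using finite_verts by (auto simp: clique_def intro: finite_subset)

lemma oriented_edges_exist:
  obtains g where
    "\<And>i j. {i, j} \<in> edges G \<Longrightarrow> arc (g i j) \<and> path_image (g i j) = A {i, j}"
    "\<And>i j. {i, j} \<in> edges G \<Longrightarrow> pathstart (g i j) = f i \<and> pathfinish (g i j) = f j"
    "\<And>i j. {i, j} \<in> edges G \<Longrightarrow> g j i = reversepath (g i j)"
proof -
  obtain \<gamma> where \<gamma>: "\<And>e. e \<in> edges G \<Longrightarrow> arc (\<gamma> e) \<and> path_image (\<gamma> e) = A e"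
    "\<And>e. e \<in> edges G \<Longrightarrow> {pathstart (\<gamma> e), pathfinish (\<gamma> e)} = f ` e"
    using arc_between_edge unfolding arc_between_def by metis
  define g where "g i j = (if pathstart (\<gamma> {i, j}) = f i then \<gamma> {i, j} else reversepath (\<gamma> {i, j}))"
    for i j
  have ends: "pathstart (\<gamma> {i, j}) = f i \<and> pathfinish (\<gamma> {i, j}) = f j \<or>
      pathstart (\<gamma> {i, j}) = f j \<and> pathfinish (\<gamma> {i, j}) = f i" "f i \<noteq> f j"
    if e: "{i, j} \<in> edges G" for i j
  proof -
    show "pathstart (\<gamma> {i, j}) = f i \<and> pathfinish (\<gamma> {i, j}) = f j \<or>
        pathstart (\<gamma> {i, j}) = f j \<and> pathfinish (\<gamma> {i, j}) = f i"
      using \<gamma>(2)[OF e] by (auto simp: doubleton_eq_iff)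
    show "f i \<noteq> f j"
      using \<gamma>(1,2)[OF e] arc_distinct_ends[of "\<gamma> {i, j}"] by auto
  qed
  show thesis
  proof (rule that[of g])
    fix i j assume e: "{i, j} \<in> edges G"
    show "arc (g i j) \<and> path_image (g i j) = A {i, j}"
      using \<gamma>(1)[OF e] by (simp add: g_def arc_reversepath)
    show "pathstart (g i j) = f i \<and> pathfinish (g i j) = f j"
      using ends[OF e] by (auto simp: g_def)
    show "g j i = reversepath (g i j)"
      using ends[OF e] by (auto simp: g_def insert_commute)
  qed
qed

lemma embedded_clique:
  assumes S: "clique G S"
    and no_crossing: "\<And>p e e'. \<lbrakk>p \<in> crossings G f A; e \<in> edges G; e' \<in> edges G; e \<noteq> e';
      e \<subseteq> S; e' \<subseteq> S; p \<in> A e\<rbrakk> \<Longrightarrow> p \<notin> A e'"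
  obtains g where "embedded_complete_graph S f g"
proof -
  obtain g where g: "\<And>i j. {i, j} \<in> edges G \<Longrightarrow> arc (g i j) \<and> path_image (g i j) = A {i, j}"
    "\<And>i j. {i, j} \<in> edges G \<Longrightarrow> pathstart (g i j) = f i \<and> pathfinish (g i j) = f j"
    "\<And>i j. {i, j} \<in> edges G \<Longrightarrow> g j i = reversepath (g i j)"
    using oriented_edges_exist by metis
  note edge = clique_edge[OF S]
  have meet: "path_image (g i j) \<inter> path_image (g k l) \<subseteq> f ` ({i, j} \<inter> {k, l})"
    if ij: "i \<in> S" "j \<in> S" "i \<noteq> j" and kl: "k \<in> S" "l \<in> S" "k \<noteq> l" and ne: "{i, j} \<noteq> {k, l}" for i j k l
  proof
    fix p assume "p \<in> path_image (g i j) \<inter> path_image (g k l)"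
    then have p: "p \<in> A {i, j}" "p \<in> A {k, l}"
      using g(1)[OF edge[OF ij]] g(1)[OF edge[OF kl]] by auto
    then have "p \<notin> crossings G f A"
      using no_crossing[OF _ edge[OF ij] edge[OF kl] ne] ij kl by auto
    then have "p \<in> f ` verts G"
      using crossingsI[OF _ edge[OF ij] edge[OF kl] ne p] by blast
    then obtain w where w: "w \<in> verts G" "p = f w"
      by blast
    then have "w \<in> {i, j}" "w \<in> {k, l}"
      using vertex_on_edge[OF edge[OF ij]] vertex_on_edge[OF edge[OF kl]] p by blast+
    then show "p \<in> f ` ({i, j} \<inter> {k, l})"
      using w(2) by blast
  qed
  have "embedded_complete_graph S f g"
  proof
    show "inj_on f S"
      using inj_vertices S by (auto simp: clique_def intro: inj_on_subset)
    fix i j assume "i \<in> S" "j \<in> S" "i \<noteq> j"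
    then have ij: "{i, j} \<in> edges G"
      by (rule edge)
    show "arc (g i j)" "pathstart (g i j) = f i" "pathfinish (g i j) = f j" "g j i = reversepath (g i j)"
      using g(1,2)[OF ij] g(3)[OF ij] by blast+
  qed (fact meet)
  then show thesis
    by (rule that)
qed

lemma five_clique_has_crossing:
  assumes "clique G S" "card S = 5"
  shows "\<exists>p\<in>crossings G f A. \<exists>e\<in>edges G. \<exists>e'\<in>edges G. e \<noteq> e' \<and> e \<subseteq> S \<and> e' \<subseteq> S \<and> p \<in> A e \<and> p \<in> A e'"
proof (rule ccontr)
  assume "\<not> ?thesis"
  then have "p \<notin> A e'"
    if "p \<in> crossings G f A" "e \<in> edges G" "e' \<in> edges G" "e \<noteq> e'" "e \<subseteq> S" "e' \<subseteq> S" "p \<in> A e" for p e e'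
    using that by blast
  then obtain g where "embedded_complete_graph S f g"
    by (rule embedded_clique[OF assms(1)])
  then have "card S \<le> 4"
    by (rule embedded_complete_graph.card_vertices_le)
  then show False
    using assms(2) by simp
qed

definition no_adjacent_crossings :: "'a set \<Rightarrow> bool" where
  "no_adjacent_crossings C \<longleftrightarrow> (\<forall>e\<in>edges G. \<forall>e'\<in>edges G. \<forall>p\<in>crossings G f A.
     e \<subseteq> C \<longrightarrow> e' \<subseteq> C \<longrightarrow> e \<noteq> e' \<longrightarrow> p \<in> A e \<longrightarrow> p \<in> A e' \<longrightarrow> e \<inter> e' = {})"

definition edges_crossing :: "'a set \<Rightarrow> 'a set set" where
  "edges_crossing e = {e' \<in> edges G. e' \<noteq> e \<and> (\<exists>p\<in>crossings G f A. p \<in> A e \<and> p \<in> A e')}"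

lemma card_edges_crossing_le:
  assumes e: "e \<in> edges G"
  shows "card (edges_crossing e) \<le> card (crossings G f A \<inter> A e)"
proof -
  have "\<exists>p. p \<in> crossings G f A \<and> p \<in> A e \<and> p \<in> A e'" if "e' \<in> edges_crossing e" for e'
    using that by (auto simp: edges_crossing_def)
  then obtain r where r: "\<And>e'. e' \<in> edges_crossing e \<Longrightarrow> r e' \<in> crossings G f A \<and> r e' \<in> A e \<and> r e' \<in> A e'"
    by metis
  have through: "{d \<in> edges G. r e' \<in> A d} = {e, e'}" if "e' \<in> edges_crossing e" for e'
    using r[OF that] that e by (intro crossing_edges(1)) (auto simp: edges_crossing_def)
  have "inj_on r (edges_crossing e)"
  proof (rule inj_onI)
    fix d d' assume d: "d \<in> edges_crossing e" "d' \<in> edges_crossing e" "r d = r d'"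
    then have "{e, d} = {e, d'}"
      using through by metis
    then show "d = d'"
      using d(1,2) by (auto simp: edges_crossing_def doubleton_eq_iff)
  qed
  moreover have "r ` edges_crossing e \<subseteq> crossings G f A \<inter> A e"
    using r by blast
  ultimately show ?thesis
    using finite_crossings by (intro card_inj_on_le) auto
qed

definition crossing_pairs :: "'a set \<Rightarrow> ('a set \<times> 'a set) set" where
  "crossing_pairs C = (SIGMA e:{e \<in> edges G. e \<subseteq> C}. {e' \<in> edges_crossing e. e' \<subseteq> C})"

lemma finite_crossing_pairs: "finite (crossing_pairs C)"
  by (rule finite_subset[of _ "edges G \<times> edges G"])
    (auto simp: crossing_pairs_def edges_crossing_def finite_edges[OF simple_graph])

lemma card_crossing_pairs_le:
  assumes C: "finite C" and few: "\<And>e. \<lbrakk>e \<in> edges G; e \<subseteq> C\<rbrakk> \<Longrightarrow> card (crossings G f A \<inter> A e) \<le> M"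
  shows "card (crossing_pairs C) \<le> (card C choose 2) * M"
proof -
  define E where "E = {e \<in> edges G. e \<subseteq> C}"
  have finE: "finite E" and fin: "finite (edges_crossing e)" for e
    using finite_edges[OF simple_graph] by (auto simp: E_def edges_crossing_def)
  have "card (crossing_pairs C) = (\<Sum>e\<in>E. card {e' \<in> edges_crossing e. e' \<subseteq> C})"
    unfolding crossing_pairs_def E_def[symmetric] using finE fin by (intro card_SigmaI) auto
  also have "\<dots> \<le> (\<Sum>e\<in>E. M)"
  proof (rule sum_mono)
    fix e assume "e \<in> E"
    have "card {e' \<in> edges_crossing e. e' \<subseteq> C} \<le> card (edges_crossing e)"
      using fin by (intro card_mono) auto
    also have "\<dots> \<le> card (crossings G f A \<inter> A e)"
      using \<open>e \<in> E\<close> by (intro card_edges_crossing_le) (simp add: E_def)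
    also have "\<dots> \<le> M"
      using few \<open>e \<in> E\<close> by (simp add: E_def)
    finally show "card {e' \<in> edges_crossing e. e' \<subseteq> C} \<le> M" .
  qed
  also have "\<dots> = card E * M"
    by simp
  also have "card E \<le> card {e. e \<subseteq> C \<and> card e = 2}"
    using C card_edge[OF simple_graph] by (intro card_mono) (auto simp: E_def)
  also have "\<dots> = card C choose 2"
    using C by (rule n_subsets)
  finally show ?thesis by simp
qed

lemma five_subset_contains_crossing_pair:
  assumes C: "clique G C" and no_adjacent: "no_adjacent_crossings C" and S: "S \<subseteq> C" "card S = 5"
  obtains e e' x where "(e, e') \<in> crossing_pairs C" "x \<in> C" "S = insert x (e \<union> e')"
proof -
  obtain p e e' where p: "p \<in> crossings G f A" "p \<in> A e" "p \<in> A e'"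
    and e: "e \<in> edges G" "e' \<in> edges G" "e \<noteq> e'" "e \<subseteq> S" "e' \<subseteq> S"
    using five_clique_has_crossing[OF clique_subset[OF C S(1)] S(2)] by blast
  have "e \<subseteq> C" "e' \<subseteq> C"
    using e(4,5) S(1) by auto
  then have "e \<inter> e' = {}"
    using no_adjacent[unfolded no_adjacent_crossings_def, rule_format, OF e(1,2) p(1) _ _ e(3) p(2,3)]
    by blast
  moreover have "card e = 2" "card e' = 2"
    using card_edge[OF simple_graph] e(1,2) by simp_all
  moreover have "finite S"
    using S(2) by (intro card_ge_0_finite) simp
  then have "finite e" "finite e'"
    using e(4,5) by (auto intro: finite_subset)
  ultimately have "card (S - (e \<union> e')) = 1"
    using S(2) e(4,5) by (simp add: card_Diff_subset card_Un_disjoint)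
  then obtain x where "S - (e \<union> e') = {x}"
    using card_1_singletonE by blast
  then have "x \<in> C" "S = insert x (e \<union> e')"
    using S(1) e(4,5) by blast+
  moreover have "(e, e') \<in> crossing_pairs C"
    using e p S(1) by (auto simp: crossing_pairs_def edges_crossing_def)
  ultimately show thesis
    using that by blast
qed

lemma choose_five_le_crossing_pairs:
  assumes C: "clique G C" and no_adjacent: "no_adjacent_crossings C"
  shows "card C choose 5 \<le> card (crossing_pairs C) * card C"
proof -
  have "{S. S \<subseteq> C \<and> card S = 5} \<subseteq> (\<lambda>((e, e'), x). insert x (e \<union> e')) ` (crossing_pairs C \<times> C)"
  proof
    fix S assume "S \<in> {S. S \<subseteq> C \<and> card S = 5}"
    then obtain e e' x where "(e, e') \<in> crossing_pairs C" "x \<in> C" "S = insert x (e \<union> e')"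
      using five_subset_contains_crossing_pair[OF C no_adjacent, of S] by blast
    then show "S \<in> (\<lambda>((e, e'), x). insert x (e \<union> e')) ` (crossing_pairs C \<times> C)"
      by (intro image_eqI[of _ _ "((e, e'), x)"]) simp_all
  qed
  then have "card {S. S \<subseteq> C \<and> card S = 5} \<le> card (crossing_pairs C \<times> C)"
    using finite_crossing_pairs finite_clique[OF C] by (intro surj_card_le) auto
  then show ?thesis
    using finite_clique[OF C] by (simp add: n_subsets card_cartesian_product)
qed

end

lemma quartic_less_choose_five:
  fixes m :: nat
  assumes "6250 < m"
  shows "(m choose 2) * (2 * m) * m < m choose 5"
proof -
  have "real ((m choose 2) * (2 * m) * m) \<le> real (m ^ 2 * (2 * m) * m)"
    using binomial_le_pow[of 2 m] assms by (intro of_nat_mono mult_right_mono) auto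
  also have "\<dots> = 2 * real m ^ 4"
    by (simp add: power2_eq_square power4_eq_xxxx)
  also have "\<dots> < (real m / 3125) * real m ^ 4"
    using assms by (intro mult_strict_right_mono) auto
  also have "\<dots> = (real m / real 5) ^ 5"
    by (simp add: power_divide eval_nat_numeral)
  also have "\<dots> \<le> real (m choose 5)"
    using assms by (intro binomial_ge_n_over_k_pow_k) auto
  finally show ?thesis
    by (simp only: of_nat_less_iff)
qed

lemma (in arc_drawing) exists_edge_with_many_crossings:
  assumes C: "clique G C" and no_adjacent: "no_adjacent_crossings C"
    and large: "6250 < card C" "M \<le> 2 * card C"
  shows "\<exists>e\<in>edges G. e \<subseteq> C \<and> M < card (crossings G f A \<inter> A e)"
proof (rule ccontr)
  assume "\<not> ?thesis"
  then have few: "card (crossings G f A \<inter> A e) \<le> M" if "e \<in> edges G" "e \<subseteq> C" for e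
    using that by force
  have "card C choose 5 \<le> card (crossing_pairs C) * card C"
    by (rule choose_five_le_crossing_pairs[OF C no_adjacent])
  also have "\<dots> \<le> (card C choose 2) * M * card C"
    using card_crossing_pairs_le[OF finite_clique[OF C] few] by (intro mult_right_mono) auto
  also have "\<dots> \<le> (card C choose 2) * (2 * card C) * card C"
    using large(2) by (intro mult_right_mono mult_left_mono) auto
  also have "\<dots> < card C choose 5"
    by (rule quartic_less_choose_five[OF large(1)])
  finally show False
    by simp
qed

section \<open>Iterating decreasing Delta-Y moves\<close>

context arc_drawing
begin

lemma delta_Y_fewer_crossings_adjacent:
  assumes C: "clique G C" "\<not> no_adjacent_crossings C" and v: "v \<notin> verts G"
  obtains a b c f' A' where "distinct [a, b, c]" "triangle_edges a b c \<subseteq> edges G"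
    "arc_drawing (delta_Y_graph G a b c v) f' A'"
    "card (crossings (delta_Y_graph G a b c v) f' A') < card (crossings G f A)"
proof -
  obtain e e' p a where e: "e \<in> edges G" "e' \<in> edges G" "e \<noteq> e'" "e \<subseteq> C" "e' \<subseteq> C"
    and p: "p \<in> crossings G f A" "p \<in> A e" "p \<in> A e'" and a: "a \<in> e" "a \<in> e'"
    using C(2) unfolding no_adjacent_crossings_def by blast
  obtain b where b: "e = {a, b}" "b \<noteq> a"
    using a(1) by (rule edge_at_vertexE[OF simple_graph e(1)])
  obtain c where c: "e' = {a, c}" "c \<noteq> a"
    using a(2) by (rule edge_at_vertexE[OF simple_graph e(2)])
  have abc: "distinct [a, b, c]"
    using b c e(3) by auto
  then have triangle: "triangle_edges a b c \<subseteq> edges G"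
    using e b c by (intro clique_triangle[OF C(1)]) auto
  have p_edges: "p \<in> A {a, b}" "p \<in> A {c, a}"
    using p(2,3) b(1) c(1) by (simp_all add: insert_commute)
  obtain f' A' where D': "arc_drawing (delta_Y_graph G a b c v) f' A'"
    "crossings (delta_Y_graph G a b c v) f' A' \<subseteq> crossings G f A - {p}"
    by (rule delta_Y_at_crossing[OF abc triangle v p(1) p_edges])
  have "card (crossings (delta_Y_graph G a b c v) f' A') < card (crossings G f A)"
    using D'(2) p(1) finite_crossings by (intro psubset_card_mono) auto
  then show thesis
    by (rule that[OF abc triangle D'(1)])
qed

lemma delta_Y_fewer_crossings_heavy_edge:
  assumes C: "clique G C" "2 < card C" and e: "e \<in> edges G" "e \<subseteq> C"
    and heavy: "card (verts G) < card (crossings G f A \<inter> A e)" and v: "v \<notin> verts G"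
  obtains a b c f' A' where "distinct [a, b, c]" "triangle_edges a b c \<subseteq> edges G"
    "arc_drawing (delta_Y_graph G a b c v) f' A'"
    "card (crossings (delta_Y_graph G a b c v) f' A') < card (crossings G f A)"
proof -
  obtain x y where xy: "e = {x, y}" "x \<noteq> y"
    using card_edge[OF simple_graph e(1)] by (auto simp: card_2_iff)
  have "\<not> C \<subseteq> e"
    using C(2) card_edge[OF simple_graph e(1)] card_mono[of e C] xy(1) by auto
  then obtain c where "c \<in> C" "c \<notin> e"
    by blast
  then have distinct: "distinct [c, x, y]" and "{c, x, y} \<subseteq> C"
    using e(2) xy by auto
  then have triangle: "triangle_edges c x y \<subseteq> edges G"
    by (intro clique_triangle[OF C(1)])
  obtain f' A' where D': "arc_drawing (delta_Y_graph G c x y v) f' A'"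
    "card (crossings (delta_Y_graph G c x y v) f' A') \<le>
      card (crossings G f A - A {x, y}) + card (verts G)"
    by (rule delta_Y_near_vertex[OF distinct triangle v])
  have "card (crossings G f A) = card (crossings G f A - A e) + card (crossings G f A \<inter> A e)"
    using card_Diff_subset_Int[of "crossings G f A" "A e"] finite_crossings
      card_mono[of "crossings G f A" "crossings G f A \<inter> A e"] by simp
  then have "card (crossings (delta_Y_graph G c x y v) f' A') < card (crossings G f A)"
    using D'(2) heavy xy(1) by simp
  then show thesis
    by (rule that[OF distinct triangle D'(1)])
qed

lemma delta_Y_fewer_crossings:
  assumes C: "clique G C" "6250 < card C" "card (verts G) \<le> 2 * card C" and v: "v \<notin> verts G"
  obtains a b c f' A' where "distinct [a, b, c]" "triangle_edges a b c \<subseteq> edges G"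
    "arc_drawing (delta_Y_graph G a b c v) f' A'"
    "card (crossings (delta_Y_graph G a b c v) f' A') < card (crossings G f A)"
proof (cases "no_adjacent_crossings C")
  case True
  obtain e where e: "e \<in> edges G" "e \<subseteq> C" "card (verts G) < card (crossings G f A \<inter> A e)"
    using exists_edge_with_many_crossings[OF C(1) True C(2,3)] by blast
  have "2 < card C"
    using C(2) by simp
  then show thesis
    using that by (rule delta_Y_fewer_crossings_heavy_edge[OF C(1) _ e v])
next
  case False
  then show thesis
    using that by (rule delta_Y_fewer_crossings_adjacent[OF C(1) _ v])
qed

lemma exists_decreasing_delta_Y_move:
  assumes C: "clique G C" "6250 < card C" "card (verts G) \<le> 2 * card C"
    and infinite: "infinite (UNIV :: 'a set)"
  obtains H f' A' C' where "delta_Y_move G H" "crossing_number H < crossing_number G"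
    "arc_drawing H f' A'"
    "clique H C'" "card C \<le> card C' + 3" "card (verts H) = Suc (card (verts G))"
proof -
  obtain f\<^sub>0 A\<^sub>0 where "arc_drawing G f\<^sub>0 A\<^sub>0"
    and minimal: "card (crossings G f\<^sub>0 A\<^sub>0) = crossing_number G"
    by (rule crossing_number_attained)
  then interpret minimal: arc_drawing G f\<^sub>0 A\<^sub>0
    by simp
  obtain v where v: "v \<notin> verts G"
    using ex_new_if_finite[OF infinite finite_verts] by blast
  obtain a b c f' A' where abc: "distinct [a, b, c]" "triangle_edges a b c \<subseteq> edges G"
    and D': "arc_drawing (delta_Y_graph G a b c v) f' A'"
    and fewer: "card (crossings (delta_Y_graph G a b c v) f' A') < card (crossings G f\<^sub>0 A\<^sub>0)"
    by (rule minimal.delta_Y_fewer_crossings[OF C v])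
  have "card C - card {a, b, c} \<le> card (C - {a, b, c})"
    by (intro diff_card_le_card_Diff) simp
  then have "card C \<le> card (C - {a, b, c}) + 3"
    using abc(1) by simp
  moreover have "crossing_number (delta_Y_graph G a b c v) < crossing_number G"
    using arc_drawing.crossing_number_le[OF D'] fewer minimal by simp
  moreover have "card (verts (delta_Y_graph G a b c v)) = Suc (card (verts G))"
    using v finite_verts by (simp add: delta_Y_graph_def)
  ultimately show thesis
    using that[OF delta_Y_move_delta_Y_graph[OF abc v] _ D' clique_delta_Y_graph[OF C(1)]] by blast
qed

end

text \<open>A move adds one vertex and costs the clique at most three, so the margin in
  \<open>card (verts G) \<le> 2 * card C\<close> shrinks by at most \<open>1 + 2 * 3 = 7\<close>.\<close>

lemma exists_decreasing_delta_Y_sequence: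
  assumes "arc_drawing G f A" "clique G C" "6250 + 3 * k < card C" "card (verts G) + 7 * k \<le> 2 * card C"
    and "infinite (UNIV :: 'a set)"
  shows "\<exists>H :: nat \<Rightarrow> 'a ugraph. H 0 = G \<and> (\<forall>i<k. delta_Y_move (H i) (H (Suc i))) \<and>
    (\<forall>i<k. crossing_number (H i) > crossing_number (H (Suc i)))"
  using assms
proof (induction k arbitrary: G f A C)
  case 0
  show ?case
    by (intro exI[of _ "\<lambda>_. G"]) simp
next
  case (Suc k)
  have "6250 < card C" "card (verts G) \<le> 2 * card C"
    using Suc.prems by simp_all
  then obtain G' f' A' C' where G': "delta_Y_move G G'" "crossing_number G' < crossing_number G"
    and D': "arc_drawing G' f' A'" "clique G' C'" "card C \<le> card C' + 3"
      "card (verts G') = Suc (card (verts G))"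
    by (rule arc_drawing.exists_decreasing_delta_Y_move[OF Suc.prems(1,2) _ _ Suc.prems(5)])
  then obtain H where "H 0 = G'" "\<forall>i<k. delta_Y_move (H i) (H (Suc i))"
    "\<forall>i<k. crossing_number (H i) > crossing_number (H (Suc i))"
    using Suc.IH[OF D'(1,2) _ _ Suc.prems(5)] Suc.prems(3,4) by auto
  then show ?case
    using G' by (intro exI[of _ "case_nat G H"]) (auto simp: less_Suc_eq_0_disj)
qed

theorem theorem3:
  fixes k :: nat
  shows "\<exists>(n::nat) (G :: nat \<Rightarrow> nat ugraph).
           G 0 = complete_graph n \<and>
           (\<forall>i<k. delta_Y_move (G i) (G (Suc i))) \<and>
           (\<forall>i<k. crossing_number (G i) > crossing_number (G (Suc i)))"
proof -
  define n where "n = 6251 + 7 * k"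
  have complete: "complete_graph n = complete_on {1..n}"
    by (simp add: complete_graph_def complete_on_def)
  obtain f A where "arc_drawing (complete_on {1..n}) f A"
    by (rule arc_drawing_complete_on[OF finite_atLeastAtMost])
  then have "arc_drawing (complete_graph n) f A"
    by (simp only: complete)
  moreover have "clique (complete_graph n) {1..n}"
    by (auto simp: complete clique_def edges_complete_on_iff)
  moreover have "card (verts (complete_graph n)) = n"
    by (simp add: complete_graph_def)
  then have "6250 + 3 * k < card {1..n}" "card (verts (complete_graph n)) + 7 * k \<le> 2 * card {1..n}"
    by (simp_all add: n_def)
  ultimately show ?thesis
    using exists_decreasing_delta_Y_sequence[OF _ _ _ _ infinite_UNIV_nat] by blast
qed

end
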